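(* Assume the Ultrapower Axiom. Let $\delta$ be a cardinal and let $U,W\in\mathrm{Un}_{\le\delta}$. Then $U\mathrel{I}W$ if and only if $j_U(|W|_{\le\delta})=|W|_{\le\delta}$.
   Context: For a countably complete ultrafilter $U$, $j_U:V\to M_U$ is its ultrapower and $[\mathrm{id}]_U$ the class of the identity. $\mathrm{Un}_{\le\delta}$ is the class of countably complete ultrafilters $U$ on ordinals $\lambda\le\delta$ that are uniform ($\lambda\setminus\beta\in U$ for all $\beta<\lambda$). The internal relation: $U\mathrel{I}W$ iff $j_U\restriction x\in M_W$ for all $x\in M_W$. An internal ultrapower embedding of an inner model $M$ is $j^M_Z:M\to M^M_Z$ for some $Z\in M$ countably complete in $M$. The Ultrapower Axiom (UA): for all countably complete $U,W$ there are internal ultrapower embeddings $i_0:M_U\to N$, $i_1:M_W\to N$ with $i_0\circ j_U=i_1\circ j_W$. A pointed ultrapower is a pair $(M,\alpha)$ with $M$ an ultrapower of $V$ by a countably complete ultrafilter and $\alpha$ an ordinal; $\mathscr P_{\le\delta}$ is the class of pointed ultrapowers $(M_U,\alpha)$ with $U\in\mathrm{Un}_{\le\delta}$. The completed seed order is defined by $(M_0,\alpha_0)<_S(M_1,\alpha_1)$ iff there are an elementary embedding $i_0:M_0\to N$ and an internal ultrapower embedding $i_1:M_1\to N$ with $i_0(\alpha_0)<i_1(\alpha_1)$; it is wellfounded. For a pointed ultrapower $\mathcal M$, $|\mathcal M|_{\le\delta}$ is its rank in the completed seed order restricted to $\mathscr P_{\le\delta}$, and for $W\in\mathrm{Un}$,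 $|W|_{\le\delta}=|(M_W,[\mathrm{id}]_W)|_{\le\delta}$. *)

theory Defs
  imports Main
begin

text \<open>
  The universe of sets is a type whose elements are the sets; \<open>elts x\<close> is the extension
  of \<open>x\<close>, so \<open>a \<in> elts x\<close> is set-theoretic membership.  Classes are arbitrary values of type
  \<open>'v set\<close> and class functions are arbitrary HOL functions, so separation and
  replacement are stated for all of these (as in Kelley-Morse class theory).
\<close>

class zfc_universe =
  fixes elts :: "'a \<Rightarrow> 'a set"
  assumes extensionality: "elts x = elts y \<Longrightarrow> x = y"
    and foundation: "elts x \<noteq> {} \<Longrightarrow> \<exists>y\<in>elts x. elts y \<inter> elts x = {}"
    and pairing: "\<exists>z. elts z = {x, y}"
    and union_set: "\<exists>u. elts u = (\<Union>y\<in>elts x. elts y)"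
    and powerset: "\<exists>p. elts p = {y. elts y \<subseteq> elts x}"
    and infinity:
      "\<exists>w. (\<exists>e\<in>elts w. elts e = {}) \<and> (\<forall>y\<in>elts w. \<exists>s\<in>elts w. elts s = insert y (elts y))"
    and separation: "\<exists>y. elts y = {z \<in> elts x. P z}"
    and replacement: "\<exists>y. elts y = F ` elts x"
    and choice_sets:
      "\<lbrakk>\<forall>y\<in>elts x. elts y \<noteq> {}; \<forall>y\<in>elts x. \<forall>z\<in>elts x. y \<noteq> z \<longrightarrow> elts y \<inter> elts z = {}\<rbrakk>
        \<Longrightarrow> \<exists>c. \<forall>y\<in>elts x. \<exists>!z. z \<in> elts c \<and> z \<in> elts y"


subsection \<open>Basic set theory\<close>

text \<open>Only meaningful when the class \<open>X\<close> is a set.\<close>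

definition set_of :: "'v::zfc_universe set \<Rightarrow> 'v" where
  "set_of X = (THE x. elts x = X)"

lemma set_of_elts [simp]: "set_of (elts x) = x"
  unfolding set_of_def by (blast intro: extensionality)

lemma elts_set_of: "X \<in> range elts \<Longrightarrow> elts (set_of X) = X"
  by auto

definition opair :: "'v::zfc_universe \<Rightarrow> 'v \<Rightarrow> 'v" where
  "opair x y = set_of {set_of {x}, set_of {x, y}}"

text \<open>The restriction of the class function \<open>F\<close> to the set \<open>X\<close>, as a set of ordered pairs.\<close>

definition restr :: "('v::zfc_universe \<Rightarrow> 'v) \<Rightarrow> 'v \<Rightarrow> 'v" where
  "restr F X = set_of ((\<lambda>a. opair a (F a)) ` elts X)"

definition function_on :: "'v::zfc_universe \<Rightarrow> 'v \<Rightarrow> bool" where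
  "function_on f X \<longleftrightarrow> (\<exists>F. f = restr F X)"

definition app :: "'v::zfc_universe \<Rightarrow> 'v \<Rightarrow> 'v" where
  "app f x = (THE y. opair x y \<in> elts f)"

definition succ :: "'v::zfc_universe \<Rightarrow> 'v" where
  "succ x = set_of (insert x (elts x))"

primrec vnat :: "nat \<Rightarrow> 'v::zfc_universe" where
  "vnat 0 = set_of {}"
| "vnat (Suc n) = succ (vnat n)"

definition omega :: "'v::zfc_universe" where
  "omega = set_of (range vnat)"

definition transitive :: "'v::zfc_universe \<Rightarrow> bool" where
  "transitive x \<longleftrightarrow> (\<forall>y\<in>elts x. elts y \<subseteq> elts x)"

text \<open>By foundation this is von Neumann's notion; the order of the ordinals is membership.\<close>

definition ordinal :: "'v::zfc_universe \<Rightarrow> bool" where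
  "ordinal x \<longleftrightarrow> transitive x \<and> (\<forall>y\<in>elts x. transitive y)"

definition cardinal :: "'v::zfc_universe \<Rightarrow> bool" where
  "cardinal x \<longleftrightarrow> ordinal x \<and> (\<forall>y\<in>elts x. \<nexists>f. bij_betw f (elts y) (elts x))"


subsection \<open>Countably complete ultrafilters and their ultrapowers\<close>

text \<open>The underlying set of an ultrafilter is its largest element, hence its union.\<close>

definition uspace :: "'v::zfc_universe \<Rightarrow> 'v" where
  "uspace Z = set_of (\<Union>A\<in>elts Z. elts A)"

text \<open>
  \<open>cc_ultrafilter M Z\<close>: \<open>Z\<close> is an element of the transitive class \<open>M\<close> and \<open>M\<close> believes that \<open>Z\<close>
  is a countably complete (possibly principal) ultrafilter on \<open>uspace Z\<close>.
  The case \<open>M = UNIV\<close> is the notion of \<open>V\<close>.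
\<close>

definition cc_ultrafilter :: "'v::zfc_universe set \<Rightarrow> 'v \<Rightarrow> bool" where
  "cc_ultrafilter M Z \<longleftrightarrow>
     Z \<in> M \<and>
     uspace Z \<in> elts Z \<and>
     set_of {} \<notin> elts Z \<and>
     (\<forall>A\<in>elts Z. \<forall>B\<in>M. elts A \<subseteq> elts B \<and> elts B \<subseteq> elts (uspace Z) \<longrightarrow> B \<in> elts Z) \<and>
     (\<forall>A\<in>elts Z. \<forall>B\<in>elts Z. set_of (elts A \<inter> elts B) \<in> elts Z) \<and>
     (\<forall>A\<in>M. elts A \<subseteq> elts (uspace Z) \<longrightarrow>
        A \<in> elts Z \<or> set_of (elts (uspace Z) - elts A) \<in> elts Z) \<and>
     (\<forall>s\<in>M. function_on s omega \<and> (\<forall>n\<in>elts omega. app s n \<in> elts Z) \<longrightarrow>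
        set_of (\<Inter>n\<in>elts omega. elts (app s n)) \<in> elts Z)"

definition ult_funs :: "'v::zfc_universe set \<Rightarrow> 'v \<Rightarrow> 'v set" where
  "ult_funs M Z = {f \<in> M. function_on f (uspace Z)}"

text \<open>The membership relation of the uncollapsed ultrapower of \<open>M\<close> by \<open>Z\<close>, on representatives.\<close>

definition ult_mem :: "'v::zfc_universe set \<Rightarrow> 'v \<Rightarrow> ('v \<times> 'v) set" where
  "ult_mem M Z =
     {(g, f). g \<in> ult_funs M Z \<and> f \<in> ult_funs M Z \<and>
        set_of {x \<in> elts (uspace Z). app g x \<in> elts (app f x)} \<in> elts Z}"

text \<open>
  \<open>ult_class M Z f\<close> is the element represented by \<open>f\<close> of the transitive collapse of the
  ultrapower.  As \<open>f\<close> and \<open>f'\<close> that agree on a set in \<open>Z\<close> have the same predecessors under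
  \<open>ult_mem\<close>, collapsing representatives is the same as collapsing equivalence classes.
\<close>

definition ult_class :: "'v::zfc_universe set \<Rightarrow> 'v \<Rightarrow> 'v \<Rightarrow> 'v" where
  "ult_class M Z = wfrec (ult_mem M Z) (\<lambda>c f. set_of (c ` {g. (g, f) \<in> ult_mem M Z}))"

definition Ult :: "'v::zfc_universe set \<Rightarrow> 'v \<Rightarrow> 'v set" where
  "Ult M Z = ult_class M Z ` ult_funs M Z"

definition ult_emb :: "'v::zfc_universe set \<Rightarrow> 'v \<Rightarrow> 'v \<Rightarrow> 'v" where
  "ult_emb M Z x = ult_class M Z (restr (\<lambda>_. x) (uspace Z))"

definition ultrapower :: "'v::zfc_universe \<Rightarrow> 'v set" where
  "ultrapower U = Ult UNIV U"

definition j_ult :: "'v::zfc_universe \<Rightarrow> 'v \<Rightarrow> 'v" where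
  "j_ult U = ult_emb UNIV U"

definition seed :: "'v::zfc_universe \<Rightarrow> 'v" where
  "seed U = ult_class UNIV U (restr (\<lambda>a. a) (uspace U))"

definition Un_le :: "'v::zfc_universe \<Rightarrow> 'v set" where
  "Un_le \<delta> =
     {U. cc_ultrafilter UNIV U \<and>
         ordinal (uspace U) \<and> elts (uspace U) \<subseteq> elts \<delta> \<and>
         (\<forall>\<beta>\<in>elts (uspace U). set_of (elts (uspace U) - elts \<beta>) \<in> elts U)}"

definition internal_rel :: "'v::zfc_universe \<Rightarrow> 'v \<Rightarrow> bool" where
  "internal_rel U W \<longleftrightarrow> (\<forall>x\<in>ultrapower W. restr (j_ult U) x \<in> ultrapower W)"


subsection \<open>Elementary and internal ultrapower embeddings\<close>

datatype fm = Mem nat nat | Eq nat nat | Neg fm | Conj fm fm | All nat fm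

primrec sat :: "'v::zfc_universe set \<Rightarrow> fm \<Rightarrow> (nat \<Rightarrow> 'v) \<Rightarrow> bool" where
  "sat M (Mem m n) e \<longleftrightarrow> e m \<in> elts (e n)"
| "sat M (Eq m n) e \<longleftrightarrow> e m = e n"
| "sat M (Neg p) e \<longleftrightarrow> \<not> sat M p e"
| "sat M (Conj p q) e \<longleftrightarrow> sat M p e \<and> sat M q e"
| "sat M (All n p) e \<longleftrightarrow> (\<forall>x\<in>M. sat M p (e(n := x)))"

definition elementary_embedding ::
  "'v::zfc_universe set \<Rightarrow> 'v set \<Rightarrow> ('v \<Rightarrow> 'v) \<Rightarrow> bool" where
  "elementary_embedding M N i \<longleftrightarrow>
     i ` M \<subseteq> N \<and> (\<forall>p e. range e \<subseteq> M \<longrightarrow> (sat M p e \<longleftrightarrow> sat N p (\<lambda>n. i (e n))))"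

definition internal_ultrapower_embedding ::
  "'v::zfc_universe set \<Rightarrow> 'v set \<Rightarrow> ('v \<Rightarrow> 'v) \<Rightarrow> bool" where
  "internal_ultrapower_embedding M N i \<longleftrightarrow>
     (\<exists>Z. cc_ultrafilter M Z \<and> N = Ult M Z \<and> (\<forall>x\<in>M. i x = ult_emb M Z x))"

definition ultrapower_axiom :: "'v::zfc_universe itself \<Rightarrow> bool" where
  "ultrapower_axiom _ \<longleftrightarrow>
     (\<forall>U W::'v. cc_ultrafilter UNIV U \<and> cc_ultrafilter UNIV W \<longrightarrow>
        (\<exists>N i0 i1. internal_ultrapower_embedding (ultrapower U) N i0 \<and>
                   internal_ultrapower_embedding (ultrapower W) N i1 \<and>
                   i0 \<circ> j_ult U = i1 \<circ> j_ult W))"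


subsection \<open>The completed seed order and its rank\<close>

type_synonym 'v pointed = "'v set \<times> 'v"

definition pointed_le :: "'v::zfc_universe \<Rightarrow> 'v pointed set" where
  "pointed_le \<delta> = {(ultrapower U, \<alpha>) | U \<alpha>. U \<in> Un_le \<delta> \<and> ordinal \<alpha>}"

definition seed_less :: "'v::zfc_universe pointed \<Rightarrow> 'v pointed \<Rightarrow> bool" where
  "seed_less P Q \<longleftrightarrow>
     (\<exists>N i0 i1. elementary_embedding (fst P) N i0 \<and>
                internal_ultrapower_embedding (fst Q) N i1 \<and>
                i0 (snd P) \<in> elts (i1 (snd Q)))"

text \<open>
  The rank of \<open>Q\<close> is the least ordinal above the ranks of all its predecessors.  Only the
  predecessors are required to lie in \<open>pointed_le \<delta>\<close>: for \<open>Q\<close> in \<open>pointed_le \<delta>\<close> this is the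
  rank in the restricted order, and it also makes sense for other pointed ultrapowers.
\<close>

definition pointed_rank :: "'v::zfc_universe \<Rightarrow> 'v pointed \<Rightarrow> 'v" where
  "pointed_rank \<delta> =
     (let R = {(P, Q). P \<in> pointed_le \<delta> \<and> seed_less P Q}
      in wfrec R (\<lambda>r Q. set_of (\<Union>P\<in>{P. (P, Q) \<in> R}. elts (succ (r P)))))"

definition seed_rank :: "'v::zfc_universe \<Rightarrow> 'v \<Rightarrow> 'v" where
  "seed_rank \<delta> W = pointed_rank \<delta> (ultrapower W, seed W)"

end

theory Submission
  imports Defs
begin

text \<open>
  Every model that occurs is the ultrapower of \<open>V\<close> by a sum of ultrafilters, and its elements are
  handled as functions modulo such a sum.  Elementary embeddings transport internal ultrapowers, so
  a descending sequence in the seed order yields an internal iteration along which ordinals descend;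
  countable completeness turns it into a descending sequence in \<open>V\<close>.

  By the Ultrapower Axiom the seed order is total up to equivalence, and every pointed ultrapower in
  \<open>pointed_le \<delta>\<close> is equivalent to an ultraproduct, by \<open>U\<close>, of members of \<open>pointed_le \<delta>\<close>.  Hence
  ranks commute with ultraproducts by \<open>U\<close>, and \<open>j\<^sub>U(|W|)\<close> is the rank of \<open>(j\<^sub>U(M\<^sub>W), j\<^sub>U([id]\<^sub>W))\<close>.
  This pointed ultrapower is always above \<open>(M\<^sub>W, [id]\<^sub>W)\<close>.  If the two are equivalent, then a
  comparison yields in \<open>M\<^sub>W\<close> the ultrafilter derived from the restriction of \<open>j\<^sub>U\<close> to \<open>M\<^sub>W\<close> and
  the seed of \<open>U\<close>, so that this restriction is an internal ultrapower embedding of \<open>M\<^sub>W\<close>; the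
  converse is immediate.
\<close>

section \<open>Sets, pairs, functions and ordinals\<close>

text \<open>The rank is a recursion over classes and the seed order quantifies over class
  embeddings, so neither is at hand as a first-order formula to be moved through an ultrapower. The
  theorem of Los moves only the notions on which internal ultrapowers rest: membership, functions,
  countably complete ultrafilters, membership modulo one. Everything above them is transferred by
  choosing witnesses for almost every index and gluing them, since an almost-everywhere quantifier
  commutes with the quantifiers of the logic up to choice functions. This is why ultrafilters become
  quantifiers \<open>ae U\<close> on arbitrary predicates, and elements of ultrapowers become
  classes \<open>cls U f\<close> of arbitrary functions.

  The bound \<delta> matters where a sum of ultrafilters must again be represented on an ordinal at
  most \<delta>: a sum lives on pairs, and pairs from \<delta> are recoded in \<delta>.

  Equal ranks force internality because a comparison of the product of \<open>U\<close> and
  \<open>W\<close> with \<open>W\<close> sends \<open>j_ult U (seed W)\<close> and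
  \<open>seed W\<close> to the same point. The other coordinate is then read off in an internal
  ultrapower of the model of \<open>W\<close>, which exchanges the two factors.\<close>

definition small :: "'v::zfc_universe set \<Rightarrow> bool" where
  "small X \<longleftrightarrow> X \<in> range elts"

lemma small_elts [simp, intro]: "small (elts x)"
  by (simp add: small_def)

lemma elts_set_of_small [simp]: "small X \<Longrightarrow> elts (set_of X) = X"
  by (simp add: small_def elts_set_of)

lemma small_subset: "small X \<Longrightarrow> Y \<subseteq> X \<Longrightarrow> small Y"
proof -
  assume "small X" and Y: "Y \<subseteq> X"
  then obtain x where x: "X = elts x" by (auto simp: small_def)
  obtain y where "elts y = {z \<in> elts x. z \<in> Y}" using separation[of x "\<lambda>z. z \<in> Y"] by blast
  then have "elts y = Y" using Y x by auto
  then show "small Y" unfolding small_def by blast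
qed

lemma small_Collect [simp]: "small {z \<in> elts x. P z}"
  by (rule small_subset[OF small_elts[of x]]) auto

lemma small_Diff [simp]: "small (elts x - A)"
  by (rule small_subset[OF small_elts[of x]]) auto

lemma small_Int [simp]: "small (elts x \<inter> A)"
  by (rule small_subset[OF small_elts[of x]]) auto

lemma small_image [simp]: "small X \<Longrightarrow> small (F ` X)" for F :: "'v::zfc_universe \<Rightarrow> 'v"
proof -
  assume "small X"
  then obtain x where "X = elts x" by (auto simp: small_def)
  then show "small (F ` X)" using replacement[of F x] by (metis small_elts)
qed

lemma small_doubleton [simp]: "small {x, y}"
  using pairing[of x y] by (metis small_elts)

lemma small_singleton [simp]: "small {x}"
  using small_doubleton[of x x] by simp

lemma small_empty [simp]: "small {}"
  using small_subset[OF small_singleton] by blast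

lemma small_UN:
  fixes f :: "'v::zfc_universe \<Rightarrow> 'v set"
  assumes "small X" "\<And>x. x \<in> X \<Longrightarrow> small (f x)"
  shows "small (\<Union>x\<in>X. f x)"
proof -
  have "small ((\<lambda>x. set_of (f x)) ` X)" using assms by simp
  then obtain z where z: "elts z = (\<lambda>x. set_of (f x)) ` X" unfolding small_def by force
  obtain u where "elts u = (\<Union>y\<in>elts z. elts y)" using union_set by blast
  then have "elts u = (\<Union>x\<in>X. f x)" using z assms(2) by simp
  then show ?thesis by (metis small_elts)
qed

lemma small_Un [simp]: "small X \<Longrightarrow> small Y \<Longrightarrow> small (X \<union> Y)"
proof -
  assume X: "small X" and Y: "small Y"
  have "small (\<Union>x\<in>{set_of X, set_of Y}. elts x)" by (rule small_UN) simp_all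
  then show ?thesis using X Y by simp
qed

lemma small_insert [simp]: "small X \<Longrightarrow> small (insert x X)"
  using small_Un[of "{x}" X] by simp

lemma small_Pow [simp]: "small {y. elts y \<subseteq> elts x}"
  using powerset[of x] by (metis small_elts)

lemma not_mem_self: "x \<notin> elts x"
  using foundation[of "set_of {x}"] by auto

lemma elts_succ [simp]: "elts (succ x) = insert x (elts x)"
  by (simp add: succ_def)

lemma vnat_less: "m < n \<Longrightarrow> vnat m \<in> elts (vnat n)"
  by (induction n) (auto simp: less_Suc_eq)

lemma inj_vnat: "inj vnat"
  by (metis injI linorder_neqE_nat not_mem_self vnat_less)

lemma small_range_vnat: "small (range (vnat :: nat \<Rightarrow> 'v::zfc_universe))"
proof -
  obtain w :: 'v where w: "\<exists>e\<in>elts w. elts e = {}"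
    "\<forall>y\<in>elts w. \<exists>s\<in>elts w. elts s = insert y (elts y)"
    using infinity by blast
  have "vnat n \<in> elts w" for n
  proof (induction n)
    case 0
    then show ?case using w(1) by (metis set_of_elts vnat.simps(1))
  next
    case (Suc n)
    then show ?case using w(2) by (metis elts_succ extensionality vnat.simps(2))
  qed
  then show ?thesis by (intro small_subset[OF small_elts[of w]]) auto
qed

lemma elts_omega [simp]: "elts omega = range vnat"
  by (simp add: omega_def small_range_vnat)

lemma small_range_nat: "small (range (F :: nat \<Rightarrow> 'v::zfc_universe))"
proof -
  have "range F = (\<lambda>v::'v. F (inv vnat v)) ` range vnat"
    unfolding image_image inv_f_f[OF inj_vnat] ..
  then show ?thesis using small_image[OF small_range_vnat] by metis
qed

text \<open>Foundation is an axiom about sets, while \<open>Q\<close> is a class. It is applied to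
  the part of \<open>Q\<close> inside the transitive closure of \<open>{a}\<close>, which is a set;
  a minimal element of that part is minimal in \<open>Q\<close>.\<close>

lemma wf_mem: "wf {(x, y). x \<in> elts (y :: 'v::zfc_universe)}"
proof (rule wfI_min)
  fix a :: 'v and Q :: "'v set"
  assume a: "a \<in> Q"
  define T where "T = rec_nat (elts a) (\<lambda>_ X. \<Union>x\<in>X. elts x)"
  have T: "T 0 = elts a" "T (Suc n) = (\<Union>x\<in>T n. elts x)" for n by (simp_all add: T_def)
  have sm: "small (T n)" for n by (induction n) (auto simp: T intro: small_UN)
  have "small (\<Union>x\<in>range (\<lambda>n. set_of (T n)). elts x)"
    by (rule small_UN[OF small_range_nat]) simp
  then have smU: "small (\<Union>n. T n)" using sm by (simp add: image_image)
  define X where "X = insert a (\<Union>n. T n) \<inter> Q"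
  have "small X" unfolding X_def by (rule small_subset[of "insert a (\<Union>n. T n)"]) (use smU in auto)
  moreover have "X \<noteq> {}" using a by (auto simp: X_def)
  ultimately obtain m where m: "m \<in> X" "elts m \<inter> X = {}"
    using foundation[of "set_of X"] by auto
  have "elts m \<subseteq> (\<Union>n. T n)"
  proof (cases "m = a")
    case True
    then show ?thesis using T(1) by auto
  next
    case False
    then obtain n where "m \<in> T n" using m(1) by (auto simp: X_def)
    then have "elts m \<subseteq> T (Suc n)" by (auto simp: T(2))
    then show ?thesis by blast
  qed
  then have "\<And>y. y \<in> elts m \<Longrightarrow> y \<notin> Q" using m(2) by (auto simp: X_def)
  then show "\<exists>z\<in>Q. \<forall>y. (y, z) \<in> {(x, y). x \<in> elts y} \<longrightarrow> y \<notin> Q"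
    using m(1) by (auto simp: X_def)
qed

lemma mem_induct: "(\<And>x. (\<And>y. y \<in> elts x \<Longrightarrow> P y) \<Longrightarrow> P x) \<Longrightarrow> P x"
  using wf_mem by (rule wf_induct_rule) auto

lemma not_mem_chain: "\<not> (\<forall>n. f (Suc n) \<in> elts (f n))"
  using wf_mem unfolding wf_iff_no_infinite_down_chain by blast

lemma not_mem_sym: "x \<in> elts y \<Longrightarrow> y \<notin> elts x"
  using foundation[of "set_of {x, y}"] by auto

section \<open>Ordered pairs and functions as sets\<close>

lemma elts_opair [simp]: "elts (opair x y) = {set_of {x}, set_of {x, y}}"
  by (simp add: opair_def)

lemma set_of_eq_iff: "small X \<Longrightarrow> small Y \<Longrightarrow> set_of X = set_of Y \<longleftrightarrow> X = Y"
  by (metis elts_set_of_small)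

lemma opair_eq_iff [simp]: "opair x y = opair x' y' \<longleftrightarrow> x = x' \<and> y = y'"
proof -
  have "opair x y = opair x' y' \<longleftrightarrow> {set_of {x}, set_of {x, y}} = {set_of {x'}, set_of {x', y'}}"
    by (simp add: opair_def set_of_eq_iff)
  also have "\<dots> \<longleftrightarrow> x = x' \<and> y = y'"
    by (auto simp: doubleton_eq_iff set_of_eq_iff singleton_insert_inj_eq singleton_insert_inj_eq')
  finally show ?thesis .
qed

definition pfst :: "'v::zfc_universe \<Rightarrow> 'v" where
  "pfst p = (THE x. \<exists>y. p = opair x y)"

definition psnd :: "'v::zfc_universe \<Rightarrow> 'v" where
  "psnd p = (THE y. \<exists>x. p = opair x y)"

lemma pfst_opair [simp]: "pfst (opair x y) = x"
  by (auto simp: pfst_def)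

lemma psnd_opair [simp]: "psnd (opair x y) = y"
  by (auto simp: psnd_def)

lemma elts_restr [simp]: "elts (restr F X) = (\<lambda>a. opair a (F a)) ` elts X"
  by (simp add: restr_def)

lemma app_restr [simp]: "a \<in> elts X \<Longrightarrow> app (restr F X) a = F a"
  unfolding app_def by (rule the_equality) auto

lemma restr_cong: "(\<And>x. x \<in> elts X \<Longrightarrow> F x = G x) \<Longrightarrow> restr F X = restr G X"
  by (rule extensionality) auto

lemma function_on_restr [simp]: "function_on (restr F X) X"
  by (auto simp: function_on_def)

lemma function_on_app: "function_on f X \<Longrightarrow> f = restr (app f) X"
  unfolding function_on_def by (metis app_restr restr_cong)

lemma function_on_iff:
  "function_on f X \<longleftrightarrow>
     (\<forall>p\<in>elts f. \<exists>a\<in>elts X. \<exists>b. p = opair a b) \<and>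
     (\<forall>a\<in>elts X. \<exists>b. opair a b \<in> elts f) \<and>
     (\<forall>a\<in>elts X. \<forall>b c. opair a b \<in> elts f \<longrightarrow> opair a c \<in> elts f \<longrightarrow> b = c)"
  (is "_ \<longleftrightarrow> ?R")
proof
  show "function_on f X \<Longrightarrow> ?R" by (force simp: function_on_def)
  assume R: ?R
  define F where "F a = (SOME b. opair a b \<in> elts f)" for a
  have F: "opair a (F a) \<in> elts f" if "a \<in> elts X" for a
    unfolding F_def using R that by (metis someI)
  have "f = restr F X"
  proof (rule extensionality, rule set_eqI, rule iffI)
    fix p assume p: "p \<in> elts f"
    then obtain a b where ab: "a \<in> elts X" "p = opair a b" using R by blast
    then have "b = F a" using R F p by blast
    then show "p \<in> elts (restr F X)" using ab by simp
  next
    fix p assume "p \<in> elts (restr F X)"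
    then show "p \<in> elts f" using F by auto
  qed
  then show "function_on f X" by simp
qed

section \<open>Ordinals\<close>

lemma ordinal_transitive: "ordinal x \<Longrightarrow> y \<in> elts x \<Longrightarrow> z \<in> elts y \<Longrightarrow> z \<in> elts x"
  by (auto simp: ordinal_def transitive_def)

lemma ordinal_mem: "ordinal x \<Longrightarrow> y \<in> elts x \<Longrightarrow> ordinal y"
  unfolding ordinal_def by (metis subsetD transitive_def)

lemma ordinal_linear: "ordinal x \<Longrightarrow> ordinal y \<Longrightarrow> x \<in> elts y \<or> x = y \<or> y \<in> elts x"
proof (induction x arbitrary: y rule: mem_induct)
  case (1 x)
  note IHx = 1
  from \<open>ordinal y\<close> show ?case
  proof (induction y rule: mem_induct)
    case (1 y)
    show ?case
    proof (rule ccontr)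
      assume neg: "\<not> ?case"
      have "elts x \<subseteq> elts y"
      proof
        fix z assume z: "z \<in> elts x"
        then have "z \<in> elts y \<or> z = y \<or> y \<in> elts z"
          using IHx(1)[OF z, of y] IHx(2) 1(2) ordinal_mem by blast
        then show "z \<in> elts y" using neg z ordinal_transitive[OF IHx(2)] by blast
      qed
      moreover have "elts y \<subseteq> elts x"
      proof
        fix z assume z: "z \<in> elts y"
        then have "x \<in> elts z \<or> x = z \<or> z \<in> elts x"
          using 1(1)[OF z] 1(2) ordinal_mem by blast
        then show "z \<in> elts x" using neg z ordinal_transitive[OF 1(2)] by blast
      qed
      ultimately show False using neg extensionality by blast
    qed
  qed
qed

lemma ordinal_subset_iff:
  "ordinal x \<Longrightarrow> ordinal y \<Longrightarrow> elts x \<subseteq> elts y \<longleftrightarrow> x = y \<or> x \<in> elts y"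
  by (metis not_mem_self ordinal_linear ordinal_transitive subset_eq)

lemma ordinalI: "(\<And>y z. y \<in> elts x \<Longrightarrow> z \<in> elts y \<Longrightarrow> z \<in> elts x) \<Longrightarrow>
    (\<And>y. y \<in> elts x \<Longrightarrow> ordinal y) \<Longrightarrow> ordinal x"
  by (auto simp: ordinal_def transitive_def)

section \<open>Ultrafilters as quantifiers\<close>

abbreviation ccu :: "'v::zfc_universe \<Rightarrow> bool" where
  "ccu U \<equiv> cc_ultrafilter UNIV U"

definition ae :: "'v::zfc_universe \<Rightarrow> ('v \<Rightarrow> bool) \<Rightarrow> bool" where
  "ae U P \<longleftrightarrow> set_of {x \<in> elts (uspace U). P x} \<in> elts U"

text \<open>A countably complete ultrafilter on a type, read as a generalized quantifier. Arbitrary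
  predicates replace measured sets, so that sums, images and derived ultrafilters are plain
  compositions of quantifiers.\<close>

definition ccq :: "(('a \<Rightarrow> bool) \<Rightarrow> bool) \<Rightarrow> bool" where
  "ccq F \<longleftrightarrow>
     (\<forall>P Q. (\<forall>x. P x \<longrightarrow> Q x) \<longrightarrow> F P \<longrightarrow> F Q) \<and>
     (\<forall>P. F (\<lambda>x. \<not> P x) \<longleftrightarrow> \<not> F P) \<and>
     (\<forall>P :: nat \<Rightarrow> 'a \<Rightarrow> bool. (\<forall>n. F (P n)) \<longrightarrow> F (\<lambda>x. \<forall>n. P n x))"

lemma ccq_mono: "ccq F \<Longrightarrow> F P \<Longrightarrow> (\<And>x. P x \<Longrightarrow> Q x) \<Longrightarrow> F Q"
  unfolding ccq_def by blast

lemma ccq_not: "ccq F \<Longrightarrow> F (\<lambda>x. \<not> P x) \<longleftrightarrow> \<not> F P"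
  unfolding ccq_def by blast

lemma ccq_nat:
  assumes F: "ccq F"
  shows "F (\<lambda>x. \<forall>n::nat. P n x) \<longleftrightarrow> (\<forall>n. F (P n))"
proof
  assume P: "F (\<lambda>x. \<forall>n. P n x)"
  show "\<forall>n. F (P n)" 
    using ccq_mono[of F "\<lambda>x. \<forall>n. P n x" "P n" for n] F P by blast
qed (use F in \<open>simp add: ccq_def\<close>)

text \<open>Properness comes from the clause for negation: exactly one of the two constant
  predicates holds, and monotonicity decides for \<open>True\<close>.\<close>

lemma ccq_const: "ccq F \<Longrightarrow> F (\<lambda>x. c) \<longleftrightarrow> c"
  using ccq_not[of F "\<lambda>x. c"] ccq_mono[of F "\<lambda>x. False" "\<lambda>x. True"] by (cases c) auto

lemma ccq_conj: "ccq F \<Longrightarrow> F (\<lambda>x. P x \<and> Q x) \<longleftrightarrow> F P \<and> F Q"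
proof -
  assume F: "ccq F"
  \<comment> \<open>Binary conjunction is the countable conjunction of \<open>P\<close>,
    \<open>Q\<close>, \<open>Q\<close>, and so on.\<close>
  have all: "(\<forall>n. R n) \<longleftrightarrow> R 0 \<and> (\<forall>n. R (Suc n))" for R by (metis not0_implies_Suc)
  show ?thesis
    using ccq_nat[OF F, of "case_nat P (\<lambda>_. Q)"] by (simp add: all)
qed

lemma ccq_imp: "ccq F \<Longrightarrow> F (\<lambda>x. P x \<longrightarrow> Q x) \<longleftrightarrow> (F P \<longrightarrow> F Q)"
  using ccq_not[of F "\<lambda>x. P x \<and> \<not> Q x"] ccq_conj[of F P "\<lambda>x. \<not> Q x"] ccq_not[of F Q] by simp

lemma ccq_disj: "ccq F \<Longrightarrow> F (\<lambda>x. P x \<or> Q x) \<longleftrightarrow> F P \<or> F Q"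
  using ccq_imp[of F "\<lambda>x. \<not> P x" Q] ccq_not[of F P] by (simp add: disj_imp)

text \<open>Choice in the logic selects the witnesses \<open>g x\<close> uniformly, whatever their
  type. This is the quantifier step of the theorem of Los, and it serves equally for witnesses that
  are embeddings or families of ultrafilters.\<close>

lemma ccq_ex_choice:
  assumes F: "ccq F"
  shows "F (\<lambda>x. \<exists>y. P x y) \<longleftrightarrow> (\<exists>g. F (\<lambda>x. P x (g x)))"
proof
  assume "F (\<lambda>x. \<exists>y. P x y)"
  then have "F (\<lambda>x. P x (SOME y. P x y))"
    using ccq_mono[of F "\<lambda>x. \<exists>y. P x y" "\<lambda>x. P x (SOME y. P x y)"] F by (simp add: some_eq_ex)
  then show "\<exists>g. F (\<lambda>x. P x (g x))" by (rule exI[of _ "\<lambda>x. SOME y. P x y"])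
next
  assume "\<exists>g. F (\<lambda>x. P x (g x))"
  then obtain g where "F (\<lambda>x. P x (g x))" ..
  then show "F (\<lambda>x. \<exists>y. P x y)"
    using ccq_mono[of F "\<lambda>x. P x (g x)" "\<lambda>x. \<exists>y. P x y"] F by blast
qed

lemma ccq_all_choice: "ccq F \<Longrightarrow> F (\<lambda>x. \<forall>y. P x y) \<longleftrightarrow> (\<forall>g. F (\<lambda>x. P x (g x)))"
  using ccq_ex_choice[of F "\<lambda>x y. \<not> P x y"] ccq_not[of F "\<lambda>x. \<exists>y. \<not> P x y"]
    ccq_not[of F "\<lambda>x. P x (g x)" for g]
  by simp

lemma ccq_exD: "ccq F \<Longrightarrow> F P \<Longrightarrow> \<exists>x. P x"
  using ccq_const[of F False] ccq_mono[of F P "\<lambda>_. False"] by blast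

lemma ccq_map:
  assumes F: "ccq F"
  shows "ccq (\<lambda>P. F (\<lambda>x. P (h x)))"
  unfolding ccq_def[of "\<lambda>P. F (\<lambda>x. P (h x))"] ccq_not[OF F] ccq_nat[OF F]
  using ccq_mono[of F "\<lambda>x. P (h x)" "\<lambda>x. Q (h x)" for P Q] F by blast

lemma elts_uspace: "elts (uspace U) = (\<Union>A\<in>elts U. elts A)"
  unfolding uspace_def by (rule elts_set_of_small, rule small_UN) auto

lemma ae_cong: "(\<And>x. x \<in> elts (uspace U) \<Longrightarrow> P x = Q x) \<Longrightarrow> ae U P = ae U Q"
  unfolding ae_def by (metis (mono_tags, lifting) Collect_cong)

lemma ae_uspace: "ccu U \<Longrightarrow> ae U (\<lambda>x. x \<in> elts (uspace U))"
  by (simp add: ae_def cc_ultrafilter_def)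

lemma ccu_D:
  assumes "ccu U"
  shows "uspace U \<in> elts U" "set_of {} \<notin> elts U"
    "\<And>A B. A \<in> elts U \<Longrightarrow> elts A \<subseteq> elts B \<Longrightarrow> elts B \<subseteq> elts (uspace U) \<Longrightarrow> B \<in> elts U"
    "\<And>A B. A \<in> elts U \<Longrightarrow> B \<in> elts U \<Longrightarrow> set_of (elts A \<inter> elts B) \<in> elts U"
    "\<And>A. elts A \<subseteq> elts (uspace U) \<Longrightarrow> A \<in> elts U \<or> set_of (elts (uspace U) - elts A) \<in> elts U"
    "\<And>s. function_on s omega \<Longrightarrow> \<forall>n\<in>elts omega. app s n \<in> elts U \<Longrightarrow>
        set_of (\<Inter>n\<in>elts omega. elts (app s n)) \<in> elts U"
proof -
  note d = assms[unfolded cc_ultrafilter_def ball_UNIV]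
  show "uspace U \<in> elts U" using d by (elim conjE)
  show "set_of {} \<notin> elts U" using d by (elim conjE)
  have "\<forall>A\<in>elts U. \<forall>B. elts A \<subseteq> elts B \<and> elts B \<subseteq> elts (uspace U) \<longrightarrow> B \<in> elts U"
    using d by (elim conjE)
  then show "\<And>A B. A \<in> elts U \<Longrightarrow> elts A \<subseteq> elts B \<Longrightarrow> elts B \<subseteq> elts (uspace U) \<Longrightarrow> B \<in> elts U" by blast
  have "\<forall>A\<in>elts U. \<forall>B\<in>elts U. set_of (elts A \<inter> elts B) \<in> elts U"
    using d by (elim conjE)
  then show "\<And>A B. A \<in> elts U \<Longrightarrow> B \<in> elts U \<Longrightarrow> set_of (elts A \<inter> elts B) \<in> elts U" by blast
  have "\<forall>A. elts A \<subseteq> elts (uspace U) \<longrightarrow> A \<in> elts U \<or> set_of (elts (uspace U) - elts A) \<in> elts U"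
    using d by (elim conjE)
  then show "\<And>A. elts A \<subseteq> elts (uspace U) \<Longrightarrow> A \<in> elts U \<or> set_of (elts (uspace U) - elts A) \<in> elts U"
    by blast
  have "\<forall>s. function_on s omega \<and> (\<forall>n\<in>elts omega. app s n \<in> elts U) \<longrightarrow>
        set_of (\<Inter>n\<in>elts omega. elts (app s n)) \<in> elts U"
    using d by (elim conjE)
  then show "\<And>s. function_on s omega \<Longrightarrow> \<forall>n\<in>elts omega. app s n \<in> elts U \<Longrightarrow>
        set_of (\<Inter>n\<in>elts omega. elts (app s n)) \<in> elts U" by blast
qed

lemma ccq_ae:
  assumes U: "ccu U"
  shows "ccq (ae U)"
  unfolding ccq_def
proof (intro conjI allI impI)
  fix P Q assume PQ: "\<forall>x. P x \<longrightarrow> Q x" and P: "ae U P"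
  show "ae U Q"
    unfolding ae_def by (rule ccu_D(3)[OF U P[unfolded ae_def]]) (use PQ in auto)
next
  fix P
  let ?A = "set_of {x \<in> elts (uspace U). P x}" and ?B = "set_of {x \<in> elts (uspace U). \<not> P x}"
  have "?A \<in> elts U \<or> set_of (elts (uspace U) - elts ?A) \<in> elts U"
    by (rule ccu_D(5)[OF U]) auto
  moreover have "elts (uspace U) - elts ?A = {x \<in> elts (uspace U). \<not> P x}" by auto
  ultimately have "?A \<in> elts U \<or> ?B \<in> elts U" by metis
  moreover have "\<not> (?A \<in> elts U \<and> ?B \<in> elts U)"
  proof
    assume "?A \<in> elts U \<and> ?B \<in> elts U"
    then have "set_of (elts ?A \<inter> elts ?B) \<in> elts U" using ccu_D(4)[OF U] by blast
    moreover have "elts ?A \<inter> elts ?B = {}" by auto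
    ultimately show False using ccu_D(2)[OF U] by metis
  qed
  ultimately show "ae U (\<lambda>x. \<not> P x) \<longleftrightarrow> \<not> ae U P" unfolding ae_def by blast
next
  fix P :: "nat \<Rightarrow> 'a \<Rightarrow> bool"
  assume P: "\<forall>n. ae U (P n)"
  define s where "s = restr (\<lambda>v. set_of {x \<in> elts (uspace U). P (inv vnat v) x}) omega"
  have s: "app s (vnat n) = set_of {x \<in> elts (uspace U). P n x}" for n
    unfolding s_def by (subst app_restr) (simp_all add: inv_f_f[OF inj_vnat])
  have "function_on s omega" by (simp add: s_def)
  moreover have "\<forall>n\<in>elts omega. app s n \<in> elts U" using P by (auto simp: s ae_def)
  ultimately have "set_of (\<Inter>n\<in>elts omega. elts (app s n)) \<in> elts U"
    by (rule ccu_D(6)[OF U])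
  moreover have "(\<Inter>n\<in>elts omega. elts (app s n)) = {x \<in> elts (uspace U). \<forall>n. P n x}"
    by (auto simp: s)
  ultimately show "ae U (\<lambda>x. \<forall>n. P n x)" by (simp add: ae_def)
qed

lemmas ae_not = ccq_not[OF ccq_ae] and ae_conj = ccq_conj[OF ccq_ae]
  and ae_imp = ccq_imp[OF ccq_ae] and ae_disj = ccq_disj[OF ccq_ae]
  and ae_const = ccq_const[OF ccq_ae] and ae_nat = ccq_nat[OF ccq_ae]
  and ae_ex_choice = ccq_ex_choice[OF ccq_ae] and ae_all_choice = ccq_all_choice[OF ccq_ae]
  and ae_exD = ccq_exD[OF ccq_ae]

lemma ae_mono:
  assumes U: "ccu U" and P: "ae U P" and PQ: "\<And>x. x \<in> elts (uspace U) \<Longrightarrow> P x \<Longrightarrow> Q x"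
  shows "ae U Q"
proof -
  have "ae U (\<lambda>x. x \<in> elts (uspace U) \<and> P x)" using P by (simp add: ae_conj[OF U] ae_uspace[OF U])
  then show ?thesis
    using ccq_mono[OF ccq_ae[OF U], of "\<lambda>x. x \<in> elts (uspace U) \<and> P x" Q] PQ by blast
qed

lemma ae_mp: "ccu U \<Longrightarrow> ae U P \<Longrightarrow> ae U Q \<Longrightarrow> (\<And>x. x \<in> elts (uspace U) \<Longrightarrow> P x \<Longrightarrow> Q x \<Longrightarrow> R x) \<Longrightarrow> ae U R"
  using ae_mono[of U "\<lambda>x. P x \<and> Q x" R] by (simp add: ae_conj)

lemma ae_iff:
  assumes U: "ccu U" and PQ: "ae U (\<lambda>x. P x = Q x)"
  shows "ae U P = ae U Q"
  using ae_mp[OF U PQ, of P Q] ae_mp[OF U PQ, of Q P] by blast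

lemma ae_all: "ccu U \<Longrightarrow> (\<And>x. x \<in> elts (uspace U) \<Longrightarrow> P x) \<Longrightarrow> ae U P"
  by (rule ae_mono[OF _ ae_uspace])

section \<open>Ultrafilters from quantifiers that concentrate on a set\<close>

definition mk_uf :: "'v::zfc_universe \<Rightarrow> (('v \<Rightarrow> bool) \<Rightarrow> bool) \<Rightarrow> 'v" where
  "mk_uf X F = set_of {A. elts A \<subseteq> elts X \<and> F (\<lambda>x. x \<in> elts A)}"

lemma elts_mk_uf [simp]: "elts (mk_uf X F) = {A. elts A \<subseteq> elts X \<and> F (\<lambda>x. x \<in> elts A)}"
  unfolding mk_uf_def by (rule elts_set_of_small, rule small_subset[OF small_Pow[of X]]) auto

context
  fixes F :: "('v::zfc_universe \<Rightarrow> bool) \<Rightarrow> bool" and X :: 'v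
  assumes F: "ccq F" and X: "F (\<lambda>x. x \<in> elts X)"
begin

lemma uspace_mk_uf: "uspace (mk_uf X F) = X"
  by (rule extensionality) (use X in \<open>auto simp: elts_uspace\<close>)

lemma ae_mk_uf: "ae (mk_uf X F) P = F P"
  using X by (auto simp: ae_def uspace_mk_uf ccq_conj[OF F])

lemma ccu_mk_uf: "ccu (mk_uf X F)"
  unfolding cc_ultrafilter_def uspace_mk_uf elts_mk_uf
proof (intro conjI ballI impI)
  show "X \<in> {A. elts A \<subseteq> elts X \<and> F (\<lambda>x. x \<in> elts A)}" using X by simp
  show "set_of {} \<notin> {A. elts A \<subseteq> elts X \<and> F (\<lambda>x. x \<in> elts A)}" by (simp add: ccq_const[OF F])
next
  fix A B assume A: "A \<in> {A. elts A \<subseteq> elts X \<and> F (\<lambda>x. x \<in> elts A)}"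
    and B: "elts A \<subseteq> elts B \<and> elts B \<subseteq> elts X"
  have "F (\<lambda>x. x \<in> elts B)"
    using ccq_mono[OF F, of "\<lambda>x. x \<in> elts A" "\<lambda>x. x \<in> elts B"] A B by blast
  then show "B \<in> {A. elts A \<subseteq> elts X \<and> F (\<lambda>x. x \<in> elts A)}" using B by simp
next
  fix A B assume "A \<in> {A. elts A \<subseteq> elts X \<and> F (\<lambda>x. x \<in> elts A)}"
    "B \<in> {A. elts A \<subseteq> elts X \<and> F (\<lambda>x. x \<in> elts A)}"
  then show "set_of (elts A \<inter> elts B) \<in> {A. elts A \<subseteq> elts X \<and> F (\<lambda>x. x \<in> elts A)}"
    by (auto simp: ccq_conj[OF F])
next
  fix A assume "elts A \<subseteq> elts X"
  then show "A \<in> {A. elts A \<subseteq> elts X \<and> F (\<lambda>x. x \<in> elts A)} \<or>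
    set_of (elts X - elts A) \<in> {A. elts A \<subseteq> elts X \<and> F (\<lambda>x. x \<in> elts A)}"
    using X by (auto simp: ccq_conj[OF F] ccq_not[OF F])
next
  fix s :: 'v
  assume s: "function_on s omega \<and>
    (\<forall>n\<in>elts omega. app s n \<in> {A. elts A \<subseteq> elts X \<and> F (\<lambda>x. x \<in> elts A)})"
  then have sub: "(\<Inter>n\<in>elts omega. elts (app s n)) \<subseteq> elts X" by auto
  moreover have "F (\<lambda>x. x \<in> (\<Inter>n\<in>elts omega. elts (app s n)))"
    using s by (simp add: ccq_nat[OF F])
  ultimately show "set_of (\<Inter>n\<in>elts omega. elts (app s n)) \<in>
    {A. elts A \<subseteq> elts X \<and> F (\<lambda>x. x \<in> elts A)}"
    using small_subset[OF small_elts sub] by simp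
qed simp

end

section \<open>Ultrapowers of the universe\<close>

lemma ult_class_rec:
  "wf (ult_mem M Z) \<Longrightarrow>
    ult_class M Z f = set_of (ult_class M Z ` {g. (g, f) \<in> ult_mem M Z})"
  unfolding ult_class_def by (subst wfrec) (auto simp: cut_def intro!: arg_cong[of _ _ set_of])

lemma ult_funs_UNIV: "ult_funs UNIV U = range (\<lambda>f. restr f (uspace U))"
  by (auto simp: ult_funs_def function_on_def)

lemma ult_mem_restr:
  "(restr g (uspace U), restr f (uspace U)) \<in> ult_mem UNIV U \<longleftrightarrow> ae U (\<lambda>x. g x \<in> elts (f x))"
proof -
  have "{x \<in> elts (uspace U). app (restr g (uspace U)) x \<in> elts (app (restr f (uspace U)) x)}
    = {x \<in> elts (uspace U). g x \<in> elts (f x)}" by auto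
  then show ?thesis by (simp add: ult_mem_def ult_funs_UNIV ae_def)
qed

text \<open>Representatives are functions of the logic and are cut down to \<open>uspace U\<close>
  only here, so domains need no tracking when representatives are composed or chosen.\<close>

definition cls :: "'v::zfc_universe \<Rightarrow> ('v \<Rightarrow> 'v) \<Rightarrow> 'v" where
  "cls U f = ult_class UNIV U (restr f (uspace U))"

lemma ultrapower_eq: "ultrapower U = range (cls U)"
  by (auto simp: ultrapower_def Ult_def ult_funs_UNIV cls_def)

lemma j_ult_eq: "j_ult U x = cls U (\<lambda>_. x)"
  by (simp add: j_ult_def ult_emb_def cls_def)

lemma seed_eq: "seed U = cls U (\<lambda>x. x)"
  by (simp add: seed_def cls_def)

lemma cls_in [simp]: "cls U f \<in> ultrapower U"
  by (simp add: ultrapower_eq)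

lemma ultrapowerE: "y \<in> ultrapower U \<Longrightarrow> (\<And>f. y = cls U f \<Longrightarrow> thesis) \<Longrightarrow> thesis"
  by (auto simp: ultrapower_eq)

context
  fixes U :: "'v::zfc_universe"
  assumes U: "ccu U"
begin

lemma wf_ult_mem: "wf (ult_mem UNIV U)"
  unfolding wf_iff_no_infinite_down_chain
proof
  assume "\<exists>f. \<forall>i. (f (Suc i), f i) \<in> ult_mem UNIV U"
  then obtain f where f: "\<And>i. (f (Suc i), f i) \<in> ult_mem UNIV U" by blast
  then have "\<exists>g. f i = restr g (uspace U)" for i
    using f[of i] by (auto simp: ult_mem_def ult_funs_UNIV)
  then obtain g where g: "\<And>i. f i = restr (g i) (uspace U)" by metis
  have "\<And>i. ae U (\<lambda>x. g (Suc i) x \<in> elts (g i x))"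
    using f unfolding g ult_mem_restr by blast
  then have "ae U (\<lambda>x. \<forall>i. g (Suc i) x \<in> elts (g i x))" by (simp add: ae_nat[OF U])
  then obtain x where "\<forall>i. g (Suc i) x \<in> elts (g i x)" using ae_exD[OF U] by blast
  then show False using not_mem_chain[of "\<lambda>i. g i x"] by blast
qed

lemma cls_rec: "cls U f = set_of (cls U ` {g. ae U (\<lambda>x. g x \<in> elts (f x))})"
proof -
  have "{h. (h, restr f (uspace U)) \<in> ult_mem UNIV U} =
      (\<lambda>g. restr g (uspace U)) ` {g. ae U (\<lambda>x. g x \<in> elts (f x))}"
    by (auto simp: ult_mem_restr) (auto simp: ult_mem_def ult_funs_UNIV ult_mem_restr[symmetric])
  then show ?thesis unfolding cls_def
    by (subst ult_class_rec[OF wf_ult_mem]) (simp add: image_image)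
qed

lemma cls_cong: "ae U (\<lambda>x. f x = g x) \<Longrightarrow> cls U f = cls U g"
proof -
  assume "ae U (\<lambda>x. f x = g x)"
  then have "ae U (\<lambda>x. h x \<in> elts (f x)) = ae U (\<lambda>x. h x \<in> elts (g x))" for h
    by (intro ae_iff[OF U]) (erule ae_mono[OF U], simp)
  then show ?thesis by (subst (1 2) cls_rec) simp
qed

lemma elts_cls: "elts (cls U f) = cls U ` {g. ae U (\<lambda>x. g x \<in> elts (f x))}"
proof -
  \<comment> \<open>A predecessor of \<open>f\<close> can be changed off a set of measure one into a
    function \<open>g'\<close> with values in \<open>B\<close>; the empty set is the default value.
    The codes of such functions are subsets of the set \<open>P\<close>, so the predecessors have
    set-many classes.\<close>
  define B where "B = insert (set_of {}) (\<Union>x\<in>elts (uspace U). elts (f x))"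
  have "small B" unfolding B_def by (intro small_insert small_UN) auto
  define P where "P = (\<Union>x\<in>elts (uspace U). opair x ` B)"
  have P: "small P" unfolding P_def by (intro small_UN small_image \<open>small B\<close>) auto
  have "cls U ` {g. ae U (\<lambda>x. g x \<in> elts (f x))} \<subseteq>
    ult_class UNIV U ` {h. elts h \<subseteq> elts (set_of P)}"
  proof
    fix y assume "y \<in> cls U ` {g. ae U (\<lambda>x. g x \<in> elts (f x))}"
    then obtain g where g: "y = cls U g" "ae U (\<lambda>x. g x \<in> elts (f x))" by blast
    define g' where "g' x = (if g x \<in> elts (f x) then g x else set_of {})" for x
    have "y = cls U g'" unfolding g(1)
      by (rule cls_cong, rule ae_mono[OF U g(2)]) (simp add: g'_def)
    moreover have "g' x \<in> B" if "x \<in> elts (uspace U)" for x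
      using that by (auto simp: B_def g'_def)
    then have "elts (restr g' (uspace U)) \<subseteq> P" unfolding elts_restr P_def by blast
    then have "elts (restr g' (uspace U)) \<subseteq> elts (set_of P)" using P by simp
    ultimately show "y \<in> ult_class UNIV U ` {h. elts h \<subseteq> elts (set_of P)}"
      unfolding cls_def by blast
  qed
  then have "small (cls U ` {g. ae U (\<lambda>x. g x \<in> elts (f x))})"
    by (rule small_subset[rotated]) (intro small_image small_Pow)
  then show ?thesis by (subst cls_rec) simp
qed

text \<open>If \<open>f\<close> and \<open>g\<close> differ almost everywhere, some \<open>h\<close>
  picks almost everywhere an element of one value outside the other. The common class has
  \<open>cls U h\<close> as an element, so \<open>h\<close> has the class of some \<open>k\<close>
  on the other side; the induction hypothesis for this smaller class makes \<open>h\<close> and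
  \<open>k\<close> agree, a contradiction.\<close>

lemma cls_eqD: "cls U f = cls U g \<Longrightarrow> ae U (\<lambda>x. f x = g x)"
proof (induction "cls U f" arbitrary: f g rule: mem_induct)
  case 1
  show ?case
  proof (rule ccontr)
    assume "\<not> ?thesis"
    then have "ae U (\<lambda>x. f x \<noteq> g x)" by (simp add: ae_not[OF U])
    then have "ae U (\<lambda>x. (\<exists>t. t \<in> elts (f x) \<and> t \<notin> elts (g x)) \<or> (\<exists>t. t \<in> elts (g x) \<and> t \<notin> elts (f x)))"
      by (rule ae_mono[OF U]) (metis extensionality subsetI subset_antisym)
    then consider h where "ae U (\<lambda>x. h x \<in> elts (f x) \<and> h x \<notin> elts (g x))"
      | h where "ae U (\<lambda>x. h x \<in> elts (g x) \<and> h x \<notin> elts (f x))"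
      unfolding ae_disj[OF U] ae_ex_choice[OF U] by blast
    then show False
    proof cases
      case (1 h)
      from this have h: "cls U h \<in> elts (cls U f)" "\<not> ae U (\<lambda>x. h x \<in> elts (g x))"
        by (auto simp: elts_cls ae_conj[OF U] ae_not[OF U])
      have "cls U h \<in> elts (cls U g)" using h(1) \<open>cls U f = cls U g\<close> by simp
      then obtain k where k: "cls U h = cls U k" "ae U (\<lambda>x. k x \<in> elts (g x))"
        unfolding elts_cls by blast
      have "ae U (\<lambda>x. h x = k x)" using "local.1.hyps"(1)[OF h(1)] k(1) by blast
      then have "ae U (\<lambda>x. h x \<in> elts (g x))"
        using ae_mp[OF U, of "\<lambda>x. h x = k x" "\<lambda>x. k x \<in> elts (g x)"] k(2) by simp
      then show False using h(2) by blast
    next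
      case (2 h)
      from this have h: "cls U h \<in> elts (cls U g)" "\<not> ae U (\<lambda>x. h x \<in> elts (f x))"
        by (auto simp: elts_cls ae_conj[OF U] ae_not[OF U])
      have "cls U h \<in> elts (cls U f)" using h(1) \<open>cls U f = cls U g\<close> by simp
      then obtain k where k: "cls U h = cls U k" "ae U (\<lambda>x. k x \<in> elts (f x))"
        unfolding elts_cls by blast
      have "cls U k \<in> elts (cls U f)" using k(2) by (auto simp: elts_cls)
      then have "ae U (\<lambda>x. k x = h x)" using "local.1.hyps"(1) k(1) by metis
      then have "ae U (\<lambda>x. h x \<in> elts (f x))"
        using ae_mp[OF U, of "\<lambda>x. k x = h x" "\<lambda>x. k x \<in> elts (f x)"] k(2) by simp
      then show False using h(2) by blast
    qed
  qed
qed

lemma cls_eq_iff: "cls U f = cls U g \<longleftrightarrow> ae U (\<lambda>x. f x = g x)"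
  using cls_eqD cls_cong by blast

lemma cls_mem_iff: "cls U f \<in> elts (cls U g) \<longleftrightarrow> ae U (\<lambda>x. f x \<in> elts (g x))"
proof
  assume "cls U f \<in> elts (cls U g)"
  then obtain h where h: "cls U f = cls U h" "ae U (\<lambda>x. h x \<in> elts (g x))" by (auto simp: elts_cls)
  then have "ae U (\<lambda>x. f x = h x \<and> h x \<in> elts (g x))" by (simp add: cls_eq_iff ae_conj[OF U])
  then show "ae U (\<lambda>x. f x \<in> elts (g x))" by (rule ae_mono[OF U]) simp
qed (auto simp: elts_cls)

lemma ultrapower_transitive: "x \<in> ultrapower U \<Longrightarrow> elts x \<subseteq> ultrapower U"
  by (auto simp: ultrapower_eq elts_cls)

lemma sat_ultrapower:
  "sat (ultrapower U) p (\<lambda>n. cls U (f n)) \<longleftrightarrow> ae U (\<lambda>x. sat UNIV p (\<lambda>n. f n x))"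
proof (induction p arbitrary: f)
  case (All n p)
  have upd: "(\<lambda>m. cls U (f m))(n := cls U g) = (\<lambda>m. cls U ((f(n := g)) m))" for g by auto
  have upd': "(\<lambda>m. (f(n := g)) m x) = (\<lambda>m. f m x)(n := g x)" for g x by auto
  have "sat (ultrapower U) (All n p) (\<lambda>n. cls U (f n)) \<longleftrightarrow>
      (\<forall>g. sat (ultrapower U) p ((\<lambda>m. cls U (f m))(n := cls U g)))"
    by (auto simp: ultrapower_eq)
  also have "\<dots> \<longleftrightarrow> (\<forall>g. ae U (\<lambda>x. sat UNIV p ((\<lambda>m. f m x)(n := g x))))"
    unfolding upd All upd' ..
  also have "\<dots> \<longleftrightarrow> ae U (\<lambda>x. sat UNIV (All n p) (\<lambda>n. f n x))"
    by (simp add: ae_all_choice[OF U])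
  finally show ?case .
qed (simp_all add: cls_mem_iff cls_eq_iff ae_not[OF U] ae_conj[OF U])

end

section \<open>First-order definable relations\<close>

text \<open>What the absoluteness arguments take from a model. Closure under pairing or union is not
  included, so a formula cannot assume that auxiliary sets such as \<open>uspace Z\<close> lie in
  the model.\<close>

definition nice :: "'v::zfc_universe set \<Rightarrow> bool" where
  "nice M \<longleftrightarrow> (\<forall>x\<in>M. elts x \<subseteq> M) \<and> omega \<in> M"

text \<open>
  A relation of an environment, possibly relativised to \<open>M\<close>, that is defined in all \<open>M\<close> by one
  formula.  In \<open>fo_all\<close> below variables are de Bruijn indices, so that definability of a concrete
  relation is established by resolution with the closure rules.
\<close>

definition fo :: "('v::zfc_universe set \<Rightarrow> (nat \<Rightarrow> 'v) \<Rightarrow> bool) \<Rightarrow> bool" where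
  "fo P \<longleftrightarrow> (\<exists>p. \<forall>M. nice M \<longrightarrow> (\<forall>e. range e \<subseteq> M \<longrightarrow> P M e = sat M p e))"

primrec vbound :: "fm \<Rightarrow> nat" where
  "vbound (Mem m n) = Suc (max m n)"
| "vbound (Eq m n) = Suc (max m n)"
| "vbound (Neg p) = vbound p"
| "vbound (Conj p q) = max (vbound p) (vbound q)"
| "vbound (All n p) = max (Suc n) (vbound p)"

lemma sat_cong: "(\<And>n. n < vbound p \<Longrightarrow> e n = e' n) \<Longrightarrow> sat M p e = sat M p e'"
proof (induction p arbitrary: e e')
  case (Conj p q)
  have "sat M p e = sat M p e'" "sat M q e = sat M q e'"
    by (rule Conj.IH; use Conj.prems in simp)+
  then show ?case by simp
next
  case (All n p)
  have "sat M p (e(n := x)) = sat M p (e'(n := x))" for x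
    by (rule All.IH) (use All.prems in simp)
  then show ?case by simp
next
  case (Mem m n)
  have "e m = e' m" "e n = e' n" by (rule Mem.prems; simp)+
  then show ?case by simp
next
  case (Eq m n)
  have "e m = e' m" "e n = e' n" by (rule Eq.prems; simp)+
  then show ?case by simp
next
  case (Neg p)
  have "sat M p e = sat M p e'" by (rule Neg.IH; use Neg.prems in simp)
  then show ?case by simp
qed

primrec ren :: "(nat \<Rightarrow> nat) \<Rightarrow> fm \<Rightarrow> fm" where
  "ren r (Mem m n) = Mem (r m) (r n)"
| "ren r (Eq m n) = Eq (r m) (r n)"
| "ren r (Neg p) = Neg (ren r p)"
| "ren r (Conj p q) = Conj (ren r p) (ren r q)"
| "ren r (All n p) = All (r n) (ren r p)"

text \<open>\<open>ren\<close> renames bound variables as well; injectivity keeps a renamed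
  quantifier from capturing a free variable.\<close>

lemma sat_ren: "inj r \<Longrightarrow> sat M (ren r p) e = sat M p (\<lambda>n. e (r n))"
proof (induction p arbitrary: e)
  case (All n p)
  have "(\<lambda>m. (e(r n := x)) (r m)) = (\<lambda>m. e (r m))(n := x)" for x
    using All.prems by (auto simp: inj_eq)
  then show ?case using All by simp
qed simp_all

lemma foI: "(\<And>M e. nice M \<Longrightarrow> range e \<subseteq> M \<Longrightarrow> P M e = sat M p e) \<Longrightarrow> fo P"
  unfolding fo_def by blast

lemma foE:
  assumes "fo P"
  obtains p where "\<And>M e. nice M \<Longrightarrow> range e \<subseteq> M \<Longrightarrow> P M e = sat M p e"
  using assms unfolding fo_def by blast

lemma fo_mem: "fo (\<lambda>M e. e i \<in> elts (e j))"
  by (rule foI[where p = "Mem i j"]) simp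

lemma fo_eq: "fo (\<lambda>M e. e i = e j)"
  by (rule foI[where p = "Eq i j"]) simp

lemma fo_not: "fo P \<Longrightarrow> fo (\<lambda>M e. \<not> P M e)"
proof (erule foE)
  fix p assume "\<And>M e. nice M \<Longrightarrow> range e \<subseteq> M \<Longrightarrow> P M e = sat M p e"
  then show ?thesis by (intro foI[where p = "Neg p"]) simp
qed

lemma fo_conj: "fo P \<Longrightarrow> fo Q \<Longrightarrow> fo (\<lambda>M e. P M e \<and> Q M e)"
proof (elim foE)
  fix p q assume "\<And>M e. nice M \<Longrightarrow> range e \<subseteq> M \<Longrightarrow> P M e = sat M p e"
    and "\<And>M e. nice M \<Longrightarrow> range e \<subseteq> M \<Longrightarrow> Q M e = sat M q e"
  then show ?thesis by (intro foI[where p = "Conj p q"]) simp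
qed

lemma fo_cong: "fo Q \<Longrightarrow> (\<And>M e. nice M \<Longrightarrow> range e \<subseteq> M \<Longrightarrow> P M e = Q M e) \<Longrightarrow> fo P"
  unfolding fo_def by metis

lemma fo_disj: "fo P \<Longrightarrow> fo Q \<Longrightarrow> fo (\<lambda>M e. P M e \<or> Q M e)"
  by (rule fo_cong[where Q = "\<lambda>M e. \<not> (\<not> P M e \<and> \<not> Q M e)"]) (intro fo_not fo_conj | simp)+

lemma fo_imp: "fo P \<Longrightarrow> fo Q \<Longrightarrow> fo (\<lambda>M e. P M e \<longrightarrow> Q M e)"
  by (rule fo_cong[where Q = "\<lambda>M e. \<not> (P M e \<and> \<not> Q M e)"]) (intro fo_not fo_conj | simp)+

lemma fo_iff: "fo P \<Longrightarrow> fo Q \<Longrightarrow> fo (\<lambda>M e. P M e \<longleftrightarrow> Q M e)"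
  by (rule fo_cong[where Q = "\<lambda>M e. (P M e \<longrightarrow> Q M e) \<and> (Q M e \<longrightarrow> P M e)"])
    (intro fo_imp fo_conj | blast)+

lemma fo_True: "fo (\<lambda>M e. True)"
  by (rule foI[where p = "Eq 0 0"]) simp

lemma fo_False: "fo (\<lambda>M e. False)"
  by (rule foI[where p = "Neg (Eq 0 0)"]) simp

lemma fo_all_upd: "fo P \<Longrightarrow> fo (\<lambda>M e. \<forall>x\<in>M. P M (e(n := x)))"
proof (erule foE)
  fix p assume "\<And>M e. nice M \<Longrightarrow> range e \<subseteq> M \<Longrightarrow> P M e = sat M p e"
  then show ?thesis by (intro foI[where p = "All n p"]) (auto simp: image_subset_iff)
qed

lemma fo_all:
  assumes "fo (\<lambda>M e. P M (\<lambda>n. e (Suc n)) (e 0))"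
  shows "fo (\<lambda>M e. \<forall>x\<in>M. P M e x)"
  using assms
proof (rule foE)
  fix p assume p: "\<And>M e. nice M \<Longrightarrow> range e \<subseteq> M \<Longrightarrow> P M (\<lambda>n. e (Suc n)) (e 0) = sat M p e"
  \<comment> \<open>Index 0 of the body becomes the variable \<open>K\<close>, which does not occur
    in \<open>p\<close>, and the shifted indices move back down by one. The last branch of
    \<open>r\<close> concerns no variable of \<open>p\<close> and only keeps \<open>r\<close>
    injective.\<close>
  define K where "K = vbound p"
  define r where "r = case_nat K (\<lambda>n. if n < K then n else Suc n)"
  have r: "inj r" by (auto simp: inj_def r_def split: nat.splits if_splits)
  have "P M e x = sat M (ren r p) (e(K := x))" if "nice M" "range e \<subseteq> M" "x \<in> M" for M e x
  proof -
    have "P M e x = sat M p (case_nat x e)"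
      using p[of M "case_nat x e"] that by (auto simp: image_subset_iff split: nat.splits)
    also have "\<dots> = sat M p (\<lambda>n. (e(K := x)) (r n))"
      by (rule sat_cong) (auto simp: r_def K_def split: nat.splits)
    finally show ?thesis by (simp add: sat_ren[OF r])
  qed
  then show ?thesis by (intro foI[where p = "All K (ren r p)"]) simp
qed

lemma fo_ex:
  assumes "fo (\<lambda>M e. P M (\<lambda>n. e (Suc n)) (e 0))"
  shows "fo (\<lambda>M e. \<exists>x\<in>M. P M e x)"
  by (rule fo_cong[where Q = "\<lambda>M e. \<not> (\<forall>x\<in>M. \<not> P M e x)"]) (intro fo_not fo_all assms | simp)+

lemma fo_ball:
  assumes "fo (\<lambda>M e. P M (\<lambda>n. e (Suc n)) (e 0))"
  shows "fo (\<lambda>M e. \<forall>x\<in>elts (e i). P M e x)"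
  by (rule fo_cong[where Q = "\<lambda>M e. \<forall>x\<in>M. x \<in> elts (e i) \<longrightarrow> P M e x"])
    (intro fo_all fo_imp fo_mem assms | auto simp: nice_def image_subset_iff)+

lemma fo_bex:
  assumes "fo (\<lambda>M e. P M (\<lambda>n. e (Suc n)) (e 0))"
  shows "fo (\<lambda>M e. \<exists>x\<in>elts (e i). P M e x)"
  by (rule fo_cong[where Q = "\<lambda>M e. \<not> (\<forall>x\<in>elts (e i). \<not> P M e x)"])
    (intro fo_not fo_ball assms | simp)+

section \<open>Definability of the basic set-theoretic notions\<close>

named_theorems fo_intros

lemmas [fo_intros] = fo_mem fo_eq fo_not fo_conj fo_disj fo_imp fo_iff fo_True fo_False
  fo_all fo_ex fo_ball fo_bex

text \<open>Formulas contain no terms, so an equation with a term such as \<open>uspace\<close> is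
  expressed by a formula for membership in it. Extensionality suffices in a transitive
  \<open>M\<close> as soon as all elements of the term lie in \<open>M\<close>; the term itself may
  lie outside.\<close>

lemma fo_eq_set_of:
  assumes "fo (\<lambda>M e. S M (\<lambda>n. e (Suc n)) (e 0))"
    and "\<And>M e x. nice M \<Longrightarrow> range e \<subseteq> M \<Longrightarrow> x \<in> elts (f e) \<longleftrightarrow> x \<in> M \<and> S M e x"
  shows "fo (\<lambda>M e. e i = f e)"
proof (rule fo_cong[where Q = "\<lambda>M e. \<forall>x\<in>M. x \<in> elts (e i) \<longleftrightarrow> S M e x"])
  show "fo (\<lambda>M e. \<forall>x\<in>M. x \<in> elts (e i) \<longleftrightarrow> S M e x)" by (intro fo_intros assms(1))
next
  fix M :: "'a set" and e :: "nat \<Rightarrow> 'a" assume M: "nice M" "range e \<subseteq> M"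
  have sub: "elts (e i) \<subseteq> M" using M by (auto simp: nice_def)
  show "(e i = f e) = (\<forall>x\<in>M. x \<in> elts (e i) \<longleftrightarrow> S M e x)" (is "_ = ?R")
  proof
    assume ?R
    then have "elts (e i) = elts (f e)" using sub assms(2)[OF M] by blast
    then show "e i = f e" by (rule extensionality)
  qed (use assms(2)[OF M] in auto)
qed

lemma fo_subset [fo_intros]: "fo (\<lambda>M e. elts (e i) \<subseteq> elts (e j))"
  unfolding subset_eq by (intro fo_intros)

lemma fo_empty [fo_intros]: "fo (\<lambda>M e. elts (e i) = {})"
  unfolding set_eq_iff[of _ "{}"]
  by (rule fo_cong[where Q = "\<lambda>M e. \<forall>x\<in>elts (e i). False"]) (intro fo_intros | simp)+

lemma fo_singleton [fo_intros]: "fo (\<lambda>M e. elts (e i) = {e j})"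
  by (rule fo_cong[where Q = "\<lambda>M e. e j \<in> elts (e i) \<and> (\<forall>x\<in>elts (e i). x = e j)"])
    (intro fo_intros | blast)+

lemma fo_doubleton [fo_intros]: "fo (\<lambda>M e. elts (e i) = {e j, e k})"
  by (rule fo_cong[where Q = "\<lambda>M e. e j \<in> elts (e i) \<and> e k \<in> elts (e i) \<and>
      (\<forall>x\<in>elts (e i). x = e j \<or> x = e k)"]) (intro fo_intros | blast)+

lemma eq_opair_iff:
  "p = opair x y \<longleftrightarrow> (\<exists>u\<in>elts p. \<exists>v\<in>elts p. elts p = {u, v} \<and> elts u = {x} \<and> elts v = {x, y})"
  (is "_ \<longleftrightarrow> ?R")
proof
  assume ?R
  then obtain u v where "elts p = {u, v}" "elts u = {x}" "elts v = {x, y}" by blast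
  then have "elts p = elts (opair x y)" by (metis elts_opair set_of_elts)
  then show "p = opair x y" by (rule extensionality)
qed simp

lemma fo_eq_opair [fo_intros]: "fo (\<lambda>M e. e i = opair (e j) (e k))"
  unfolding eq_opair_iff by (intro fo_intros)

lemma fo_opair_mem [fo_intros]: "fo (\<lambda>M e. opair (e i) (e j) \<in> elts (e k))"
  by (rule fo_cong[where Q = "\<lambda>M e. \<exists>p\<in>elts (e k). p = opair (e i) (e j)"])
    (intro fo_intros | blast)+

lemma fo_eq_succ [fo_intros]: "fo (\<lambda>M e. e i = succ (e j))"
  by (rule fo_eq_set_of[where S = "\<lambda>M e x. x = e j \<or> x \<in> elts (e j)"])
    (intro fo_intros | auto simp: nice_def)+

text \<open>The quantifiers displayed on the right are bounded by \<open>w\<close>, so the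
  description means the same in every transitive model. Membership induction excludes elements other
  than the \<open>vnat n\<close>, since every nonempty element is the successor of an element of
  \<open>w\<close>.\<close>

lemma eq_omega_iff:
  "w = omega \<longleftrightarrow> (\<exists>x\<in>elts w. elts x = {}) \<and> (\<forall>x\<in>elts w. \<exists>y\<in>elts w. y = succ x) \<and>
     (\<forall>x\<in>elts w. elts x = {} \<or> (\<exists>y\<in>elts w. x = succ y))" (is "_ \<longleftrightarrow> ?R")
proof
  assume "w = omega"
  then have w: "elts w = range vnat" by simp
  have z: "elts (vnat 0) = {}" by simp
  have s: "vnat (Suc n) = succ (vnat n)" for n by simp
  have "elts (vnat n) = {} \<or> (\<exists>y\<in>range vnat. vnat n = succ y)" for n
    by (cases n) (use z s in blast)+
  moreover have "\<exists>y\<in>range vnat. y = succ (vnat n)" for n using s[of n] by (metis rangeI)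
  ultimately show ?R unfolding w using z by blast
next
  assume R: ?R
  have "vnat n \<in> elts w" for n
  proof (induction n)
    case 0
    then show ?case using R by (metis set_of_elts vnat.simps(1))
  qed (use R in auto)
  moreover have "x \<in> elts w \<Longrightarrow> x \<in> range vnat" for x
  proof (induction x rule: mem_induct)
    case (1 x)
    show ?case
    proof (cases "elts x = {}")
      case True
      then have "x = vnat 0" by (metis set_of_elts vnat.simps(1))
      then show ?thesis by blast
    next
      case False
      then obtain y where y: "y \<in> elts w" "x = succ y" using R 1(2) by blast
      then obtain n where "y = vnat n" using 1(1)[of y] by auto
      then have "x = vnat (Suc n)" using y by simp
      then show ?thesis by blast
    qed
  qed
  ultimately have "elts w = elts omega" by auto
  then show "w = omega" by (rule extensionality)
qed

lemma fo_eq_omega [fo_intros]: "fo (\<lambda>M e. e i = omega)"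
  unfolding eq_omega_iff by (intro fo_intros)

lemma fo_transitive [fo_intros]: "fo (\<lambda>M e. transitive (e i))"
  unfolding transitive_def by (intro fo_intros)

lemma fo_ordinal [fo_intros]: "fo (\<lambda>M e. ordinal (e i))"
  unfolding ordinal_def by (intro fo_intros)

lemma opair_in_nice:
  assumes "nice M" "p \<in> M" "p = opair a b"
  shows "a \<in> M \<and> b \<in> M"
proof -
  have "set_of {a, b} \<in> M" using assms by (auto simp: nice_def)
  then show ?thesis using assms(1) unfolding nice_def by (metis elts_set_of_small insert_subset small_doubleton)
qed

text \<open>The components of a pair in a transitive \<open>M\<close> lie in \<open>M\<close>, so
  quantifiers over values of the function may be restricted to \<open>M\<close>.\<close>

lemma fo_function_on [fo_intros]: "fo (\<lambda>M e. function_on (e i) (e j))"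
proof (rule fo_cong[where Q = "\<lambda>M e.
     (\<forall>p\<in>elts (e i). \<exists>a\<in>elts (e j). \<exists>b\<in>M. p = opair a b) \<and>
     (\<forall>a\<in>elts (e j). \<exists>b\<in>M. opair a b \<in> elts (e i)) \<and>
     (\<forall>a\<in>elts (e j). \<forall>b\<in>M. \<forall>c\<in>M. opair a b \<in> elts (e i) \<longrightarrow> opair a c \<in> elts (e i) \<longrightarrow> b = c)"])
  fix M :: "'a set" and e :: "nat \<Rightarrow> 'a" assume M: "nice M" "range e \<subseteq> M"
  then have "p \<in> elts (e i) \<Longrightarrow> p \<in> M" for p by (auto simp: nice_def)
  then have *: "opair a b \<in> elts (e i) \<Longrightarrow> b \<in> M" "p \<in> elts (e i) \<Longrightarrow> p = opair a b \<Longrightarrow> b \<in> M" for a b p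
    using opair_in_nice[OF M(1)] by blast+
  show "function_on (e i) (e j) =
     ((\<forall>p\<in>elts (e i). \<exists>a\<in>elts (e j). \<exists>b\<in>M. p = opair a b) \<and>
     (\<forall>a\<in>elts (e j). \<exists>b\<in>M. opair a b \<in> elts (e i)) \<and>
     (\<forall>a\<in>elts (e j). \<forall>b\<in>M. \<forall>c\<in>M. opair a b \<in> elts (e i) \<longrightarrow> opair a c \<in> elts (e i) \<longrightarrow> b = c))"
    unfolding function_on_iff using * by (intro conj_cong) (meson | blast)+
qed (intro fo_intros)

lemma opair_mem_function: "function_on f X \<Longrightarrow> a \<in> elts X \<Longrightarrow> opair a b \<in> elts f \<longleftrightarrow> b = app f a"
  by (auto simp: function_on_def)

lemma fo_uspace_mem [fo_intros]: "fo (\<lambda>M e. e i \<in> elts (uspace (e j)))"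
  unfolding elts_uspace UN_iff by (intro fo_intros)

lemma nice_elts: "nice M \<Longrightarrow> y \<in> M \<Longrightarrow> x \<in> elts y \<Longrightarrow> x \<in> M"
  by (auto simp: nice_def)

lemma nice_uspace: "nice M \<Longrightarrow> Z \<in> M \<Longrightarrow> x \<in> elts (uspace Z) \<Longrightarrow> x \<in> M"
  unfolding elts_uspace by (blast intro: nice_elts)

lemma fo_eq_uspace [fo_intros]: "fo (\<lambda>M e. e i = uspace (e j))"
  by (rule fo_eq_set_of[where S = "\<lambda>M e x. x \<in> elts (uspace (e j))"])
    (intro fo_intros | auto simp: image_subset_iff intro: nice_uspace)+

lemma fo_eq_inter [fo_intros]: "fo (\<lambda>M e. e i = set_of (elts (e j) \<inter> elts (e k)))"
  by (rule fo_eq_set_of[where S = "\<lambda>M e x. x \<in> elts (e j) \<and> x \<in> elts (e k)"])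
    (intro fo_intros | auto simp: image_subset_iff intro: nice_elts)+

lemma fo_eq_diff [fo_intros]: "fo (\<lambda>M e. e i = set_of (elts (uspace (e j)) - elts (e k)))"
  by (rule fo_eq_set_of[where S = "\<lambda>M e x. x \<in> elts (uspace (e j)) \<and> x \<notin> elts (e k)"])
    (intro fo_intros | auto simp: image_subset_iff intro: nice_uspace)+

text \<open>Every set whose membership in the ultrafilter is asserted becomes a witness found among
  the elements of the ultrafilter, so none of them has to be constructed in
  \<open>M\<close>.\<close>

lemma fo_cc_ultrafilter [fo_intros]: "fo (\<lambda>M e. cc_ultrafilter M (e i))"
proof (rule fo_cong[where Q = "\<lambda>M e.
     (\<exists>X\<in>elts (e i). X = uspace (e i)) \<and>
     \<not> (\<exists>X\<in>elts (e i). elts X = {}) \<and>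
     (\<forall>A\<in>elts (e i). \<forall>B\<in>M. elts A \<subseteq> elts B \<and> (\<forall>x\<in>elts B. x \<in> elts (uspace (e i))) \<longrightarrow> B \<in> elts (e i)) \<and>
     (\<forall>A\<in>elts (e i). \<forall>B\<in>elts (e i). \<exists>C\<in>elts (e i). C = set_of (elts A \<inter> elts B)) \<and>
     (\<forall>A\<in>M. (\<forall>x\<in>elts A. x \<in> elts (uspace (e i))) \<longrightarrow>
        A \<in> elts (e i) \<or> (\<exists>C\<in>elts (e i). C = set_of (elts (uspace (e i)) - elts A))) \<and>
     (\<exists>w\<in>M. w = omega \<and> (\<forall>s\<in>M. function_on s w \<and> (\<forall>n\<in>elts w. \<exists>A\<in>elts (e i). opair n A \<in> elts s) \<longrightarrow>
        (\<exists>B\<in>elts (e i). \<forall>x\<in>M. x \<in> elts B \<longleftrightarrow> (\<forall>n\<in>elts w. \<forall>A\<in>elts (e i). opair n A \<in> elts s \<longrightarrow> x \<in> elts A))))"])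
  fix M :: "'a set" and e :: "nat \<Rightarrow> 'a" assume M: "nice M" "range e \<subseteq> M"
  define Z where "Z = e i"
  have Z: "Z \<in> M" "omega \<in> M" using M by (auto simp: Z_def nice_def)
  have tr: "x \<in> elts y \<Longrightarrow> y \<in> M \<Longrightarrow> x \<in> M" for x y using M by (auto simp: nice_def)
  have e: "set_of {} \<in> elts Z \<longleftrightarrow> (\<exists>X\<in>elts Z. elts X = {})"
    by (metis elts_set_of_small set_of_elts small_empty)
  have cnt: "set_of (\<Inter>n\<in>elts omega. elts (app s n)) \<in> elts Z \<longleftrightarrow>
      (\<exists>B\<in>elts Z. \<forall>x\<in>M. x \<in> elts B \<longleftrightarrow> (\<forall>n\<in>elts omega. \<forall>A\<in>elts Z. opair n A \<in> elts s \<longrightarrow> x \<in> elts A))"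
    and cnt': "(\<forall>n\<in>elts omega. app s n \<in> elts Z) \<longleftrightarrow> (\<forall>n\<in>elts omega. \<exists>A\<in>elts Z. opair n A \<in> elts s)"
    if s: "function_on s omega" "\<forall>n\<in>elts omega. \<exists>A\<in>elts Z. opair n A \<in> elts s" for s
  proof -
    note op = opair_mem_function[OF s(1)]
    show "(\<forall>n\<in>elts omega. app s n \<in> elts Z) \<longleftrightarrow> (\<forall>n\<in>elts omega. \<exists>A\<in>elts Z. opair n A \<in> elts s)"
      using op by metis
    have ap: "app s n \<in> elts Z" if "n \<in> elts omega" for n using s(2) op that by metis
    define I where "I = (\<Inter>n\<in>elts omega. elts (app s n))"
    \<comment> \<open>The intersection is contained in its member of index 0; this makes it a set
      and puts its elements into \<open>M\<close>.\<close>
    have n0: "vnat 0 \<in> elts omega" by (simp only: elts_omega rangeI)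
    have I0: "I \<subseteq> elts (app s (vnat 0))" using n0 unfolding I_def by blast
    then have sm: "small I" by (rule small_subset[OF small_elts])
    have IM: "I \<subseteq> M" using I0 tr tr[OF ap[OF n0] Z(1)] by blast
    have eq: "(\<forall>n\<in>elts omega. \<forall>A\<in>elts Z. opair n A \<in> elts s \<longrightarrow> x \<in> elts A) \<longleftrightarrow> x \<in> I" for x
      unfolding I_def using op ap by simp
    have "set_of I \<in> elts Z \<longleftrightarrow> (\<exists>B\<in>elts Z. \<forall>x\<in>M. x \<in> elts B \<longleftrightarrow> x \<in> I)" (is "_ = ?R")
    proof
      assume ?R
      then obtain B where B: "B \<in> elts Z" "\<forall>x\<in>M. x \<in> elts B \<longleftrightarrow> x \<in> I" by blast
      then have "elts B = I" using IM tr[OF _ tr[OF B(1) Z(1)]] by blast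
      then show "set_of I \<in> elts Z" using B(1) by (metis set_of_elts)
    qed (use sm in \<open>auto intro!: bexI[of _ "set_of I"]\<close>)
    then show "set_of (\<Inter>n\<in>elts omega. elts (app s n)) \<in> elts Z \<longleftrightarrow>
      (\<exists>B\<in>elts Z. \<forall>x\<in>M. x \<in> elts B \<longleftrightarrow> (\<forall>n\<in>elts omega. \<forall>A\<in>elts Z. opair n A \<in> elts s \<longrightarrow> x \<in> elts A))"
      unfolding eq I_def[symmetric] .
  qed
  have cc: "(\<forall>s\<in>M. function_on s omega \<and> (\<forall>n\<in>elts omega. app s n \<in> elts Z) \<longrightarrow>
        set_of (\<Inter>n\<in>elts omega. elts (app s n)) \<in> elts Z) \<longleftrightarrow>
      (\<exists>w\<in>M. w = omega \<and> (\<forall>s\<in>M. function_on s w \<and> (\<forall>n\<in>elts w. \<exists>A\<in>elts Z. opair n A \<in> elts s) \<longrightarrow>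
        (\<exists>B\<in>elts Z. \<forall>x\<in>M. x \<in> elts B \<longleftrightarrow> (\<forall>n\<in>elts w. \<forall>A\<in>elts Z. opair n A \<in> elts s \<longrightarrow> x \<in> elts A))))"
    (is "?L = ?R")
  proof -
    have 1: "function_on s omega \<and> (\<forall>n\<in>elts omega. app s n \<in> elts Z) \<longleftrightarrow>
        function_on s omega \<and> (\<forall>n\<in>elts omega. \<exists>A\<in>elts Z. opair n A \<in> elts s)" for s
      using opair_mem_function[of s omega] by metis
    have "?L \<longleftrightarrow> (\<forall>s\<in>M. function_on s omega \<and> (\<forall>n\<in>elts omega. \<exists>A\<in>elts Z. opair n A \<in> elts s) \<longrightarrow>
        (\<exists>B\<in>elts Z. \<forall>x\<in>M. x \<in> elts B \<longleftrightarrow> (\<forall>n\<in>elts omega. \<forall>A\<in>elts Z. opair n A \<in> elts s \<longrightarrow> x \<in> elts A)))"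
      unfolding 1 by (intro ball_cong imp_cong refl) (use cnt in blast)
    then show ?thesis using Z(2) by simp
  qed
  show "cc_ultrafilter M (e i) \<longleftrightarrow> (\<exists>X\<in>elts (e i). X = uspace (e i)) \<and>
     \<not> (\<exists>X\<in>elts (e i). elts X = {}) \<and>
     (\<forall>A\<in>elts (e i). \<forall>B\<in>M. elts A \<subseteq> elts B \<and> (\<forall>x\<in>elts B. x \<in> elts (uspace (e i))) \<longrightarrow> B \<in> elts (e i)) \<and>
     (\<forall>A\<in>elts (e i). \<forall>B\<in>elts (e i). \<exists>C\<in>elts (e i). C = set_of (elts A \<inter> elts B)) \<and>
     (\<forall>A\<in>M. (\<forall>x\<in>elts A. x \<in> elts (uspace (e i))) \<longrightarrow>
        A \<in> elts (e i) \<or> (\<exists>C\<in>elts (e i). C = set_of (elts (uspace (e i)) - elts A))) \<and>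
     (\<exists>w\<in>M. w = omega \<and> (\<forall>s\<in>M. function_on s w \<and> (\<forall>n\<in>elts w. \<exists>A\<in>elts (e i). opair n A \<in> elts s) \<longrightarrow>
        (\<exists>B\<in>elts (e i). \<forall>x\<in>M. x \<in> elts B \<longleftrightarrow> (\<forall>n\<in>elts w. \<forall>A\<in>elts (e i). opair n A \<in> elts s \<longrightarrow> x \<in> elts A))))"
    unfolding cc_ultrafilter_def Z_def[symmetric] cc e subset_eq[of _ "elts (uspace Z)"]
    using Z(1) by simp
qed (intro fo_intros)

section \<open>The theorem of Los and elementary embeddings\<close>

lemma cls_vnat: "ccu U \<Longrightarrow> cls U (\<lambda>_. vnat n) = vnat n"
proof (induction n)
  case 0
  then show ?case by (intro extensionality) (simp add: elts_cls ae_const)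
next
  case (Suc n)
  note U = Suc.prems
  have "elts (cls U (\<lambda>_. succ (vnat n))) = insert (cls U (\<lambda>_. vnat n)) (elts (cls U (\<lambda>_. vnat n)))"
    by (auto simp: elts_cls[OF U] ae_disj[OF U] cls_eq_iff[OF U, symmetric])
  then show ?case using Suc by (intro extensionality) simp
qed

text \<open>A function into \<open>omega\<close> is constant almost everywhere by countable
  completeness, so the ultrapower has no new natural numbers. This is what makes every ultrapower
  \<open>nice\<close>.\<close>

lemma cls_omega: "ccu U \<Longrightarrow> cls U (\<lambda>_. omega) = omega"
proof (rule extensionality)
  assume U: "ccu U"
  have "cls U g \<in> range vnat" if "ae U (\<lambda>x. g x \<in> range vnat)" for g
  proof -
    have "ae U (\<lambda>x. \<not> (\<forall>n. g x \<noteq> vnat n))" by (rule ae_mono[OF U that]) blast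
    then obtain n where "ae U (\<lambda>x. g x = vnat n)"
      unfolding ae_not[OF U] ae_nat[OF U] by blast
    then have "cls U g = cls U (\<lambda>_. vnat n)" by (rule cls_cong[OF U])
    then have "cls U g = vnat n" by (simp only: cls_vnat[OF U])
    then show ?thesis by blast
  qed
  moreover have "\<exists>g. ae U (\<lambda>x. g x \<in> range vnat) \<and> vnat n = cls U g" for n
    by (rule exI[of _ "\<lambda>_. vnat n"]) (simp add: ae_const[OF U] cls_vnat[OF U])
  ultimately show "elts (cls U (\<lambda>_. omega)) = elts omega" by (auto simp: elts_cls[OF U])
qed

lemma nice_UNIV [simp]: "nice UNIV"
  by (simp add: nice_def)

lemma nice_ultrapower: "ccu U \<Longrightarrow> nice (ultrapower U)"
  unfolding nice_def using ultrapower_transitive[of U] cls_in[of U "\<lambda>_. omega"]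
  by (simp add: cls_omega)

lemma los:
  assumes "ccu U" "fo P"
  shows "P (ultrapower U) (\<lambda>n. cls U (f n)) \<longleftrightarrow> ae U (\<lambda>x. P UNIV (\<lambda>n. f n x))"
  using assms(2)
proof (rule foE)
  fix p assume p: "\<And>M e. nice M \<Longrightarrow> range e \<subseteq> M \<Longrightarrow> P M e = sat M p e"
  show ?thesis
    using p[OF nice_ultrapower[OF assms(1)], of "\<lambda>n. cls U (f n)"] p[OF nice_UNIV]
    by (simp add: sat_ultrapower[OF assms(1)] image_subset_iff)
qed

definition env :: "'v \<Rightarrow> 'v \<Rightarrow> 'v \<Rightarrow> nat \<Rightarrow> 'v" where
  "env a b c n = (if n = 0 then a else if n = 1 then b else c)"

lemma env_simps [simp]: "env a b c 0 = a" "env a b c (Suc 0) = b" "env a b c (Suc (Suc n)) = c"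
  by (simp_all add: env_def)

lemma los3:
  assumes "ccu U" "fo (\<lambda>M e. P M (e 0) (e (Suc 0)) (e (Suc (Suc 0))))"
  shows "P (ultrapower U) (cls U f) (cls U g) (cls U h) \<longleftrightarrow> ae U (\<lambda>x. P UNIV (f x) (g x) (h x))"
  using los[OF assms, of "env f g h"] by simp

lemma los2:
  assumes "ccu U" "fo (\<lambda>M e. P M (e 0) (e (Suc 0)))"
  shows "P (ultrapower U) (cls U f) (cls U g) \<longleftrightarrow> ae U (\<lambda>x. P UNIV (f x) (g x))"
  using los[OF assms, of "env f g g"] by simp

lemma los1:
  assumes "ccu U" "fo (\<lambda>M e. P M (e 0))"
  shows "P (ultrapower U) (cls U f) \<longleftrightarrow> ae U (\<lambda>x. P UNIV (f x))"
  using los[OF assms, of "env f f f"] by simp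

text \<open>The theorem of Los for \<open>p = opair a b\<close>, which holds here at every index.
  Other terms are computed in ultrapowers by the same pattern.\<close>

lemma opair_cls:
  assumes "ccu U"
  shows "opair (cls U f) (cls U g) = cls U (\<lambda>x. opair (f x) (g x))"
  using los3[OF assms, of "\<lambda>_ p a b. p = opair a b" "\<lambda>x. opair (f x) (g x)" f g, OF fo_eq_opair]
  by (simp add: ae_const[OF assms])

lemma elementary_transfer:
  assumes "elementary_embedding M N i" "nice M" "nice N" "fo P" "range e \<subseteq> M"
  shows "P M e \<longleftrightarrow> P N (\<lambda>n. i (e n))"
  using assms(4)
proof (rule foE)
  fix p assume p: "\<And>M e. nice M \<Longrightarrow> range e \<subseteq> M \<Longrightarrow> P M e = sat M p e"
  have "range (\<lambda>n. i (e n)) \<subseteq> N" using assms(1,5) by (auto simp: elementary_embedding_def)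
  then show ?thesis using assms(1,5) p[OF assms(2,5)] p[OF assms(3)]
    by (simp add: elementary_embedding_def)
qed

lemma elementary3:
  assumes "elementary_embedding M N i" "nice M" "nice N"
    "fo (\<lambda>M e. P M (e 0) (e (Suc 0)) (e (Suc (Suc 0))))" "a \<in> M" "b \<in> M" "c \<in> M"
  shows "P M a b c \<longleftrightarrow> P N (i a) (i b) (i c)"
  using elementary_transfer[OF assms(1-4), of "env a b c"] assms(5-)
  by (auto simp: env_def)

lemma elementary2:
  assumes "elementary_embedding M N i" "nice M" "nice N"
    "fo (\<lambda>M e. P M (e 0) (e (Suc 0)))" "a \<in> M" "b \<in> M"
  shows "P M a b \<longleftrightarrow> P N (i a) (i b)"
  using elementary_transfer[OF assms(1-4), of "env a b b"] assms(5-)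
  by (auto simp: env_def)

lemma elementary1:
  assumes "elementary_embedding M N i" "nice M" "nice N" "fo (\<lambda>M e. P M (e 0))" "a \<in> M"
  shows "P M a \<longleftrightarrow> P N (i a)"
  using elementary_transfer[OF assms(1-4), of "env a a a"] assms(5-)
  by (auto simp: env_def)

text \<open>\<open>i\<close> is described by an operation \<open>g\<close> on representatives. By
  the theorem of Los, transferring all first-order relations from \<open>D\<close> to
  \<open>E\<close> along \<open>g\<close> is elementarity.\<close>

lemma elementary_mapI:
  assumes D: "ccu D" and E: "ccu E"
    and i: "\<And>f. i (cls D f) = cls E (g f)"
    and tr: "\<And>f P. fo P \<Longrightarrow> ae D (\<lambda>x. P UNIV (\<lambda>n. f n x)) \<longleftrightarrow> ae E (\<lambda>y. P UNIV (\<lambda>n. g (f n) y))"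
  shows "elementary_embedding (ultrapower D) (ultrapower E) i"
  unfolding elementary_embedding_def
proof (intro conjI allI impI)
  show "i ` ultrapower D \<subseteq> ultrapower E" by (auto simp: i ultrapower_eq)
  fix p and e :: "nat \<Rightarrow> 'a" assume "range e \<subseteq> ultrapower D"
  then have "\<forall>n. \<exists>f. e n = cls D f" by (auto simp: ultrapower_eq)
  then obtain f where f: "\<And>n. e n = cls D (f n)" by metis
  have fo: "fo (\<lambda>M. sat M p)" by (rule foI[where p = p]) simp
  show "sat (ultrapower D) p e = sat (ultrapower E) p (\<lambda>n. i (e n))"
    unfolding f i sat_ultrapower[OF D] sat_ultrapower[OF E] using tr[OF fo] .
qed

section \<open>Sums of ultrafilters and internal ultrapowers\<close>

text \<open>Uniqueness of the Mostowski collapse, stated for representatives so that no quotient has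
  to be formed: both ranges are transitive and the two maps induce the same membership
  relation.\<close>

lemma collapse_unique:
  fixes c d :: "'i \<Rightarrow> 'v::zfc_universe"
  assumes cd: "\<And>i j. c i \<in> elts (c j) \<longleftrightarrow> d i \<in> elts (d j)"
    and c: "\<And>x j. x \<in> elts (c j) \<Longrightarrow> x \<in> range c"
    and d: "\<And>x j. x \<in> elts (d j) \<Longrightarrow> x \<in> range d"
  shows "c i = d i"
proof (induction "c i" arbitrary: i rule: mem_induct)
  case 1
  have IH: "c k = d k" if "c k \<in> elts (c i)" for k using 1[OF that] by simp
  have "elts (c i) = elts (d i)"
  proof (intro set_eqI iffI)
    fix x assume "x \<in> elts (c i)"
    moreover from this obtain k where "x = c k" using c by blast
    ultimately show "x \<in> elts (d i)" using IH cd by metis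
  next
    fix x assume "x \<in> elts (d i)"
    moreover from this obtain k where "x = d k" using d by blast
    ultimately show "x \<in> elts (c i)" using IH cd by metis
  qed
  then show ?case by (rule extensionality)
qed

text \<open>A principal ultrafilter on a one-point set. It fills the exceptional indices of families
  of ultrafilters, and its ultrapower embedding is the identity.\<close>

definition trivial_uf :: "'v::zfc_universe" where
  "trivial_uf = mk_uf (set_of {set_of {}}) (\<lambda>P. P (set_of {}))"

lemma ccq_point: "ccq (\<lambda>P. P a)"
  by (auto simp: ccq_def)

lemma ccu_trivial_uf: "ccu trivial_uf"
  unfolding trivial_uf_def by (rule ccu_mk_uf) (simp_all add: ccq_point)

lemma ae_trivial_uf: "ae trivial_uf P \<longleftrightarrow> P (set_of {})"
  unfolding trivial_uf_def by (subst ae_mk_uf) (simp_all add: ccq_point)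

text \<open>Lets families have their defining property at every index, so that sums can be formed
  without exceptional sets.\<close>

lemma family_everywhere:
  assumes D: "ccu D" and z: "ae D (\<lambda>x. Q (z x))" and c: "Q c"
  obtains z' where "\<And>x. Q (z' x)" "ae D (\<lambda>x. z' x = z x)" "cls D z' = cls D z"
proof -
  define z' where "z' x = (if Q (z x) then z x else c)" for x
  have "ae D (\<lambda>x. z' x = z x)" by (rule ae_mono[OF D z]) (simp add: z'_def)
  moreover from this have "cls D z' = cls D z" by (rule cls_cong[OF D])
  ultimately show ?thesis using that[of z'] c by (auto simp: z'_def)
qed

text \<open>The \<open>D\<close>-sum of the ultrafilters \<open>z x\<close>. Its ultrapower is the
  two-step iteration: by \<open>D\<close>, and then by the ultrafilter \<open>cls D z\<close> of the
  resulting model.\<close>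

definition usum :: "'v::zfc_universe \<Rightarrow> ('v \<Rightarrow> 'v) \<Rightarrow> 'v" where
  "usum D z = mk_uf (set_of (\<Union>x\<in>elts (uspace D). opair x ` elts (uspace (z x))))
     (\<lambda>P. ae D (\<lambda>x. ae (z x) (\<lambda>y. P (opair x y))))"

context
  fixes D :: "'v::zfc_universe" and z :: "'v \<Rightarrow> 'v"
  assumes D: "ccu D" and z: "\<And>x. ccu (z x)"
begin

lemma ccq_usum: "ccq (\<lambda>P. ae D (\<lambda>x. ae (z x) (\<lambda>y. P (opair x y))))"
  unfolding ccq_def ae_not[OF z] ae_not[OF D] ae_nat[OF z] ae_nat[OF D]
proof (intro conjI allI impI refl)
  fix P Q :: "'v \<Rightarrow> bool" assume PQ: "\<forall>x. P x \<longrightarrow> Q x"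
    and P: "ae D (\<lambda>x. ae (z x) (\<lambda>y. P (opair x y)))"
  show "ae D (\<lambda>x. ae (z x) (\<lambda>y. Q (opair x y)))"
    by (rule ae_mono[OF D P], erule ae_mono[OF z]) (use PQ in blast)
qed blast

lemma usum_space:
  "ae D (\<lambda>x. ae (z x) (\<lambda>y. opair x y \<in>
     elts (set_of (\<Union>x\<in>elts (uspace D). opair x ` elts (uspace (z x))))))"
proof -
  have "small (\<Union>x\<in>elts (uspace D). opair x ` elts (uspace (z x)))"
    by (intro small_UN small_image) auto
  then show ?thesis
    by (intro ae_all[OF D] ae_all[OF z]) auto
qed

lemma ccu_usum: "ccu (usum D z)"
  unfolding usum_def by (rule ccu_mk_uf[OF ccq_usum usum_space])

lemma ae_usum: "ae (usum D z) P \<longleftrightarrow> ae D (\<lambda>x. ae (z x) (\<lambda>y. P (opair x y)))"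
  unfolding usum_def by (rule ae_mk_uf[OF ccq_usum usum_space])

lemma cls_family_mem:
  assumes "x \<in> elts (cls D (\<lambda>x. cls (z x) (F x)))"
  obtains G where "x = cls D (\<lambda>x. cls (z x) (G x))"
proof -
  obtain g where g: "x = cls D g" "ae D (\<lambda>x. g x \<in> elts (cls (z x) (F x)))"
    using assms by (auto simp: elts_cls[OF D])
  have "ae D (\<lambda>x. \<exists>h. g x = cls (z x) h)"
    by (rule ae_mono[OF D g(2)]) (auto simp: elts_cls[OF z])
  then obtain G where "ae D (\<lambda>x. g x = cls (z x) (G x))"
    unfolding ae_ex_choice[OF D] by blast
  then have "x = cls D (\<lambda>x. cls (z x) (G x))" unfolding g(1) by (rule cls_cong[OF D])
  then show ?thesis by (rule that)
qed

text \<open>Both sides collapse the same relation on functions of pairs. The range on the right is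
  transitive because representatives of the inner elements can be chosen for almost all
  \<open>x\<close> at once and merged into one function of the pair.\<close>

lemma cls_usum: "cls (usum D z) F = cls D (\<lambda>x. cls (z x) (\<lambda>y. F (opair x y)))"
proof (rule collapse_unique[of "cls (usum D z)" "\<lambda>F. cls D (\<lambda>x. cls (z x) (\<lambda>y. F (opair x y)))" F])
  fix F G
  show "cls (usum D z) F \<in> elts (cls (usum D z) G) \<longleftrightarrow>
    cls D (\<lambda>x. cls (z x) (\<lambda>y. F (opair x y))) \<in> elts (cls D (\<lambda>x. cls (z x) (\<lambda>y. G (opair x y))))"
    by (simp add: cls_mem_iff[OF ccu_usum] cls_mem_iff[OF D] cls_mem_iff[OF z] ae_usum)
next
  fix x F assume "x \<in> elts (cls (usum D z) F)"
  then show "x \<in> range (cls (usum D z))" by (auto simp: elts_cls[OF ccu_usum])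
next
  fix x F assume "x \<in> elts (cls D (\<lambda>x. cls (z x) (\<lambda>y. F (opair x y))))"
  then obtain G where "x = cls D (\<lambda>x. cls (z x) (G x))" by (rule cls_family_mem)
  then have "x = cls D (\<lambda>x. cls (z x) (\<lambda>y. G (pfst (opair x y)) (psnd (opair x y))))" by simp
  then show "x \<in> range (\<lambda>F. cls D (\<lambda>x. cls (z x) (\<lambda>y. F (opair x y))))"
    by (rule range_eqI[where x = "\<lambda>p. G (pfst p) (psnd p)"])
qed

lemma cls_usum2: "cls D (\<lambda>x. cls (z x) (F x)) = cls (usum D z) (\<lambda>p. F (pfst p) (psnd p))"
  by (simp add: cls_usum)

end

text \<open>The first conjunct puts \<open>uspace (e i)\<close> into \<open>M\<close>, where a
  formula can quantify over it; every ultrafilter satisfies it.\<close>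

lemma fo_ult_mem:
  "fo (\<lambda>M e. uspace (e i) \<in> elts (e i) \<and> (e j, e k) \<in> ult_mem M (e i))"
proof (rule fo_cong[where Q = "\<lambda>M e. \<exists>X\<in>elts (e i). X = uspace (e i) \<and> function_on (e j) X \<and>
    function_on (e k) X \<and> (\<exists>A\<in>elts (e i). \<forall>x\<in>M. x \<in> elts A \<longleftrightarrow>
      x \<in> elts X \<and> (\<exists>a\<in>M. \<exists>b\<in>M. opair x a \<in> elts (e j) \<and> opair x b \<in> elts (e k) \<and> a \<in> elts b))"])
  fix M :: "'a set" and e :: "nat \<Rightarrow> 'a" assume M: "nice M" "range e \<subseteq> M"
  define Z g f where "Z = e i" and "g = e j" and "f = e k"
  have ZM: "Z \<in> M" "g \<in> M" "f \<in> M" using M(2) by (auto simp: Z_def g_def f_def)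
  show "(uspace (e i) \<in> elts (e i) \<and> (e j, e k) \<in> ult_mem M (e i)) \<longleftrightarrow>
    (\<exists>X\<in>elts (e i). X = uspace (e i) \<and> function_on (e j) X \<and>
    function_on (e k) X \<and> (\<exists>A\<in>elts (e i). \<forall>x\<in>M. x \<in> elts A \<longleftrightarrow>
      x \<in> elts X \<and> (\<exists>a\<in>M. \<exists>b\<in>M. opair x a \<in> elts (e j) \<and> opair x b \<in> elts (e k) \<and> a \<in> elts b)))"
    unfolding Z_def[symmetric] g_def[symmetric] f_def[symmetric]
  proof (cases "uspace Z \<in> elts Z \<and> function_on g (uspace Z) \<and> function_on f (uspace Z)")
    case True
    note gf = opair_mem_function[of g "uspace Z"] opair_mem_function[of f "uspace Z"]
    define S where "S = {x \<in> elts (uspace Z). app g x \<in> elts (app f x)}"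
    have S: "small S" "S \<subseteq> M" unfolding S_def using nice_uspace[OF M(1) ZM(1)] by auto
    have app: "app h x \<in> M" if h: "function_on h (uspace Z)" "h \<in> M" and x: "x \<in> elts (uspace Z)" for h x
    proof -
      have "opair x (app h x) \<in> elts h" using opair_mem_function[OF h(1) x] by blast
      then have "opair x (app h x) \<in> M" using nice_elts[OF M(1) h(2)] by blast
      then show ?thesis using opair_in_nice[OF M(1)] by blast
    qed
    have eq: "x \<in> elts (uspace Z) \<and> (\<exists>a\<in>M. \<exists>b\<in>M. opair x a \<in> elts g \<and> opair x b \<in> elts f \<and> a \<in> elts b)
      \<longleftrightarrow> x \<in> S" for x
      unfolding S_def using gf True app ZM by auto
    have "set_of S \<in> elts Z \<longleftrightarrow> (\<exists>A\<in>elts Z. \<forall>x\<in>M. x \<in> elts A \<longleftrightarrow> x \<in> S)" (is "_ = ?R")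
    proof
      assume ?R
      then obtain A where A: "A \<in> elts Z" "\<forall>x\<in>M. x \<in> elts A \<longleftrightarrow> x \<in> S" by blast
      then have "elts A = S" using S(2) nice_elts[OF M(1) nice_elts[OF M(1) ZM(1) A(1)]] by blast
      then show "set_of S \<in> elts Z" using A(1) by (metis set_of_elts)
    qed (use S(1) in \<open>auto intro!: bexI[of _ "set_of S"]\<close>)
    then have S': "set_of S \<in> elts Z \<longleftrightarrow> (\<exists>A\<in>elts Z. \<forall>x\<in>M. x \<in> elts A \<longleftrightarrow>
      x \<in> elts (uspace Z) \<and> (\<exists>a\<in>M. \<exists>b\<in>M. opair x a \<in> elts g \<and> opair x b \<in> elts f \<and> a \<in> elts b))"
      unfolding eq .
    have "(g, f) \<in> ult_mem M Z \<longleftrightarrow> set_of S \<in> elts Z"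
      using True ZM unfolding ult_mem_def ult_funs_def S_def by simp
    then show "(uspace Z \<in> elts Z \<and> (g, f) \<in> ult_mem M Z) \<longleftrightarrow>
      (\<exists>X\<in>elts Z. X = uspace Z \<and> function_on g X \<and> function_on f X \<and> (\<exists>A\<in>elts Z. \<forall>x\<in>M. x \<in> elts A \<longleftrightarrow>
      x \<in> elts X \<and> (\<exists>a\<in>M. \<exists>b\<in>M. opair x a \<in> elts g \<and> opair x b \<in> elts f \<and> a \<in> elts b)))"
      unfolding S' using True by blast
  next
    case False
    then show "(uspace Z \<in> elts Z \<and> (g, f) \<in> ult_mem M Z) \<longleftrightarrow>
      (\<exists>X\<in>elts Z. X = uspace Z \<and> function_on g X \<and> function_on f X \<and> (\<exists>A\<in>elts Z. \<forall>x\<in>M. x \<in> elts A \<longleftrightarrow>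
      x \<in> elts X \<and> (\<exists>a\<in>M. \<exists>b\<in>M. opair x a \<in> elts g \<and> opair x b \<in> elts f \<and> a \<in> elts b)))"
      unfolding ult_mem_def ult_funs_def by blast
  qed
qed (intro fo_intros)

lemma fo_const_fun [fo_intros]: "fo (\<lambda>M e. e i = restr (\<lambda>_. e j) (e k))"
proof (rule fo_cong[where Q = "\<lambda>M e. (\<forall>p\<in>elts (e i). \<exists>a\<in>elts (e k). p = opair a (e j)) \<and>
    (\<forall>a\<in>elts (e k). opair a (e j) \<in> elts (e i))"])
  fix M :: "'a set" and e :: "nat \<Rightarrow> 'a"
  show "(e i = restr (\<lambda>_. e j) (e k)) \<longleftrightarrow> (\<forall>p\<in>elts (e i). \<exists>a\<in>elts (e k). p = opair a (e j)) \<and>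
    (\<forall>a\<in>elts (e k). opair a (e j) \<in> elts (e i))" (is "_ = ?R")
  proof
    assume ?R
    then have "elts (e i) = elts (restr (\<lambda>_. e j) (e k))" by auto
    then show "e i = restr (\<lambda>_. e j) (e k)" by (rule extensionality)
  qed auto
qed (intro fo_intros)

context
  fixes D :: "'v::zfc_universe" and z :: "'v \<Rightarrow> 'v"
  assumes D: "ccu D" and z: "\<And>x. ccu (z x)"
begin

lemma uspace_cls: "uspace (cls D z) = cls D (\<lambda>x. uspace (z x))"
proof -
  have "cls D (\<lambda>x. uspace (z x)) = uspace (cls D z)"
    using los2[OF D, of "\<lambda>M a b. a = uspace b" "\<lambda>x. uspace (z x)" z, OF fo_eq_uspace]
    by (simp add: ae_const[OF D])
  then show ?thesis ..
qed

lemma ccu_cls: "cc_ultrafilter (ultrapower D) (cls D z)"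
  using los1[OF D, of cc_ultrafilter z, OF fo_cc_ultrafilter] z by (simp add: ae_const[OF D])

lemma function_on_cls:
  "function_on (cls D f) (uspace (cls D z)) \<longleftrightarrow> ae D (\<lambda>x. function_on (f x) (uspace (z x)))"
  unfolding uspace_cls using los2[OF D, of "\<lambda>M. function_on", OF fo_function_on] .

lemma ult_mem_cls:
  "(cls D g, cls D f) \<in> ult_mem (ultrapower D) (cls D z) \<longleftrightarrow>
    ae D (\<lambda>x. (g x, f x) \<in> ult_mem UNIV (z x))"
proof -
  have "uspace (cls D z) \<in> elts (cls D z)" using ccu_cls by (simp add: cc_ultrafilter_def)
  moreover have "uspace (z x) \<in> elts (z x)" for x by (rule ccu_D(1)[OF z])
  ultimately show ?thesis
    using los3[OF D, of "\<lambda>M Z g f. uspace Z \<in> elts Z \<and> (g, f) \<in> ult_mem M Z" z g f, OF fo_ult_mem]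
    by simp
qed

lemma ult_mem_cls_class:
  assumes "ae D (\<lambda>x. (g x, f x) \<in> ult_mem UNIV (z x))"
  shows "cls D (\<lambda>x. ult_class UNIV (z x) (g x)) \<in> elts (cls D (\<lambda>x. ult_class UNIV (z x) (f x)))"
  unfolding cls_mem_iff[OF D]
proof (rule ae_mono[OF D assms])
  fix x assume m: "(g x, f x) \<in> ult_mem UNIV (z x)"
  then obtain G F where "g x = restr G (uspace (z x))" "f x = restr F (uspace (z x))"
    unfolding ult_mem_def ult_funs_UNIV by blast
  then show "ult_class UNIV (z x) (g x) \<in> elts (ult_class UNIV (z x) (f x))"
    using m cls_mem_iff[OF z, of x G F] by (simp add: ult_mem_restr cls_def)
qed

text \<open>The sequence need not belong to the ultrapower of \<open>D\<close>, so well-foundedness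
  in the sense of that model is not enough. The pointwise collapses turn it into a descending
  membership sequence in \<open>V\<close>.\<close>

lemma wf_ult_mem_internal: "wf (ult_mem (ultrapower D) (cls D z))"
  unfolding wf_iff_no_infinite_down_chain
proof
  assume "\<exists>h. \<forall>i. (h (Suc i), h i) \<in> ult_mem (ultrapower D) (cls D z)"
  then obtain h where h: "\<And>i. (h (Suc i), h i) \<in> ult_mem (ultrapower D) (cls D z)" by blast
  then have "\<exists>f. h i = cls D f" for i
    using h[of i] by (auto simp: ult_mem_def ult_funs_def ultrapower_eq)
  then obtain f where f: "\<And>i. h i = cls D (f i)" by metis
  have "\<And>i. ae D (\<lambda>x. (f (Suc i) x, f i x) \<in> ult_mem UNIV (z x))"
    using h unfolding f ult_mem_cls .
  then have "\<And>i. cls D (\<lambda>x. ult_class UNIV (z x) (f (Suc i) x)) \<in>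
      elts (cls D (\<lambda>x. ult_class UNIV (z x) (f i x)))"
    by (rule ult_mem_cls_class)
  then show False using not_mem_chain[of "\<lambda>i. cls D (\<lambda>x. ult_class UNIV (z x) (f i x))"] by blast
qed

text \<open>The theorem of Los is applied only to the membership relation of the internal
  ultrapower; its collapse is computed by induction along that relation. An element of the right
  side is represented by collapses chosen at almost every \<open>x\<close>.\<close>

lemma ult_class_internal:
  assumes "ae D (\<lambda>x. function_on (f x) (uspace (z x)))"
  shows "ult_class (ultrapower D) (cls D z) (cls D f) = cls D (\<lambda>x. ult_class UNIV (z x) (f x))"
  using assms
proof (induction "cls D f" arbitrary: f rule: wf_induct_rule[OF wf_ult_mem_internal])
  case 1
  let ?R = "ult_mem (ultrapower D) (cls D z)"
  have IH: "ult_class (ultrapower D) (cls D z) (cls D g) = cls D (\<lambda>x. ult_class UNIV (z x) (g x))"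
    if "ae D (\<lambda>x. (g x, f x) \<in> ult_mem UNIV (z x))" for g
  proof (rule "1.hyps")
    show "(cls D g, cls D f) \<in> ?R" using that by (simp add: ult_mem_cls)
    show "ae D (\<lambda>x. function_on (g x) (uspace (z x)))"
      by (rule ae_mono[OF D that]) (auto simp: ult_mem_def ult_funs_def)
  qed
  have "ult_class (ultrapower D) (cls D z) ` {g. (g, cls D f) \<in> ?R} =
      elts (cls D (\<lambda>x. ult_class UNIV (z x) (f x)))" (is "?A = ?B")
  proof (intro subset_antisym subsetI)
    fix y assume "y \<in> ?A"
    then obtain h where h: "y = ult_class (ultrapower D) (cls D z) h" "(h, cls D f) \<in> ?R" by blast
    then obtain g where g: "h = cls D g" by (auto simp: ult_mem_def ult_funs_def ultrapower_eq)
    have *: "ae D (\<lambda>x. (g x, f x) \<in> ult_mem UNIV (z x))" using h(2) unfolding g ult_mem_cls .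
    show "y \<in> ?B" unfolding h(1) g IH[OF *] by (rule ult_mem_cls_class[OF *])
  next
    fix y assume "y \<in> ?B"
    then obtain k where k: "y = cls D k" "ae D (\<lambda>x. k x \<in> elts (ult_class UNIV (z x) (f x)))"
      by (auto simp: elts_cls[OF D])
    have "ae D (\<lambda>x. \<exists>g. (g, f x) \<in> ult_mem UNIV (z x) \<and> k x = ult_class UNIV (z x) g)"
    proof (rule ae_mp[OF D "1.prems" k(2)])
      fix x assume fx: "function_on (f x) (uspace (z x))" and kx: "k x \<in> elts (ult_class UNIV (z x) (f x))"
      define F where "F = app (f x)"
      have fF: "f x = restr F (uspace (z x))" unfolding F_def using function_on_app[OF fx] .
      then have "k x \<in> elts (cls (z x) F)" using kx by (simp add: cls_def)
      then obtain G where "k x = cls (z x) G" "ae (z x) (\<lambda>y. G y \<in> elts (F y))"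
        by (auto simp: elts_cls[OF z])
      then have "(restr G (uspace (z x)), f x) \<in> ult_mem UNIV (z x) \<and>
          k x = ult_class UNIV (z x) (restr G (uspace (z x)))"
        unfolding fF ult_mem_restr by (simp add: cls_def)
      then show "\<exists>g. (g, f x) \<in> ult_mem UNIV (z x) \<and> k x = ult_class UNIV (z x) g" ..
    qed
    then obtain g where g: "ae D (\<lambda>x. (g x, f x) \<in> ult_mem UNIV (z x) \<and> k x = ult_class UNIV (z x) (g x))"
      unfolding ae_ex_choice[OF D] by blast
    then have g1: "ae D (\<lambda>x. (g x, f x) \<in> ult_mem UNIV (z x))"
      and g2: "ae D (\<lambda>x. k x = ult_class UNIV (z x) (g x))" by (simp_all add: ae_conj[OF D])
    have "y = ult_class (ultrapower D) (cls D z) (cls D g)"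
      unfolding k(1) IH[OF g1] by (rule cls_cong[OF D g2])
    moreover have "(cls D g, cls D f) \<in> ?R" using g1 by (simp add: ult_mem_cls)
    ultimately show "y \<in> ?A" by blast
  qed
  then show ?case by (subst ult_class_rec[OF wf_ult_mem_internal]) simp
qed

lemma ult_class_internal_restr:
  "ult_class (ultrapower D) (cls D z) (cls D (\<lambda>x. restr (F x) (uspace (z x)))) =
    cls (usum D z) (\<lambda>p. F (pfst p) (psnd p))"
  by (subst ult_class_internal) (simp_all add: ae_const[OF D] cls_def[symmetric] cls_usum2[OF D z])

lemma Ult_internal: "Ult (ultrapower D) (cls D z) = ultrapower (usum D z)"
proof (intro subset_antisym subsetI)
  fix y assume "y \<in> Ult (ultrapower D) (cls D z)"
  then obtain h where h: "y = ult_class (ultrapower D) (cls D z) h" "h \<in> ultrapower D"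
    "function_on h (uspace (cls D z))" by (auto simp: Ult_def ult_funs_def)
  obtain f where f: "h = cls D f" using h(2) by (rule ultrapowerE)
  have "ae D (\<lambda>x. function_on (f x) (uspace (z x)))" using h(3) unfolding f function_on_cls .
  then have "ae D (\<lambda>x. f x = restr (app (f x)) (uspace (z x)))"
    by (rule ae_mono[OF D]) (rule function_on_app)
  then have "h = cls D (\<lambda>x. restr (app (f x)) (uspace (z x)))" unfolding f by (rule cls_cong[OF D])
  then show "y \<in> ultrapower (usum D z)" unfolding h(1) using ult_class_internal_restr by simp
next
  fix y assume "y \<in> ultrapower (usum D z)"
  then obtain F where F: "y = cls (usum D z) F" by (rule ultrapowerE)
  let ?h = "cls D (\<lambda>x. restr (\<lambda>v. F (opair x v)) (uspace (z x)))"
  have "y = ult_class (ultrapower D) (cls D z) ?h"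
    unfolding F ult_class_internal_restr by (simp add: cls_usum[OF D z])
  moreover have "?h \<in> ult_funs (ultrapower D) (cls D z)"
    by (simp add: ult_funs_def function_on_cls ae_const[OF D])
  ultimately show "y \<in> Ult (ultrapower D) (cls D z)" unfolding Ult_def by blast
qed

lemma ult_emb_internal:
  "ult_emb (ultrapower D) (cls D z) (cls D f) = cls (usum D z) (\<lambda>p. f (pfst p))"
proof -
  have "cls D (\<lambda>x. restr (\<lambda>_. f x) (uspace (z x))) = restr (\<lambda>_. cls D f) (uspace (cls D z))"
    using los3[OF D, of "\<lambda>M h a X. h = restr (\<lambda>_. a) X"
        "\<lambda>x. restr (\<lambda>_. f x) (uspace (z x))" f "\<lambda>x. uspace (z x)", OF fo_const_fun]
    by (simp add: ae_const[OF D] uspace_cls)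
  then show ?thesis unfolding ult_emb_def using ult_class_internal_restr[of "\<lambda>x _. f x"] by simp
qed

end

text \<open>The normal form in which internal ultrapowers enter the rest of the proof. The theorem
  of Los makes the factors ultrafilters almost everywhere, and \<open>trivial_uf\<close> fills the
  remaining indices.\<close>

lemma internal_iff:
  assumes D: "ccu D"
  shows "internal_ultrapower_embedding (ultrapower D) N i \<longleftrightarrow>
    (\<exists>z. (\<forall>x. ccu (z x)) \<and> N = ultrapower (usum D z) \<and>
      (\<forall>f. i (cls D f) = cls (usum D z) (\<lambda>p. f (pfst p))))" (is "?L = ?R")
proof
  assume ?L
  then obtain Z where Z: "cc_ultrafilter (ultrapower D) Z" "N = Ult (ultrapower D) Z"
    "\<forall>x\<in>ultrapower D. i x = ult_emb (ultrapower D) Z x"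
    unfolding internal_ultrapower_embedding_def by blast
  then have "Z \<in> ultrapower D" by (simp add: cc_ultrafilter_def)
  then obtain z0 where z0: "Z = cls D z0" by (rule ultrapowerE)
  have "ae D (\<lambda>x. ccu (z0 x))"
    using Z(1) los1[OF D, of cc_ultrafilter z0, OF fo_cc_ultrafilter] unfolding z0 by simp
  then obtain z where z: "\<And>x. ccu (z x)" "Z = cls D z"
    using family_everywhere[OF D, of ccu z0 trivial_uf] ccu_trivial_uf z0 by metis
  show ?R using z Z(2,3) Ult_internal[OF D z(1)] ult_emb_internal[OF D z(1)] by auto
next
  assume ?R
  then obtain z where z: "\<And>x. ccu (z x)" "N = ultrapower (usum D z)"
    "\<And>f. i (cls D f) = cls (usum D z) (\<lambda>p. f (pfst p))" by blast
  have "i x = ult_emb (ultrapower D) (cls D z) x" if x: "x \<in> ultrapower D" for x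
    using x by (rule ultrapowerE) (simp add: z(3) ult_emb_internal[OF D z(1)])
  then show ?L unfolding internal_ultrapower_embedding_def
    by (intro exI[of _ "cls D z"] conjI ballI ccu_cls[OF D z(1)])
      (simp_all add: Ult_internal[OF D z(1)] z(2))
qed

lemma internal_elementary:
  assumes D: "ccu D" and z: "\<And>x. ccu (z x)"
    and i: "\<And>f. i (cls D f) = cls (usum D z) (\<lambda>p. f (pfst p))"
  shows "elementary_embedding (ultrapower D) (ultrapower (usum D z)) i"
proof (rule elementary_mapI[where i = i and g = "\<lambda>f p. f (pfst p)"])
  show "ccu (usum D z)" by (rule ccu_usum[OF D z])
qed (simp_all add: D i ae_usum[OF D z] ae_const[OF z])

section \<open>Transporting internal ultrapowers along elementary embeddings\<close>

lemma fo_ren: "fo P \<Longrightarrow> inj r \<Longrightarrow> fo (\<lambda>M e. P M (\<lambda>n. e (r n)))"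
proof (erule foE)
  fix p assume r: "inj r" and p: "\<And>M e. nice M \<Longrightarrow> range e \<subseteq> M \<Longrightarrow> P M e = sat M p e"
  have "P M (\<lambda>n. e (r n)) = sat M (ren r p) e" if "nice M" "range e \<subseteq> M" for M e
    using p[of M "\<lambda>n. e (r n)"] that by (simp add: sat_ren[OF r] image_subset_iff)
  then show ?thesis by (rule foI)
qed

text \<open>Unlike \<^const>\<open>app\<close>, this is definable also off the functions.\<close>

definition fapp :: "'v::zfc_universe \<Rightarrow> 'v \<Rightarrow> 'v" where
  "fapp h v = (if \<exists>!b. opair v b \<in> elts h then THE b. opair v b \<in> elts h else set_of {})"

lemma fapp_restr: "v \<in> elts X \<Longrightarrow> fapp (restr F X) v = F v"
  by (auto simp: fapp_def)

lemma fapp_eq_iff: "b = fapp h v \<longleftrightarrow>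
    (opair v b \<in> elts h \<and> (\<forall>c. opair v c \<in> elts h \<longrightarrow> c = b)) \<or>
    (\<not> (\<exists>b. opair v b \<in> elts h \<and> (\<forall>c. opair v c \<in> elts h \<longrightarrow> c = b)) \<and> elts b = {})"
proof (cases "\<exists>!b. opair v b \<in> elts h")
  case True
  then obtain b0 where b0: "opair v b0 \<in> elts h" "\<And>c. opair v c \<in> elts h \<Longrightarrow> c = b0" by blast
  have "(THE b. opair v b \<in> elts h) = b0" by (rule the_equality) (fact b0)+
  then have "fapp h v = b0" unfolding fapp_def using True by simp
  then show ?thesis using b0 by blast
next
  case False
  have e: "b = set_of {} \<longleftrightarrow> elts b = {}" by (metis elts_set_of_small set_of_elts small_empty)
  have n: "\<not> (\<exists>b. opair v b \<in> elts h \<and> (\<forall>c. opair v c \<in> elts h \<longrightarrow> c = b))"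
    using False by (simp add: Ex1_def)
  then have nb: "\<not> (opair v b \<in> elts h \<and> (\<forall>c. opair v c \<in> elts h \<longrightarrow> c = b))" by iprover
  have f: "fapp h v = set_of {}" unfolding fapp_def using False by (simp only: if_False)
  have "\<not> B \<Longrightarrow> \<not> E \<Longrightarrow> X \<longleftrightarrow> B \<or> (\<not> E \<and> X)" for B E X by blast
  from this[OF nb n] show ?thesis unfolding f e .
qed

text \<open>The graph of \<open>fapp\<close> relativised to a model, since a formula can describe
  the graph but not contain the term.\<close>

definition is_fapp :: "'v::zfc_universe set \<Rightarrow> 'v \<Rightarrow> 'v \<Rightarrow> 'v \<Rightarrow> bool" where
  "is_fapp M b h v \<longleftrightarrow> (opair v b \<in> elts h \<and> (\<forall>c\<in>M. opair v c \<in> elts h \<longrightarrow> c = b)) \<or>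
    (\<not> (\<exists>b\<in>M. opair v b \<in> elts h \<and> (\<forall>c\<in>M. opair v c \<in> elts h \<longrightarrow> c = b)) \<and> elts b = {})"

lemma is_fapp_UNIV: "is_fapp UNIV b h v \<longleftrightarrow> b = fapp h v"
  by (simp add: is_fapp_def fapp_eq_iff)

lemma fo_is_fapp [fo_intros]: "fo (\<lambda>M e. is_fapp M (e i) (e j) (e k))"
  unfolding is_fapp_def by (intro fo_intros)

text \<open>
  The quantifier over the value of a bound variable becomes a quantifier over functions, since every
  value is taken at the given point by some function.
\<close>

lemma fo_sat_pointwise:
  "\<exists>Q :: 'v::zfc_universe set \<Rightarrow> (nat \<Rightarrow> 'v) \<Rightarrow> bool. fo Q \<and> (\<forall>e. Q UNIV e \<longleftrightarrow> sat UNIV p (\<lambda>n. fapp (e (Suc n)) (e 0)))"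
proof (induction p)
  case (Mem m n)
  show ?case
    by (rule exI[of _ "\<lambda>M e. \<exists>a\<in>M. \<exists>b\<in>M. is_fapp M a (e (Suc m)) (e 0) \<and>
        is_fapp M b (e (Suc n)) (e 0) \<and> a \<in> elts b"], rule conjI)
      (intro fo_intros | simp add: is_fapp_UNIV)+
next
  case (Eq m n)
  show ?case
    by (rule exI[of _ "\<lambda>M e. \<exists>a\<in>M. \<exists>b\<in>M. is_fapp M a (e (Suc m)) (e 0) \<and>
        is_fapp M b (e (Suc n)) (e 0) \<and> a = b"], rule conjI)
      (intro fo_intros | simp add: is_fapp_UNIV)+
next
  case (Neg p)
  then obtain Q :: "'v set \<Rightarrow> (nat \<Rightarrow> 'v) \<Rightarrow> bool" where "fo Q" "\<forall>e. Q UNIV e \<longleftrightarrow> sat UNIV p (\<lambda>n. fapp (e (Suc n)) (e 0))" by blast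
  then show ?case by (intro exI[of _ "\<lambda>M e. \<not> Q M e"] conjI fo_not) simp_all
next
  case (Conj p q)
  then obtain Q R :: "'v set \<Rightarrow> (nat \<Rightarrow> 'v) \<Rightarrow> bool" where "fo Q" "\<forall>e. Q UNIV e \<longleftrightarrow> sat UNIV p (\<lambda>n. fapp (e (Suc n)) (e 0))"
    "fo R" "\<forall>e. R UNIV e \<longleftrightarrow> sat UNIV q (\<lambda>n. fapp (e (Suc n)) (e 0))" by blast
  then show ?case by (intro exI[of _ "\<lambda>M e. Q M e \<and> R M e"] conjI fo_conj) simp_all
next
  case (All n p)
  then obtain Q :: "'v set \<Rightarrow> (nat \<Rightarrow> 'v) \<Rightarrow> bool" where Q: "fo Q" "\<And>e. Q UNIV e \<longleftrightarrow> sat UNIV p (\<lambda>n. fapp (e (Suc n)) (e 0))" by blast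
  have "(\<forall>h. Q UNIV (e(Suc n := h))) \<longleftrightarrow> sat UNIV (All n p) (\<lambda>n. fapp (e (Suc n)) (e 0))" for e
  proof -
    let ?a = "\<lambda>n. fapp (e (Suc n)) (e 0)"
    have 1: "Q UNIV (e(Suc n := h)) \<longleftrightarrow> sat UNIV p (?a(n := fapp h (e 0)))" for h
      unfolding Q(2) by (rule arg_cong[of _ _ "sat UNIV p"]) auto
    have 2: "\<exists>h. fapp h (e 0) = x" for x
      by (rule exI[of _ "restr (\<lambda>_. x) (set_of {e 0})"]) (simp add: fapp_restr)
    show ?thesis unfolding 1 sat.simps using 2 by (metis UNIV_I)
  qed
  then show ?case
    by (intro exI[of _ "\<lambda>M e. \<forall>h\<in>M. Q M (e(Suc n := h))"] conjI fo_all_upd Q(1)) simp_all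
qed

text \<open>Truth of \<open>P\<close> modulo the ultrafilter \<open>e 0\<close>, at functions coded
  by the \<open>e (Suc n)\<close>, is itself first-order in the ultrafilter and the codes. An
  elementary embedding that moves these therefore preserves it.\<close>

lemma fo_ae_pointwise:
  fixes P :: "'v::zfc_universe set \<Rightarrow> (nat \<Rightarrow> 'v) \<Rightarrow> bool"
  assumes "fo P"
  obtains Q :: "'v set \<Rightarrow> (nat \<Rightarrow> 'v) \<Rightarrow> bool" where "fo Q"
    "\<And>e. ccu (e 0) \<Longrightarrow> Q UNIV e \<longleftrightarrow> ae (e 0) (\<lambda>v. P UNIV (\<lambda>n. fapp (e (Suc n)) v))"
proof -
  obtain p where p: "\<And>M e. nice M \<Longrightarrow> range e \<subseteq> M \<Longrightarrow> P M e = sat M p e" using assms by (rule foE) blast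
  obtain R :: "'v set \<Rightarrow> (nat \<Rightarrow> 'v) \<Rightarrow> bool" where R: "fo R" "\<And>e. R UNIV e \<longleftrightarrow> sat UNIV p (\<lambda>n. fapp (e (Suc n)) (e 0))"
    using fo_sat_pointwise[of p] by blast
  \<comment> \<open>Under the two quantifiers index 0 is \<open>v\<close>, 1 is \<open>A\<close>, 2
    is the ultrafilter, and the functions begin at 3; \<open>r\<close> skips the indices 1 and
    2.\<close>
  define r where "r = case_nat 0 (\<lambda>n. Suc (Suc (Suc n)))"
  have "inj r" by (auto simp: inj_def r_def split: nat.splits)
  then have r: "fo (\<lambda>M e. R M (\<lambda>n. e (r n)))" by (rule fo_ren[OF R(1)])
  have re: "(\<lambda>n. e (r n)) = case_nat (e 0) (\<lambda>n. e (Suc (Suc (Suc n))))" for e :: "nat \<Rightarrow> 'v"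
    by (auto simp: r_def split: nat.splits)
  define Q where "Q M e \<longleftrightarrow> (\<exists>A\<in>elts (e 0). \<forall>v\<in>elts A. R M (case_nat v (\<lambda>n. e (Suc n))))"
    for M :: "'v set" and e
  show ?thesis
  proof (rule that)
    show "fo Q" unfolding Q_def[abs_def]
      by (intro fo_bex fo_ball) (rule r[unfolded re])
    fix e :: "nat \<Rightarrow> 'v" assume Z: "ccu (e 0)"
    have "Q UNIV e \<longleftrightarrow> (\<exists>A\<in>elts (e 0). \<forall>v\<in>elts A. P UNIV (\<lambda>n. fapp (e (Suc n)) v))"
      unfolding Q_def R(2) using p[of UNIV] by simp
    also have "\<dots> \<longleftrightarrow> ae (e 0) (\<lambda>v. P UNIV (\<lambda>n. fapp (e (Suc n)) v))" (is "_ \<longleftrightarrow> ae _ ?P")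
    proof
      assume "\<exists>A\<in>elts (e 0). \<forall>v\<in>elts A. ?P v"
      then obtain A where A: "A \<in> elts (e 0)" "\<forall>v\<in>elts A. ?P v" by blast
      then have "elts A \<subseteq> {v \<in> elts (uspace (e 0)). ?P v}" by (auto simp: elts_uspace)
      then show "ae (e 0) ?P" unfolding ae_def by (intro ccu_D(3)[OF Z A(1)]) auto
    next
      assume "ae (e 0) ?P"
      then show "\<exists>A\<in>elts (e 0). \<forall>v\<in>elts A. ?P v" unfolding ae_def
        by (rule bexI[rotated]) simp
    qed
    finally show "Q UNIV e \<longleftrightarrow> ae (e 0) ?P" .
  qed
qed

text \<open>The shift of an internal ultrapower along \<open>i\<close>: the ultrafilter
  \<open>cls D z\<close> goes to \<open>cls E y\<close>, and the class of a function goes to the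
  class of its image under \<open>i\<close>. Since \<open>i\<close> is an arbitrary class map, truth
  in the internal ultrapower must first be turned into a statement about elements of
  \<open>ultrapower D\<close>, by \<open>fo_ae_pointwise\<close>. The last conclusion says that
  \<open>k\<close> and \<open>i\<close> commute with the two internal embeddings.\<close>

lemma push_internal:
  assumes D: "ccu D" and E: "ccu E" and z: "\<And>x. ccu (z x)"
    and i: "elementary_embedding (ultrapower D) (ultrapower E) i"
  obtains y k where "\<And>x. ccu (y x)"
    "elementary_embedding (ultrapower (usum D z)) (ultrapower (usum E y)) k"
    "\<And>f g. i (cls D f) = cls E g \<Longrightarrow>
      k (cls (usum D z) (\<lambda>p. f (pfst p))) = cls (usum E y) (\<lambda>p. g (pfst p))"
proof -
  note nD = nice_ultrapower[OF D] and nE = nice_ultrapower[OF E]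
  have iE: "\<exists>g. i (cls D f) = cls E g" for f
  proof -
    have "i (cls D f) \<in> ultrapower E" using i cls_in unfolding elementary_embedding_def by blast
    then show ?thesis by (auto simp: ultrapower_eq)
  qed
  obtain y0 where y0: "i (cls D z) = cls E y0" using iE by blast
  have "cc_ultrafilter (ultrapower E) (cls E y0)"
    using elementary1[OF i nD nE, of cc_ultrafilter "cls D z", OF fo_cc_ultrafilter] ccu_cls[OF D z] y0
    by simp
  then have "ae E (\<lambda>x. ccu (y0 x))" using los1[OF E, of cc_ultrafilter y0, OF fo_cc_ultrafilter] by simp
  then obtain y where y: "\<And>x. ccu (y x)" "i (cls D z) = cls E y"
    using family_everywhere[OF E, of ccu y0 trivial_uf] ccu_trivial_uf y0 by metis
  \<comment> \<open>\<open>code F\<close> is the element of \<open>ultrapower D\<close> that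
    represents \<open>cls (usum D z) F\<close> in the internal ultrapower; \<open>h F\<close>
    represents its image under \<open>i\<close>, and \<open>G F\<close> evaluates that
    image.\<close>
  define code where "code F = cls D (\<lambda>x. restr (\<lambda>v. F (opair x v)) (uspace (z x)))" for F
  define h where "h F = (SOME g. i (code F) = cls E g)" for F
  have h: "i (code F) = cls E (h F)" for F
  proof -
    have "\<exists>g. i (code F) = cls E g" unfolding code_def by (rule iE)
    then show ?thesis unfolding h_def by (rule someI_ex[of "\<lambda>g. i (code F) = cls E g"])
  qed
  define G where "G F p = fapp (h F (pfst p)) (psnd p)" for F p
  note S = ccu_usum[OF D z] and T = ccu_usum[OF E y(1)]
  have tr: "ae (usum D z) (\<lambda>p. P UNIV (\<lambda>n. F n p)) \<longleftrightarrow> ae (usum E y) (\<lambda>p. P UNIV (\<lambda>n. G (F n) p))"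
    if P: "fo P" for P and F :: "nat \<Rightarrow> 'a \<Rightarrow> 'a"
  proof -
    obtain Q where Q: "fo Q"
      "\<And>e. ccu (e 0) \<Longrightarrow> Q UNIV e \<longleftrightarrow> ae (e 0) (\<lambda>v. P UNIV (\<lambda>n. fapp (e (Suc n)) v))"
      using P by (rule fo_ae_pointwise) blast
    define c where "c n x = restr (\<lambda>v. F n (opair x v)) (uspace (z x))" for n x
    have c: "code (F n) = cls D (c n)" for n unfolding code_def c_def ..
    have 1: "ae (z x) (\<lambda>v. P UNIV (\<lambda>n. F n (opair x v))) \<longleftrightarrow> Q UNIV (case_nat (z x) (\<lambda>n. c n x))" for x
    proof -
      have "Q UNIV (case_nat (z x) (\<lambda>n. c n x)) \<longleftrightarrow> ae (z x) (\<lambda>v. P UNIV (\<lambda>n. fapp (c n x) v))"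
        using Q(2)[of "case_nat (z x) (\<lambda>n. c n x)"] z by simp
      also have "\<dots> \<longleftrightarrow> ae (z x) (\<lambda>v. P UNIV (\<lambda>n. F n (opair x v)))"
        by (rule ae_cong) (simp add: c_def fapp_restr)
      finally show ?thesis ..
    qed
    have e1: "(\<lambda>n. cls D (case_nat z c n)) = case_nat (cls D z) (\<lambda>n. code (F n))"
      by (auto simp: c split: nat.splits)
    have e1': "(\<lambda>n. case_nat z c n x) = case_nat (z x) (\<lambda>n. c n x)" for x
      by (auto split: nat.splits)
    have e2: "(\<lambda>n. cls E (case_nat y (\<lambda>n. h (F n)) n)) = (\<lambda>n. i (case_nat (cls D z) (\<lambda>n. code (F n)) n))"
      by (auto simp: y(2) h split: nat.splits)
    have e2': "(\<lambda>n. case_nat y (\<lambda>n. h (F n)) n x) = case_nat (y x) (\<lambda>n. h (F n) x)" for x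
      by (auto split: nat.splits)
    have "ae (usum D z) (\<lambda>p. P UNIV (\<lambda>n. F n p)) \<longleftrightarrow> ae D (\<lambda>x. Q UNIV (case_nat (z x) (\<lambda>n. c n x)))"
      by (simp add: ae_usum[OF D z] 1)
    also have "\<dots> \<longleftrightarrow> Q (ultrapower D) (case_nat (cls D z) (\<lambda>n. code (F n)))"
      using los[OF D Q(1), of "case_nat z c"] unfolding e1 e1' ..
    also have "\<dots> \<longleftrightarrow> Q (ultrapower E) (\<lambda>n. i (case_nat (cls D z) (\<lambda>n. code (F n)) n))"
      by (rule elementary_transfer[OF i nD nE Q(1)]) (auto simp: code_def split: nat.splits)
    also have "\<dots> \<longleftrightarrow> ae E (\<lambda>x. Q UNIV (case_nat (y x) (\<lambda>n. h (F n) x)))"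
      using los[OF E Q(1), of "case_nat y (\<lambda>n. h (F n))"] unfolding e2 e2' .
    also have "\<dots> \<longleftrightarrow> ae E (\<lambda>x. ae (y x) (\<lambda>v. P UNIV (\<lambda>n. fapp (h (F n) x) v)))"
      using Q(2)[of "case_nat (y x) (\<lambda>n. h (F n) x)" for x] y(1) by simp
    also have "\<dots> \<longleftrightarrow> ae (usum E y) (\<lambda>p. P UNIV (\<lambda>n. G (F n) p))"
      by (simp add: ae_usum[OF E y(1)] G_def)
    finally show ?thesis .
  qed
  \<comment> \<open>Defined through an arbitrary representative; \<open>tr\<close> for the formula
    of equality makes the choice immaterial.\<close>
  define k where "k w = cls (usum E y) (G (SOME F. w = cls (usum D z) F))" for w
  have k: "k (cls (usum D z) F) = cls (usum E y) (G F)" for F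
  proof -
    define F' where "F' = (SOME F'. cls (usum D z) F = cls (usum D z) F')"
    have "cls (usum D z) F = cls (usum D z) F'" unfolding F'_def by (rule someI[of "\<lambda>F'. cls (usum D z) F = cls (usum D z) F'"]) (rule refl)
    then have "ae (usum D z) (\<lambda>p. F p = F' p)" by (simp add: cls_eq_iff[OF S])
    then have "ae (usum E y) (\<lambda>p. G F p = G F' p)"
      using tr[of "\<lambda>M e. e 0 = e (Suc 0)" "case_nat F (\<lambda>_. F')", OF fo_eq] by simp
    then have "cls (usum E y) (G F) = cls (usum E y) (G F')" by (simp add: cls_eq_iff[OF T])
    then show ?thesis unfolding k_def F'_def[symmetric] by simp
  qed
  show ?thesis
  proof (rule that[OF y(1)])
    show "elementary_embedding (ultrapower (usum D z)) (ultrapower (usum E y)) k"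
      by (rule elementary_mapI[where i = k and g = G]) (use S T k tr in simp_all)
    fix f g assume fg: "i (cls D f) = cls E g"
    \<comment> \<open>The code of a function of the first coordinate is a constant function with
      value \<open>cls D f\<close>. Being constant is first-order, so its image is the constant
      function with value \<open>cls E g\<close>.\<close>
    have "code (\<lambda>p. f (pfst p)) = cls D (\<lambda>x. restr (\<lambda>_. f x) (uspace (z x)))" by (simp add: code_def)
    also have "\<dots> = restr (\<lambda>_. cls D f) (uspace (cls D z))"
      using los3[OF D, of "\<lambda>M h a X. h = restr (\<lambda>_. a) X"
        "\<lambda>x. restr (\<lambda>_. f x) (uspace (z x))" f "\<lambda>x. uspace (z x)", OF fo_const_fun]
      by (simp add: ae_const[OF D] uspace_cls[OF D z])
    finally have c: "code (\<lambda>p. f (pfst p)) = restr (\<lambda>_. cls D f) (uspace (cls D z))" .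
    have us: "uspace (cls D z) \<in> ultrapower D" by (simp add: uspace_cls[OF D z])
    have "i (uspace (cls D z)) = uspace (cls E y)"
      using elementary2[OF i nD nE, of "\<lambda>M a b. a = uspace b" "uspace (cls D z)" "cls D z", OF fo_eq_uspace] us
      by (simp add: y(2))
    then have "i (code (\<lambda>p. f (pfst p))) = restr (\<lambda>_. cls E g) (uspace (cls E y))"
      using elementary3[OF i nD nE, of "\<lambda>M h a X. h = restr (\<lambda>_. a) X"
        "code (\<lambda>p. f (pfst p))" "cls D f" "uspace (cls D z)", OF fo_const_fun] us fg c
      by (simp add: code_def)
    then have "cls E (h (\<lambda>p. f (pfst p))) = restr (\<lambda>_. cls E g) (cls E (\<lambda>x. uspace (y x)))"
      by (simp add: h uspace_cls[OF E y(1)])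
    then have "ae E (\<lambda>x. h (\<lambda>p. f (pfst p)) x = restr (\<lambda>_. g x) (uspace (y x)))"
      using los3[OF E, of "\<lambda>M h a X. h = restr (\<lambda>_. a) X"
        "h (\<lambda>p. f (pfst p))" g "\<lambda>x. uspace (y x)", OF fo_const_fun] by simp
    then have "ae E (\<lambda>x. ae (y x) (\<lambda>v. G (\<lambda>p. f (pfst p)) (opair x v) = g x))"
      by (rule ae_mono[OF E]) (auto intro!: ae_all[OF y(1)] simp: G_def fapp_restr)
    then show "k (cls (usum D z) (\<lambda>p. f (pfst p))) = cls (usum E y) (\<lambda>p. g (pfst p))"
      unfolding k cls_eq_iff[OF T] ae_usum[OF E y(1)] by simp
  qed
qed

section \<open>The completed seed order\<close>

text \<open>The direct limit of the iteration is never formed. A point of stage \<open>n\<close> is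
  \<open>good\<close> if, for every \<open>j\<close>, the comparison \<open>j\<close> stages later
  holds for almost all continuations. Almost every point of stage 0 is good and a good point has a
  good continuation; along the resulting thread the values of \<open>b\<close> descend.\<close>

lemma no_descending_iteration:
  fixes E :: "nat \<Rightarrow> 'v::zfc_universe" and y b :: "nat \<Rightarrow> 'v \<Rightarrow> 'v"
  assumes E0: "ccu (E 0)" and y: "\<And>n x. ccu (y n x)" and E: "\<And>n. E (Suc n) = usum (E n) (y n)"
    and b: "\<And>n. ae (E (Suc n)) (\<lambda>p. b (Suc n) p \<in> elts (b n (pfst p)))"
  shows False
proof -
  have cE: "ccu (E n)" for n by (induction n) (simp_all add: E0 E ccu_usum y)
  \<comment> \<open>Stage 0 has no predecessor, so \<open>A\<close> is vacuous there.
    \<open>H j n x\<close> asserts \<open>A\<close> at stage \<open>n + j\<close> for almost all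
    ways of appending \<open>j\<close> coordinates to \<open>x\<close>.\<close>
  define A where "A n p \<longleftrightarrow> (case n of 0 \<Rightarrow> True | Suc m \<Rightarrow> b (Suc m) p \<in> elts (b m (pfst p)))" for n p
  define H where "H = rec_nat A (\<lambda>_ R n x. ae (y n x) (\<lambda>v. R (Suc n) (opair x v)))"
  have H: "H 0 n x \<longleftrightarrow> A n x" "H (Suc j) n x \<longleftrightarrow> ae (y n x) (\<lambda>v. H j (Suc n) (opair x v))" for j n x
    by (simp_all add: H_def)
  have aH: "ae (E n) (H j n)" for j n
  proof (induction j arbitrary: n)
    case 0
    show ?case
    proof (cases n)
      case 0
      then show ?thesis using ae_const[OF E0, of True] by (simp add: H A_def)
    qed (use b in \<open>simp add: H(1) A_def\<close>)
  next
    case (Suc j)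
    from Suc[of "Suc n"] show ?case by (simp add: E ae_usum[OF cE y] H(2))
  qed
  define good where "good n x \<longleftrightarrow> (\<forall>j. H j n x)" for n x
  have "ae (E 0) (good 0)" unfolding good_def ae_nat[OF E0] using aH by simp
  then obtain x0 where x0: "good 0 x0" using ae_exD[OF E0] by blast
  have step: "\<exists>v. good (Suc n) (opair x v)" if "good n x" for n x
  proof -
    have "\<forall>j. H (Suc j) n x" using that by (simp add: good_def)
    then have "ae (y n x) (\<lambda>v. \<forall>j. H j (Suc n) (opair x v))" unfolding H(2) ae_nat[OF y] .
    then show ?thesis unfolding good_def by (rule ae_exD[OF y])
  qed
  obtain s where s: "\<And>n. good n (s n)" "\<And>n. \<exists>v. s (Suc n) = opair (s n) v"
    using dependent_nat_choice[of good "\<lambda>n x x'. \<exists>v. x' = opair x v"] x0 step by metis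
  have "b (Suc n) (s (Suc n)) \<in> elts (b n (s n))" for n
  proof -
    have "H 0 (Suc n) (s (Suc n))" using s(1) by (simp add: good_def)
    moreover have "pfst (s (Suc n)) = s n" using s(2)[of n] by auto
    ultimately show ?thesis by (simp add: H(1) A_def)
  qed
  then show False using not_mem_chain[of "\<lambda>n. b n (s n)"] by blast
qed

section \<open>Elementary embeddings and ordinals\<close>

lemma elementary_compose:
  assumes "elementary_embedding M N i" "elementary_embedding N K k"
  shows "elementary_embedding M K (k \<circ> i)"
  unfolding elementary_embedding_def
proof (intro conjI allI impI)
  show "(k \<circ> i) ` M \<subseteq> K" using assms unfolding elementary_embedding_def image_comp[symmetric] by blast
  fix p and e :: "nat \<Rightarrow> 'a" assume e: "range e \<subseteq> M"
  have "range (\<lambda>n. i (e n)) \<subseteq> N" using e assms(1) unfolding elementary_embedding_def by blast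
  then show "sat M p e = sat K p (\<lambda>n. (k \<circ> i) (e n))"
    using e assms unfolding elementary_embedding_def comp_def by metis
qed

lemma elementary_id: "elementary_embedding M M (\<lambda>x. x)"
  by (simp add: elementary_embedding_def)

lemma elementary_ordinal:
  assumes i: "elementary_embedding M N i" and M: "nice M" and N: "nice N"
    and \<alpha>: "ordinal \<alpha>" "\<alpha> \<in> M"
  shows "ordinal (i \<alpha>)" "elts \<alpha> \<subseteq> elts (i \<alpha>)"
proof -
  have ord: "ordinal (i \<beta>)" if "ordinal \<beta>" "\<beta> \<in> M" for \<beta>
    using elementary1[OF i M N, of "\<lambda>_. ordinal" \<beta>, OF fo_ordinal] that by simp
  show "ordinal (i \<alpha>)" by (rule ord[OF \<alpha>])
  show "elts \<alpha> \<subseteq> elts (i \<alpha>)"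
    using \<alpha>
  proof (induction \<alpha> rule: mem_induct)
    case (1 \<alpha>)
    show ?case
    proof
      fix \<beta> assume \<beta>: "\<beta> \<in> elts \<alpha>"
      then have \<beta>M: "\<beta> \<in> M" "ordinal \<beta>" using 1 M nice_elts ordinal_mem by blast+
      then have "elts \<beta> \<subseteq> elts (i \<beta>)" using 1 \<beta> by blast
      then have "\<beta> = i \<beta> \<or> \<beta> \<in> elts (i \<beta>)"
        using ordinal_subset_iff ord \<beta>M by blast
      moreover have "i \<beta> \<in> elts (i \<alpha>)"
        using elementary2[OF i M N, of "\<lambda>_ a b. a \<in> elts b" \<beta> \<alpha>, OF fo_mem] \<beta> \<beta>M 1(3) by simp
      moreover have "ordinal (i \<alpha>)" using ord 1 by blast
      ultimately show "\<beta> \<in> elts (i \<alpha>)" using ordinal_transitive by metis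
    qed
  qed
qed

lemma j_ult_elementary: "ccu U \<Longrightarrow> elementary_embedding UNIV (ultrapower U) (j_ult U)"
  unfolding elementary_embedding_def
proof (intro conjI allI impI)
  fix p and e :: "nat \<Rightarrow> 'a" assume U: "ccu U"
  show "sat UNIV p e = sat (ultrapower U) p (\<lambda>n. j_ult U (e n))"
    unfolding j_ult_eq sat_ultrapower[OF U] ae_const[OF U] ..
qed (auto simp: j_ult_eq)

text \<open>An ordinal is at most its image under \<open>j_ult U\<close>, and this image lies in the
  transitive ultrapower.\<close>

lemma ordinal_in_ultrapower:
  assumes U: "ccu U" and \<alpha>: "ordinal \<alpha>"
  shows "\<alpha> \<in> ultrapower U"
proof -
  note j = elementary_ordinal[OF j_ult_elementary[OF U] nice_UNIV nice_ultrapower[OF U] \<alpha> UNIV_I]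
  have "\<alpha> = j_ult U \<alpha> \<or> \<alpha> \<in> elts (j_ult U \<alpha>)" using ordinal_subset_iff j \<alpha> by blast
  moreover have "j_ult U \<alpha> \<in> ultrapower U" by (simp add: j_ult_eq)
  ultimately show ?thesis using ultrapower_transitive[OF U] by auto
qed

lemma ordinal_cls: "ccu U \<Longrightarrow> ordinal (cls U f) \<longleftrightarrow> ae U (\<lambda>x. ordinal (f x))"
  by (rule los1[of U "\<lambda>_. ordinal", OF _ fo_ordinal])

text \<open>With a parameter for the final comparison, transitivity and the passage to ultraproducts
  cover the strict order and \<open>seed_le\<close> at once; of \<open>S\<close> they use
  first-order definability.\<close>

definition seed_rel ::
  "('v::zfc_universe \<Rightarrow> 'v \<Rightarrow> bool) \<Rightarrow> 'v pointed \<Rightarrow> 'v pointed \<Rightarrow> bool" where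
  "seed_rel S P Q \<longleftrightarrow>
     (\<exists>N i0 i1. elementary_embedding (fst P) N i0 \<and>
                internal_ultrapower_embedding (fst Q) N i1 \<and> S (i0 (snd P)) (i1 (snd Q)))"

lemma seed_less_eq: "seed_less = seed_rel (\<lambda>x y. x \<in> elts y)"
  by (intro ext) (simp add: seed_less_def seed_rel_def)

definition seed_le :: "'v::zfc_universe pointed \<Rightarrow> 'v pointed \<Rightarrow> bool" where
  "seed_le = seed_rel (\<lambda>x y. x = y \<or> x \<in> elts y)"

lemma seed_rel_iff:
  assumes D: "ccu D"
  shows "seed_rel S (M, a) (ultrapower D, cls D b) \<longleftrightarrow>
    (\<exists>z i. (\<forall>x. ccu (z x)) \<and> elementary_embedding M (ultrapower (usum D z)) i \<and>
      S (i a) (cls (usum D z) (\<lambda>p. b (pfst p))))" (is "?L = ?R")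
proof
  assume ?L
  then obtain N i0 i1 where N: "elementary_embedding M N i0"
    "internal_ultrapower_embedding (ultrapower D) N i1" "S (i0 a) (i1 (cls D b))"
    by (auto simp: seed_rel_def)
  then show ?R unfolding internal_iff[OF D] by metis
next
  assume ?R
  then obtain z i where z: "\<And>x. ccu (z x)" and i: "elementary_embedding M (ultrapower (usum D z)) i"
    "S (i a) (cls (usum D z) (\<lambda>p. b (pfst p)))" by blast
  have "internal_ultrapower_embedding (ultrapower D) (ultrapower (usum D z))
      (ult_emb (ultrapower D) (cls D z))"
    unfolding internal_iff[OF D] by (intro exI[of _ z] conjI allI z refl ult_emb_internal[OF D z])
  then show ?L unfolding seed_rel_def
    by (intro exI[of _ "ultrapower (usum D z)"] exI[of _ i] exI[of _ "ult_emb (ultrapower D) (cls D z)"])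
      (simp add: i ult_emb_internal[OF D z])
qed

text \<open>Associativity of sums up to rearranging triples: a composition of two internal
  ultrapower embeddings is again internal.\<close>

lemma
  fixes D :: "'v::zfc_universe"
  assumes D: "ccu D" and z: "\<And>x. ccu (z x)" and y: "\<And>x. ccu (y x)"
  shows cls_usum_assoc: "cls (usum (usum D z) y) F =
      cls (usum D (\<lambda>x. usum (z x) (\<lambda>v. y (opair x v))))
        (\<lambda>p. F (opair (opair (pfst p) (pfst (psnd p))) (psnd (psnd p))))"
    and ultrapower_usum_assoc: "ultrapower (usum (usum D z) y) =
      ultrapower (usum D (\<lambda>x. usum (z x) (\<lambda>v. y (opair x v))))"
proof -
  let ?w = "\<lambda>x. usum (z x) (\<lambda>v. y (opair x v))"
  note S = ccu_usum[OF D z]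
  have w: "ccu (?w x)" for x by (rule ccu_usum[OF z y])
  have l: "cls (usum (usum D z) y) F =
    cls D (\<lambda>x. cls (z x) (\<lambda>v. cls (y (opair x v)) (\<lambda>u. F (opair (opair x v) u))))" for F
    by (simp add: cls_usum[OF S y] cls_usum[OF D z])
  have r: "cls (usum D ?w) G =
    cls D (\<lambda>x. cls (z x) (\<lambda>v. cls (y (opair x v)) (\<lambda>u. G (opair x (opair v u)))))" for G
    by (simp add: cls_usum[OF D w] cls_usum[OF z y])
  show eq: "cls (usum (usum D z) y) F =
      cls (usum D ?w) (\<lambda>p. F (opair (opair (pfst p) (pfst (psnd p))) (psnd (psnd p))))" for F
    by (simp add: l r)
  have eq': "cls (usum D ?w) G =
      cls (usum (usum D z) y) (\<lambda>p. G (opair (pfst (pfst p)) (opair (psnd (pfst p)) (psnd p))))" for G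
    by (simp add: l r)
  show "ultrapower (usum (usum D z) y) = ultrapower (usum D ?w)"
    unfolding ultrapower_eq
    by (intro subset_antisym image_subsetI) (subst eq, rule rangeI, subst eq', rule rangeI)
qed

text \<open>The internal ultrapower of the middle model is copied along the embedding
  \<open>k0\<close> of that model. This leaves an elementary embedding on the left and a two-step
  internal ultrapower on the right; \<open>v\<close> is the image of the middle ordinal.\<close>

lemma seed_rel_trans:
  assumes D1: "ccu D1" and D2: "ccu D2"
    and PQ: "seed_rel S P (ultrapower D1, cls D1 b)"
    and QR: "seed_rel T (ultrapower D1, cls D1 b) (ultrapower D2, cls D2 c)"
    and S: "fo (\<lambda>M e. S (e 0) (e (Suc 0)))" and T: "fo (\<lambda>M e. T (e 0) (e (Suc 0)))"
    and a: "snd P \<in> fst P"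
  shows "seed_rel (\<lambda>x w. \<exists>v. S x v \<and> T v w) P (ultrapower D2, cls D2 c)"
proof -
  obtain M a where P: "P = (M, a)" by (cases P)
  obtain z i where z: "\<And>x. ccu (z x)" and i: "elementary_embedding M (ultrapower (usum D1 z)) i"
    and Si: "S (i a) (cls (usum D1 z) (\<lambda>p. b (pfst p)))"
    using PQ unfolding P seed_rel_iff[OF D1] by blast
  obtain y k0 where y: "\<And>x. ccu (y x)"
    and k0: "elementary_embedding (ultrapower D1) (ultrapower (usum D2 y)) k0"
    and Tk: "T (k0 (cls D1 b)) (cls (usum D2 y) (\<lambda>p. c (pfst p)))"
    using QR unfolding seed_rel_iff[OF D2] by blast
  note E1 = ccu_usum[OF D1 z] and E = ccu_usum[OF D2 y]
  obtain w k where w: "\<And>x. ccu (w x)"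
    and k: "elementary_embedding (ultrapower (usum D1 z)) (ultrapower (usum (usum D2 y) w)) k"
      "\<And>f g. k0 (cls D1 f) = cls (usum D2 y) g \<Longrightarrow>
        k (cls (usum D1 z) (\<lambda>p. f (pfst p))) = cls (usum (usum D2 y) w) (\<lambda>p. g (pfst p))"
    by (rule push_internal[OF D1 E z k0]) (rule that)
  note E' = ccu_usum[OF E w]
  have "k0 (cls D1 b) \<in> ultrapower (usum D2 y)" using k0 unfolding elementary_embedding_def by auto
  then obtain g where g: "k0 (cls D1 b) = cls (usum D2 y) g" by (rule ultrapowerE)
  have ia: "i a \<in> ultrapower (usum D1 z)" using i a unfolding P elementary_embedding_def by auto
  have "S (k (i a)) (cls (usum (usum D2 y) w) (\<lambda>p. g (pfst p)))"
    using elementary2[OF k(1) nice_ultrapower[OF E1] nice_ultrapower[OF E'], of "\<lambda>_. S", OF S ia] Si k(2)[OF g]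
    by simp
  moreover have "T (cls (usum (usum D2 y) w) (\<lambda>p. g (pfst p)))
      (cls (usum (usum D2 y) w) (\<lambda>p. c (pfst (pfst p))))"
    using Tk unfolding g los2[OF E, of "\<lambda>_. T", OF T] los2[OF E', of "\<lambda>_. T", OF T]
    by (simp add: ae_usum[OF E w] ae_const[OF w])
  moreover have "cls (usum (usum D2 y) w) (\<lambda>p. c (pfst (pfst p))) =
      cls (usum D2 (\<lambda>x. usum (y x) (\<lambda>v. w (opair x v)))) (\<lambda>p. c (pfst p))"
    by (simp add: cls_usum_assoc[OF D2 y w])
  moreover have "elementary_embedding M (ultrapower (usum D2 (\<lambda>x. usum (y x) (\<lambda>v. w (opair x v))))) (k \<circ> i)"
    using elementary_compose[OF i k(1)] unfolding ultrapower_usum_assoc[OF D2 y w] .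
  moreover have "ccu (usum (y x) (\<lambda>v. w (opair x v)))" for x by (rule ccu_usum[OF y w])
  ultimately show ?thesis unfolding P seed_rel_iff[OF D2]
    by (intro exI[of _ "\<lambda>x. usum (y x) (\<lambda>v. w (opair x v))"] exI[of _ "k \<circ> i"]) auto
qed

definition pup :: "'v::zfc_universe pointed \<Rightarrow> bool" where
  "pup P \<longleftrightarrow> (\<exists>D \<alpha>. ccu D \<and> ordinal \<alpha> \<and> P = (ultrapower D, \<alpha>))"

lemma pupE:
  assumes "pup P"
  obtains D a where "ccu D" "ordinal (cls D a)" "P = (ultrapower D, cls D a)"
  using assms ordinal_in_ultrapower unfolding pup_def by (metis ultrapowerE)

lemma pupI: "ccu D \<Longrightarrow> ordinal \<alpha> \<Longrightarrow> pup (ultrapower D, \<alpha>)"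
  unfolding pup_def by blast

lemma seed_rel_mono:
  assumes "seed_rel S P Q" "pup Q" and imp: "\<And>x w. ordinal w \<Longrightarrow> S x w \<Longrightarrow> T x w"
  shows "seed_rel T P Q"
proof -
  obtain D b where D: "ccu D" "ordinal (cls D b)" "Q = (ultrapower D, cls D b)"
    using assms(2) by (rule pupE)
  obtain M a where P: "P = (M, a)" by (cases P)
  obtain z i where z: "\<And>x. ccu (z x)" "elementary_embedding M (ultrapower (usum D z)) i"
      "S (i a) (cls (usum D z) (\<lambda>p. b (pfst p)))"
    using assms(1) unfolding D(3) P seed_rel_iff[OF D(1)] by blast
  have "ordinal (cls (usum D z) (\<lambda>p. b (pfst p)))"
    using D(2) by (simp add: ordinal_cls[OF D(1)] ordinal_cls[OF ccu_usum[OF D(1) z(1)]]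
        ae_usum[OF D(1) z(1)] ae_const[OF z(1)])
  then show ?thesis unfolding D(3) P seed_rel_iff[OF D(1)] using z imp by blast
qed

lemma pup_trans:
  assumes "seed_rel S P Q" "seed_rel T Q R" "pup P" "pup Q" "pup R"
    and "fo (\<lambda>M e. S (e 0) (e (Suc 0)))" "fo (\<lambda>M e. T (e 0) (e (Suc 0)))"
    and "\<And>x v w. ordinal w \<Longrightarrow> S x v \<Longrightarrow> T v w \<Longrightarrow> K x w"
  shows "seed_rel K P R"
proof -
  obtain D1 b where D1: "ccu D1" "Q = (ultrapower D1, cls D1 b)" using assms(4) by (rule pupE)
  obtain D2 c where D2: "ccu D2" "R = (ultrapower D2, cls D2 c)" using assms(5) by (rule pupE)
  have "snd P \<in> fst P" using assms(3) by (rule pupE) simp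
  then have "seed_rel (\<lambda>x w. \<exists>v. S x v \<and> T v w) P R"
    using seed_rel_trans[OF D1(1) D2(1) _ _ assms(6,7)] assms(1,2) unfolding D1 D2 by blast
  then show ?thesis by (rule seed_rel_mono[OF _ assms(5)]) (use assms(8) in blast)
qed

lemma fo_le: "fo (\<lambda>M e. e i = e j \<or> e i \<in> elts (e j))"
  by (intro fo_intros)

lemma seed_less_le_trans: "seed_less P Q \<Longrightarrow> seed_le Q R \<Longrightarrow> pup P \<Longrightarrow> pup Q \<Longrightarrow> pup R \<Longrightarrow> seed_less P R"
  unfolding seed_less_eq seed_le_def
  by (erule pup_trans, assumption, assumption, assumption, assumption) (auto intro: fo_mem fo_le ordinal_transitive)

lemma seed_le_less_trans: "seed_le P Q \<Longrightarrow> seed_less Q R \<Longrightarrow> pup P \<Longrightarrow> pup Q \<Longrightarrow> pup R \<Longrightarrow> seed_less P R"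
  unfolding seed_less_eq seed_le_def
  by (erule pup_trans, assumption, assumption, assumption, assumption) (auto intro: fo_mem fo_le ordinal_transitive)

lemma no_seed_less_chain:
  assumes chain: "\<And>n. seed_less (P (Suc n)) (P n)" and P: "\<And>n::nat. pup (P n)"
  shows False
proof -
  have "\<exists>D a. ccu D \<and> P n = (ultrapower D, cls D a)" for n using P[of n] by (metis pupE)
  then obtain D a where D: "\<And>n. ccu (D n)" "\<And>n. P n = (ultrapower (D n), cls (D n) (a n))" by metis
  have "\<exists>z i. (\<forall>x. ccu (z x)) \<and>
      elementary_embedding (ultrapower (D (Suc n))) (ultrapower (usum (D n) z)) i \<and>
      i (cls (D (Suc n)) (a (Suc n))) \<in> elts (cls (usum (D n) z) (\<lambda>p. a n (pfst p)))" for n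
    using chain[of n] unfolding seed_less_eq D seed_rel_iff[OF D(1)] .
  then obtain z i where z: "\<And>n x. ccu (z n x)"
    and i: "\<And>n. elementary_embedding (ultrapower (D (Suc n))) (ultrapower (usum (D n) (z n))) (i n)"
    and ia: "\<And>n. i n (cls (D (Suc n)) (a (Suc n))) \<in> elts (cls (usum (D n) (z n)) (\<lambda>p. a n (pfst p)))"
    by metis
  \<comment> \<open>A state at \<open>n\<close> is an ultrafilter for the \<open>n\<close>-th model
    of the iteration, together with an embedding of the model of \<open>P n\<close> into it. A step
    copies along this embedding the internal ultrapower that witnesses
    \<open>seed_less (P (Suc n)) (P n)\<close>, and records that the image of the ordinal has
    dropped.\<close>
  define good where "good n s \<longleftrightarrow> ccu (fst s) \<and> elementary_embedding (ultrapower (D n)) (ultrapower (fst s)) (snd s)"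
    for n and s :: "'a \<times> ('a \<Rightarrow> 'a)"
  define step where "step n s s' \<longleftrightarrow> (\<exists>y. (\<forall>x. ccu (y x)) \<and> fst s' = usum (fst s) y \<and>
      (\<forall>b. snd s (cls (D n) (a n)) = cls (fst s) b \<longrightarrow>
        snd s' (cls (D (Suc n)) (a (Suc n))) \<in> elts (cls (fst s') (\<lambda>p. b (pfst p)))))"
    for n and s s' :: "'a \<times> ('a \<Rightarrow> 'a)"
  have "good 0 (D 0, \<lambda>x. x)" unfolding good_def using D(1) elementary_id by simp
  moreover have "\<exists>s'. good (Suc n) s' \<and> step n s s'" if s: "good n s" for n s
  proof -
    have E: "ccu (fst s)" and e: "elementary_embedding (ultrapower (D n)) (ultrapower (fst s)) (snd s)"
      using s by (simp_all add: good_def)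
    obtain y k where y: "\<And>x. ccu (y x)"
      and k: "elementary_embedding (ultrapower (usum (D n) (z n))) (ultrapower (usum (fst s) y)) k"
        "\<And>f g. snd s (cls (D n) f) = cls (fst s) g \<Longrightarrow>
          k (cls (usum (D n) (z n)) (\<lambda>p. f (pfst p))) = cls (usum (fst s) y) (\<lambda>p. g (pfst p))"
      by (rule push_internal[OF D(1) E z e]) (rule that)
    let ?s = "(usum (fst s) y, k \<circ> i n)"
    have cc: "ccu (usum (fst s) y)" by (rule ccu_usum[OF E y])
    have "good (Suc n) ?s" unfolding good_def using cc elementary_compose[OF i k(1)] by simp
    moreover have "step n s ?s"
      unfolding step_def
    proof (intro exI[of _ y] conjI allI impI)
      fix b assume b: "snd s (cls (D n) (a n)) = cls (fst s) b"
      have "i n (cls (D (Suc n)) (a (Suc n))) \<in> ultrapower (usum (D n) (z n))"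
        using i[of n] unfolding elementary_embedding_def by auto
      then have "k (i n (cls (D (Suc n)) (a (Suc n)))) \<in> elts (k (cls (usum (D n) (z n)) (\<lambda>p. a n (pfst p))))"
        using elementary2[OF k(1) nice_ultrapower[OF ccu_usum[OF D(1) z]] nice_ultrapower[OF cc],
          of "\<lambda>_ x y. x \<in> elts y", OF fo_mem] ia[of n] by simp
      then show "snd ?s (cls (D (Suc n)) (a (Suc n))) \<in> elts (cls (fst ?s) (\<lambda>p. b (pfst p)))"
        unfolding k(2)[OF b] by simp
    qed (simp_all add: y)
    ultimately show ?thesis by blast
  qed
  ultimately obtain s where good: "\<And>n. good n (s n)" and step: "\<And>n. step n (s n) (s (Suc n))"
    using dependent_nat_choice[of good step] by metis
  define E where "E n = fst (s n)" for n
  have E: "ccu (E n)" for n using good[of n] by (simp add: good_def E_def)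
  have "\<exists>b. snd (s n) (cls (D n) (a n)) = cls (E n) b" for n
  proof -
    have "snd (s n) (cls (D n) (a n)) \<in> ultrapower (E n)"
      using good[of n] unfolding good_def elementary_embedding_def E_def by auto
    then show ?thesis by (rule ultrapowerE) blast
  qed
  then obtain b where b: "\<And>n. snd (s n) (cls (D n) (a n)) = cls (E n) (b n)" by metis
  have "\<exists>y. (\<forall>x. ccu (y x)) \<and> E (Suc n) = usum (E n) y \<and>
      cls (E (Suc n)) (b (Suc n)) \<in> elts (cls (E (Suc n)) (\<lambda>p. b n (pfst p)))" for n
    using step[of n] b[of n] b[of "Suc n"] unfolding step_def E_def by metis
  then obtain y where y: "\<And>n x. ccu (y n x)" "\<And>n. E (Suc n) = usum (E n) (y n)"
    "\<And>n. cls (E (Suc n)) (b (Suc n)) \<in> elts (cls (E (Suc n)) (\<lambda>p. b n (pfst p)))" by metis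
  show False
    by (rule no_descending_iteration[OF E[of 0] y(1,2), of b]) (use y(3) in \<open>simp add: cls_mem_iff[OF E]\<close>)
qed

lemma seed_less_irrefl: "pup P \<Longrightarrow> \<not> seed_less P P"
  using no_seed_less_chain[of "\<lambda>_. P"] by blast

lemma not_seed_less_le: "seed_less P Q \<Longrightarrow> seed_le Q P \<Longrightarrow> pup P \<Longrightarrow> pup Q \<Longrightarrow> False"
  using seed_less_le_trans seed_less_irrefl by blast

section \<open>Ranks under the Ultrapower Axiom\<close>

lemma ua_compare:
  fixes U W :: "'v::zfc_universe"
  assumes UA: "ultrapower_axiom TYPE('v)" and U: "ccu U" and W: "ccu W"
  obtains z y where "\<And>x. ccu (z x)" "\<And>x. ccu (y x)"
    "ultrapower (usum U z) = ultrapower (usum W y)"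
    "\<And>x. cls (usum U z) (\<lambda>_. x) = cls (usum W y) (\<lambda>_. x)"
proof -
  obtain N i0 i1 where i: "internal_ultrapower_embedding (ultrapower U) N i0"
    "internal_ultrapower_embedding (ultrapower W) N i1" "i0 \<circ> j_ult U = i1 \<circ> j_ult W"
    using UA U W unfolding ultrapower_axiom_def by blast
  obtain z where z: "\<And>x. ccu (z x)" "N = ultrapower (usum U z)"
    "\<And>f. i0 (cls U f) = cls (usum U z) (\<lambda>p. f (pfst p))"
    using i(1) unfolding internal_iff[OF U] by blast
  obtain y where y: "\<And>x. ccu (y x)" "N = ultrapower (usum W y)"
    "\<And>f. i1 (cls W f) = cls (usum W y) (\<lambda>p. f (pfst p))"
    using i(2) unfolding internal_iff[OF W] by blast
  have "cls (usum U z) (\<lambda>_. x) = cls (usum W y) (\<lambda>_. x)" for x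
    using fun_cong[OF i(3), of x] by (simp add: j_ult_eq z(3) y(3))
  then show ?thesis using that z(1,2) y(1,2) by blast
qed

text \<open>In a comparison of the two models let \<gamma> be the image of \<open>cls W b\<close>. A
  predecessor \<alpha> is at most its own image, which lies below \<gamma>. So besides totality
  there is one bound for all \<alpha>, which later makes the union defining the rank a set.\<close>

lemma seed_total_bound:
  fixes U W :: "'v::zfc_universe"
  assumes UA: "ultrapower_axiom TYPE('v)" and U: "ccu U" and W: "ccu W" and b: "ordinal (cls W b)"
  obtains \<gamma> where "\<And>\<alpha>. ordinal \<alpha> \<Longrightarrow> seed_le (ultrapower W, cls W b) (ultrapower U, \<alpha>) \<or>
    (seed_less (ultrapower U, \<alpha>) (ultrapower W, cls W b) \<and> \<alpha> \<in> elts \<gamma>)"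
proof -
  obtain z y where z: "\<And>x. ccu (z x)" and y: "\<And>x. ccu (y x)"
    and N: "ultrapower (usum U z) = ultrapower (usum W y)"
    by (rule ua_compare[OF UA U W]) (rule that)
  define i where "i = ult_emb (ultrapower U) (cls U z)"
  define k where "k = ult_emb (ultrapower W) (cls W y)"
  have i: "i (cls U f) = cls (usum U z) (\<lambda>p. f (pfst p))" for f
    unfolding i_def by (rule ult_emb_internal[OF U z])
  have k: "k (cls W f) = cls (usum W y) (\<lambda>p. f (pfst p))" for f
    unfolding k_def by (rule ult_emb_internal[OF W y])
  have ie: "elementary_embedding (ultrapower U) (ultrapower (usum U z)) i"
    by (rule internal_elementary[OF U z i])
  have ke: "elementary_embedding (ultrapower W) (ultrapower (usum W y)) k"
    by (rule internal_elementary[OF W y k])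
  define \<gamma> where "\<gamma> = k (cls W b)"
  have ord\<gamma>: "ordinal \<gamma>" unfolding \<gamma>_def
    by (rule elementary_ordinal(1)[OF ke nice_ultrapower[OF W] nice_ultrapower[OF ccu_usum[OF W y]] b]) simp
  show ?thesis
  proof (rule that[of \<gamma>])
    fix \<alpha> :: 'v assume \<alpha>: "ordinal \<alpha>"
    have \<alpha>U: "\<alpha> \<in> ultrapower U" by (rule ordinal_in_ultrapower[OF U \<alpha>])
    then obtain a where a: "\<alpha> = cls U a" by (rule ultrapowerE)
    note io = elementary_ordinal[OF ie nice_ultrapower[OF U] nice_ultrapower[OF ccu_usum[OF U z]] \<alpha> \<alpha>U]
    consider "i \<alpha> \<in> elts \<gamma>" | "\<gamma> = i \<alpha> \<or> \<gamma> \<in> elts (i \<alpha>)" using ordinal_linear[OF io(1) ord\<gamma>] by blast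
    then show "seed_le (ultrapower W, cls W b) (ultrapower U, \<alpha>) \<or>
      (seed_less (ultrapower U, \<alpha>) (ultrapower W, cls W b) \<and> \<alpha> \<in> elts \<gamma>)"
    proof cases
      case 1
      have "seed_less (ultrapower U, \<alpha>) (ultrapower W, cls W b)"
        unfolding seed_less_eq seed_rel_iff[OF W] using y ie 1 unfolding N \<gamma>_def k by blast
      moreover have "\<alpha> \<in> elts \<gamma>"
        using ordinal_subset_iff[OF \<alpha> io(1)] io(2) 1 ordinal_transitive[OF ord\<gamma>] by metis
      ultimately show ?thesis by blast
    next
      case 2
      have "seed_le (ultrapower W, cls W b) (ultrapower U, cls U a)"
        unfolding seed_le_def seed_rel_iff[OF U] using z ke 2 unfolding N[symmetric] \<gamma>_def a i by blast
      then show ?thesis unfolding a by blast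
    qed
  qed
qed

lemma seed_total:
  fixes P Q :: "'v::zfc_universe pointed"
  assumes UA: "ultrapower_axiom TYPE('v)" and P: "pup P" and Q: "pup Q"
  shows "seed_less P Q \<or> seed_le Q P"
proof -
  obtain U a where U: "ccu U" "ordinal (cls U a)" "P = (ultrapower U, cls U a)" using P by (rule pupE)
  obtain W b where W: "ccu W" "ordinal (cls W b)" "Q = (ultrapower W, cls W b)" using Q by (rule pupE)
  obtain \<gamma> where "\<And>\<alpha>. ordinal \<alpha> \<Longrightarrow> seed_le (ultrapower W, cls W b) (ultrapower U, \<alpha>) \<or>
    (seed_less (ultrapower U, \<alpha>) (ultrapower W, cls W b) \<and> \<alpha> \<in> elts \<gamma>)"
    using UA U(1) W(1,2) by (rule seed_total_bound) blast
  then show ?thesis using U(2) unfolding U(3) W(3) by blast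
qed

section \<open>The bounded pointed ultrapowers and their rank\<close>

lemma Un_le_ccu: "U \<in> Un_le \<delta> \<Longrightarrow> ccu U"
  by (simp add: Un_le_def)

lemma pointed_le_pup: "P \<in> pointed_le \<delta> \<Longrightarrow> pup P"
  unfolding pointed_le_def using Un_le_ccu pupI by blast

lemma small_Un_le: "small (Un_le \<delta>)"
proof (rule small_subset[OF small_Pow])
  show "Un_le \<delta> \<subseteq> {Z. elts Z \<subseteq> elts (set_of {A. elts A \<subseteq> elts \<delta>})}"
    by (auto simp: Un_le_def elts_uspace)
qed

definition seed_pred :: "'v::zfc_universe \<Rightarrow> ('v pointed \<times> 'v pointed) set" where
  "seed_pred \<delta> = {(P, Q). P \<in> pointed_le \<delta> \<and> seed_less P Q}"

lemma wf_seed_pred: "wf (seed_pred \<delta>)"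
  unfolding wf_iff_no_infinite_down_chain
proof
  assume "\<exists>f. \<forall>i. (f (Suc i), f i) \<in> seed_pred \<delta>"
  then obtain f where f: "\<And>i. f (Suc i) \<in> pointed_le \<delta>" "\<And>i. seed_less (f (Suc i)) (f i)"
    by (auto simp: seed_pred_def)
  \<comment> \<open>The chain starts at \<open>f 1\<close>, because \<open>f 0\<close> is not known
    to be a pointed ultrapower.\<close>
  show False
    by (rule no_seed_less_chain[of "\<lambda>n. f (Suc n)"]) (use f pointed_le_pup in blast)+
qed

lemma pointed_rank_rec:
  "pointed_rank \<delta> Q = set_of (\<Union>P\<in>{P. (P, Q) \<in> seed_pred \<delta>}. elts (succ (pointed_rank \<delta> P)))"
proof -
  have r: "pointed_rank \<delta> = wfrec (seed_pred \<delta>)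
      (\<lambda>r Q. set_of (\<Union>P\<in>{P. (P, Q) \<in> seed_pred \<delta>}. elts (succ (r P))))"
    by (simp add: pointed_rank_def seed_pred_def Let_def)
  show ?thesis
    by (subst r, subst wfrec[OF wf_seed_pred], unfold r[symmetric])
      (auto simp: cut_def intro!: arg_cong[of _ _ set_of])
qed

context
  fixes \<delta> :: "'v::zfc_universe"
  assumes UA: "ultrapower_axiom TYPE('v)"
begin

text \<open>The union in the recursion has to be shown to be a set. There are set-many
  \<open>U\<close>, and for each of them \<open>seed_total_bound\<close> bounds the ordinals that
  occur in predecessors.\<close>

lemma elts_pointed_rank:
  assumes Q: "pup Q"
  shows "elts (pointed_rank \<delta> Q) =
    (\<Union>P\<in>{P. P \<in> pointed_le \<delta> \<and> seed_less P Q}. insert (pointed_rank \<delta> P) (elts (pointed_rank \<delta> P)))"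
proof -
  obtain W b where W: "ccu W" "ordinal (cls W b)" "Q = (ultrapower W, cls W b)" using Q by (rule pupE)
  have "\<exists>\<gamma>. \<forall>\<alpha>. ordinal \<alpha> \<longrightarrow> seed_less (ultrapower U, \<alpha>) Q \<longrightarrow> \<alpha> \<in> elts \<gamma>" if U: "ccu U" for U
  proof -
    obtain \<gamma> where "\<And>\<alpha>. ordinal \<alpha> \<Longrightarrow> seed_le (ultrapower W, cls W b) (ultrapower U, \<alpha>) \<or>
      (seed_less (ultrapower U, \<alpha>) (ultrapower W, cls W b) \<and> \<alpha> \<in> elts \<gamma>)"
      by (rule seed_total_bound[OF UA U W(1,2)]) (rule that)
    then show ?thesis using not_seed_less_le pupI[OF U] Q unfolding W(3) by blast
  qed
  then obtain \<gamma> where \<gamma>: "\<And>U \<alpha>. ccu U \<Longrightarrow> ordinal \<alpha> \<Longrightarrow> seed_less (ultrapower U, \<alpha>) Q \<Longrightarrow> \<alpha> \<in> elts (\<gamma> U)"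
    by metis
  let ?r = "pointed_rank \<delta>"
  have "small (\<Union>U\<in>Un_le \<delta>. \<Union>\<alpha>\<in>elts (\<gamma> U). elts (succ (?r (ultrapower U, \<alpha>))))"
    by (intro small_UN small_Un_le small_elts)
  moreover have "(\<Union>P\<in>{P. (P, Q) \<in> seed_pred \<delta>}. elts (succ (?r P))) \<subseteq>
      (\<Union>U\<in>Un_le \<delta>. \<Union>\<alpha>\<in>elts (\<gamma> U). elts (succ (?r (ultrapower U, \<alpha>))))"
  proof (rule UN_least)
    fix P assume "P \<in> {P. (P, Q) \<in> seed_pred \<delta>}"
    then obtain U \<alpha> where "U \<in> Un_le \<delta>" "ordinal \<alpha>" "P = (ultrapower U, \<alpha>)" "seed_less P Q"
      by (auto simp: seed_pred_def pointed_le_def)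
    moreover from this have "\<alpha> \<in> elts (\<gamma> U)" using \<gamma> Un_le_ccu by blast
    ultimately show "elts (succ (?r P)) \<subseteq>
      (\<Union>U\<in>Un_le \<delta>. \<Union>\<alpha>\<in>elts (\<gamma> U). elts (succ (?r (ultrapower U, \<alpha>))))" by blast
  qed
  ultimately have "small (\<Union>P\<in>{P. (P, Q) \<in> seed_pred \<delta>}. elts (succ (?r P)))" by (rule small_subset)
  then show ?thesis by (subst pointed_rank_rec) (simp add: seed_pred_def)
qed

lemma ordinal_pointed_rank: "pup Q \<Longrightarrow> ordinal (pointed_rank \<delta> Q)"
proof (induction Q rule: wf_induct_rule[OF wf_seed_pred[of \<delta>]])
  case (1 Q)
  have IH: "ordinal (pointed_rank \<delta> P)" if "P \<in> pointed_le \<delta>" "seed_less P Q" for P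
    using 1(1)[of P] that pointed_le_pup[OF that(1)] by (simp add: seed_pred_def)
  show ?case
  proof (rule ordinalI)
    fix y assume "y \<in> elts (pointed_rank \<delta> Q)"
    then obtain P where P: "P \<in> pointed_le \<delta>" "seed_less P Q"
      "y = pointed_rank \<delta> P \<or> y \<in> elts (pointed_rank \<delta> P)" by (auto simp: elts_pointed_rank[OF 1(2)])
    then show "ordinal y" using IH ordinal_mem by blast
    fix z assume "z \<in> elts y"
    then have "z \<in> elts (pointed_rank \<delta> P)" using P IH ordinal_transitive by blast
    then show "z \<in> elts (pointed_rank \<delta> Q)" using P(1,2) unfolding elts_pointed_rank[OF 1(2)] by blast
  qed
qed

lemma pointed_rank_less:
  "P \<in> pointed_le \<delta> \<Longrightarrow> seed_less P Q \<Longrightarrow> pup Q \<Longrightarrow> pointed_rank \<delta> P \<in> elts (pointed_rank \<delta> Q)"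
  unfolding elts_pointed_rank by blast

lemma pointed_rank_le:
  assumes "seed_le P Q" and P: "pup P" and Q: "pup Q"
  shows "pointed_rank \<delta> P = pointed_rank \<delta> Q \<or> pointed_rank \<delta> P \<in> elts (pointed_rank \<delta> Q)"
proof -
  have "elts (pointed_rank \<delta> P) \<subseteq> elts (pointed_rank \<delta> Q)"
    unfolding elts_pointed_rank[OF P] elts_pointed_rank[OF Q]
    using seed_less_le_trans[OF _ assms(1) pointed_le_pup P Q] by blast
  then show ?thesis using ordinal_subset_iff ordinal_pointed_rank P Q by blast
qed

lemma pointed_rank_eq:
  "seed_le P Q \<Longrightarrow> seed_le Q P \<Longrightarrow> pup P \<Longrightarrow> pup Q \<Longrightarrow> pointed_rank \<delta> P = pointed_rank \<delta> Q"
  using pointed_rank_le[of P Q] pointed_rank_le[of Q P]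
    not_mem_sym[of "pointed_rank \<delta> P" "pointed_rank \<delta> Q"] by (auto simp: not_mem_self)

end

section \<open>Ultraproducts of pointed ultrapowers\<close>

text \<open>The witnesses of \<open>seed_rel\<close> for almost every \<open>x\<close> are glued, as
  the theorem of Los does not reach class embeddings: the maps \<open>i x\<close> become an
  elementary map between ultraproducts, and the families \<open>z x\<close> an internal ultrapower
  of the ultraproduct on the right.\<close>

lemma seed_rel_ultraproduct:
  fixes U :: "'v::zfc_universe"
  assumes U: "ccu U" and W: "\<And>x. ccu (W x)" and W': "\<And>x. ccu (W' x)"
    and S: "fo (\<lambda>M e. S (e 0) (e (Suc 0)))"
    and \<alpha>: "\<And>x. \<alpha> x \<in> ultrapower (W x)" and \<beta>: "\<And>x. \<beta> x \<in> ultrapower (W' x)"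
    and rel: "ae U (\<lambda>x. seed_rel S (ultrapower (W x), \<alpha> x) (ultrapower (W' x), \<beta> x))"
  shows "seed_rel S (ultrapower (usum U W), cls U \<alpha>) (ultrapower (usum U W'), cls U \<beta>)"
proof -
  have "\<exists>b. \<beta> x = cls (W' x) b" for x using \<beta>[of x] by (auto simp: ultrapower_eq)
  then obtain b where b: "\<And>x. \<beta> x = cls (W' x) (b x)" by metis
  define good where "good x z i \<longleftrightarrow> (\<forall>v. ccu (z v)) \<and>
      elementary_embedding (ultrapower (W x)) (ultrapower (usum (W' x) z)) i \<and>
      S (i (\<alpha> x)) (cls (usum (W' x) z) (\<lambda>p. b x (pfst p)))" for x z i
  have "ae U (\<lambda>x. \<exists>z i. good x z i)"
    using rel unfolding b seed_rel_iff[OF W'] good_def .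
  then obtain z0 i where "ae U (\<lambda>x. good x (z0 x) (i x))"
    unfolding ae_ex_choice[OF U] by blast
  \<comment> \<open>Outside a set of measure one the chosen family may fail to consist of
    ultrafilters, and \<open>trivial_uf\<close> replaces it there.\<close>
  define z where "z x = (if \<forall>v. ccu (z0 x v) then z0 x else (\<lambda>_. trivial_uf))" for x
  have z: "ccu (z x v)" for x v by (simp add: z_def ccu_trivial_uf)
  have gd: "ae U (\<lambda>x. good x (z x) (i x))"
    by (rule ae_mono[OF U \<open>ae U (\<lambda>x. good x (z0 x) (i x))\<close>]) (simp add: z_def good_def)
  define E where "E x = usum (W' x) (z x)" for x
  have E: "ccu (E x)" for x unfolding E_def by (rule ccu_usum[OF W' z])
  define Z where "Z p = z (pfst p) (psnd p)" for p
  have Z: "ccu (Z p)" for p by (simp add: Z_def z)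
  have E': "E = (\<lambda>x. usum (W' x) (\<lambda>v. Z (opair x v)))" by (intro ext) (simp add: E_def Z_def)
  note SW = ccu_usum[OF U W] and SW' = ccu_usum[OF U W'] and SE = ccu_usum[OF U E]
  define I where "I w = cls U (\<lambda>x. i x ((SOME h. w = cls U h) x))" for w
  have I: "I (cls U h) = cls U (\<lambda>x. i x (h x))" for h
  proof -
    define h' where "h' = (SOME h'. cls U h = cls U h')"
    have "cls U h = cls U h'" unfolding h'_def by (rule someI[of "\<lambda>h'. cls U h = cls U h'"]) (rule refl)
    then have "ae U (\<lambda>x. h x = h' x)" by (simp add: cls_eq_iff[OF U])
    then have "ae U (\<lambda>x. i x (h' x) = i x (h x))" by (rule ae_mono[OF U]) simp
    then show ?thesis unfolding I_def h'_def[symmetric] by (rule cls_cong[OF U])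
  qed
  define g where "g F x = (SOME g. i x (cls (W x) (\<lambda>v. F (opair x v))) = cls (E x) g)" for F x
  have g: "i x (cls (W x) (\<lambda>v. F (opair x v))) = cls (E x) (g F x)" if "good x (z x) (i x)" for F x
  proof -
    have "i x (cls (W x) (\<lambda>v. F (opair x v))) \<in> ultrapower (E x)"
      using that cls_in[of "W x"] unfolding good_def elementary_embedding_def E_def by blast
    then have "\<exists>g. i x (cls (W x) (\<lambda>v. F (opair x v))) = cls (E x) g" by (auto simp: ultrapower_eq)
    then show ?thesis unfolding g_def
      by (rule someI_ex[of "\<lambda>g. i x (cls (W x) (\<lambda>v. F (opair x v))) = cls (E x) g"])
  qed
  define G where "G F p = g F (pfst p) (psnd p)" for F p
  have elem: "elementary_embedding (ultrapower (usum U W)) (ultrapower (usum U E)) I"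
  proof (rule elementary_mapI[OF SW SE, where i = I and g = G])
    fix F
    have "I (cls (usum U W) F) = cls U (\<lambda>x. i x (cls (W x) (\<lambda>v. F (opair x v))))"
      by (simp add: cls_usum[OF U W] I)
    also have "\<dots> = cls U (\<lambda>x. cls (E x) (g F x))"
      by (rule cls_cong[OF U], rule ae_mono[OF U gd]) (rule g)
    finally show "I (cls (usum U W) F) = cls (usum U E) (G F)"
      unfolding G_def[abs_def] cls_usum2[OF U E] .
  next
    fix F :: "nat \<Rightarrow> 'v \<Rightarrow> 'v" and P :: "'v set \<Rightarrow> (nat \<Rightarrow> 'v) \<Rightarrow> bool"
    assume P: "fo P"
    have "ae (W x) (\<lambda>v. P UNIV (\<lambda>n. F n (opair x v))) \<longleftrightarrow> ae (E x) (\<lambda>q. P UNIV (\<lambda>n. g (F n) x q))"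
      if gx: "good x (z x) (i x)" for x
    proof -
      have ix: "elementary_embedding (ultrapower (W x)) (ultrapower (E x)) (i x)"
        using gx unfolding good_def E_def by blast
      have "ae (W x) (\<lambda>v. P UNIV (\<lambda>n. F n (opair x v))) \<longleftrightarrow>
          P (ultrapower (W x)) (\<lambda>n. cls (W x) (\<lambda>v. F n (opair x v)))"
        using los[OF W P, of x "\<lambda>n v. F n (opair x v)"] ..
      also have "\<dots> \<longleftrightarrow> P (ultrapower (E x)) (\<lambda>n. i x (cls (W x) (\<lambda>v. F n (opair x v))))"
        by (rule elementary_transfer[OF ix nice_ultrapower[OF W] nice_ultrapower[OF E] P]) auto
      also have "\<dots> \<longleftrightarrow> ae (E x) (\<lambda>q. P UNIV (\<lambda>n. g (F n) x q))"
        unfolding g[OF gx] by (rule los[OF E P])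
      finally show ?thesis .
    qed
    then have "ae U (\<lambda>x. ae (W x) (\<lambda>v. P UNIV (\<lambda>n. F n (opair x v))) \<longleftrightarrow>
        ae (E x) (\<lambda>q. P UNIV (\<lambda>n. g (F n) x q)))"
      by (rule ae_mono[OF U gd])
    then show "ae (usum U W) (\<lambda>p. P UNIV (\<lambda>n. F n p)) \<longleftrightarrow> ae (usum U E) (\<lambda>p. P UNIV (\<lambda>n. G (F n) p))"
      unfolding ae_usum[OF U W] ae_usum[OF U E] G_def pfst_opair psnd_opair by (rule ae_iff[OF U])
  qed
  have \<beta>eq: "cls U \<beta> = cls (usum U W') (\<lambda>p. b (pfst p) (psnd p))"
    unfolding cls_usum[OF U W'] pfst_opair psnd_opair b[symmetric] ..
  have "ae U (\<lambda>x. S (i x (\<alpha> x)) (cls (E x) (\<lambda>q. b x (pfst q))))"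
    by (rule ae_mono[OF U gd]) (simp add: good_def E_def)
  then have "S (cls U (\<lambda>x. i x (\<alpha> x))) (cls U (\<lambda>x. cls (E x) (\<lambda>q. b x (pfst q))))"
    by (simp add: los2[OF U, of "\<lambda>_. S", OF S])
  moreover have "cls U (\<lambda>x. cls (E x) (\<lambda>q. b x (pfst q))) =
      cls (usum (usum U W') Z) (\<lambda>p. b (pfst (pfst p)) (psnd (pfst p)))"
    unfolding cls_usum_assoc[OF U W' Z] E'[symmetric] by (simp add: cls_usum2[OF U E])
  ultimately have SI: "S (I (cls U \<alpha>)) (cls (usum (usum U W') Z) (\<lambda>p. b (pfst (pfst p)) (psnd (pfst p))))"
    by (simp add: I)
  have "elementary_embedding (ultrapower (usum U W)) (ultrapower (usum (usum U W') Z)) I"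
    using elem unfolding ultrapower_usum_assoc[OF U W' Z] E'[symmetric] .
  then show ?thesis unfolding \<beta>eq seed_rel_iff[OF SW']
    using Z SI by (intro exI[of _ Z] exI[of _ I]) simp
qed

section \<open>Recoding ultrafilters as uniform ultrafilters on ordinals up to \<delta>\<close>

lemma uniform_uf:
  fixes \<delta> :: "'v::zfc_universe"
  assumes F: "ccq F" "F (\<lambda>x. x \<in> elts \<delta>)" and \<delta>: "ordinal \<delta>"
  obtains B where "B \<in> Un_le \<delta>" "\<And>P. ae B P = F P"
proof -
  \<comment> \<open>The least \<kappa> of measure one is taken: by minimality no smaller initial
    segment has measure one, which is uniformity on \<kappa>.\<close>
  define L where "L = {\<kappa>. ordinal \<kappa> \<and> F (\<lambda>x. x \<in> elts \<kappa>)}"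
  have "\<delta> \<in> L" using F \<delta> by (simp add: L_def)
  then obtain \<kappa> where \<kappa>: "\<kappa> \<in> L" "\<And>\<beta>. \<beta> \<in> elts \<kappa> \<Longrightarrow> \<beta> \<notin> L"
    using wf_mem unfolding wf_eq_minimal by (metis (mono_tags, lifting) case_prodI mem_Collect_eq)
  have o: "ordinal \<kappa>" "F (\<lambda>x. x \<in> elts \<kappa>)" using \<kappa>(1) by (auto simp: L_def)
  have sub: "elts \<kappa> \<subseteq> elts \<delta>"
    using ordinal_linear[OF o(1) \<delta>] \<kappa>(2) \<open>\<delta> \<in> L\<close> ordinal_transitive[OF \<delta>] by blast
  have un: "set_of (elts \<kappa> - elts \<beta>) \<in> elts (mk_uf \<kappa> F)" if \<beta>: "\<beta> \<in> elts \<kappa>" for \<beta>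
  proof -
    have "\<not> F (\<lambda>x. x \<in> elts \<beta>)" using \<kappa>(2)[OF \<beta>] ordinal_mem[OF o(1) \<beta>] by (simp add: L_def)
    then show ?thesis using o(2) by (simp add: ccq_conj[OF F(1)] ccq_not[OF F(1)])
  qed
  have "mk_uf \<kappa> F \<in> Un_le \<delta>"
    unfolding Un_le_def using ccu_mk_uf[OF F(1) o(2)] o(1) sub un
    by (simp add: uspace_mk_uf[OF F(1) o(2)])
  then show ?thesis using that ae_mk_uf[OF F(1) o(2)] by blast
qed

text \<open>A map with a left inverse almost everywhere identifies nothing modulo \<open>E\<close>,
  so \<open>B\<close> and \<open>E\<close> are Rudin-Keisler equivalent.\<close>

lemma
  fixes B E :: "'v::zfc_universe"
  assumes B: "ccu B" and E: "ccu E" and h: "\<And>P. ae B P \<longleftrightarrow> ae E (\<lambda>p. P (h p))"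
    and g: "ae E (\<lambda>p. g (h p) = p)"
  shows cls_pushforward_inj: "cls B f = cls E (\<lambda>p. f (h p))"
    and ultrapower_pushforward_inj: "ultrapower B = ultrapower E"
proof -
  have Eg: "cls E k = cls E (\<lambda>p. k (g (h p)))" for k
    by (rule cls_cong[OF E], rule ae_mono[OF E g]) simp
  show eq: "cls B f = cls E (\<lambda>p. f (h p))" for f
  proof (rule collapse_unique[of "cls B" "\<lambda>f. cls E (\<lambda>p. f (h p))"])
    fix f f'
    show "(cls B f \<in> elts (cls B f')) = (cls E (\<lambda>p. f (h p)) \<in> elts (cls E (\<lambda>p. f' (h p))))"
      by (simp add: cls_mem_iff[OF B] cls_mem_iff[OF E] h)
  next
    fix x f assume "x \<in> elts (cls B f)"
    then show "x \<in> range (cls B)" by (auto simp: elts_cls[OF B])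
  next
    fix x f assume "x \<in> elts (cls E (\<lambda>p. f (h p)))"
    then obtain k where "x = cls E k" by (auto simp: elts_cls[OF E])
    then have "x = cls E (\<lambda>p. (\<lambda>v. k (g v)) (h p))" using Eg[of k] by simp
    then show "x \<in> range (\<lambda>f. cls E (\<lambda>p. f (h p)))" by (rule range_eqI[where x = "\<lambda>v. k (g v)"])
  qed
  show "ultrapower B = ultrapower E" unfolding ultrapower_eq
  proof (intro subset_antisym image_subsetI)
    show "cls B f \<in> range (cls E)" for f unfolding eq by (rule rangeI)
    show "cls E k \<in> range (cls B)" for k using Eg[of k] eq[of "\<lambda>v. k (g v)"] by (metis rangeI)
  qed
qed

lemma ccq_finite: "finite A \<Longrightarrow> ccq F \<Longrightarrow> F (\<lambda>x. x \<in> A) \<Longrightarrow> \<exists>a\<in>A. F (\<lambda>x. x = a)"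
proof (induction A rule: finite_induct)
  case empty
  then show ?case using ccq_const[of F False] by simp
next
  case (insert a A)
  then show ?case using ccq_disj[of F "\<lambda>x. x = a" "\<lambda>x. x \<in> A"] by auto
qed

lemma ultrapower_of_pairs:
  fixes \<delta> :: "'v::zfc_universe"
  assumes \<delta>: "ordinal \<delta>" and E: "ccu E"
    and pairs: "ae E (\<lambda>p. \<exists>x\<in>elts \<delta>. \<exists>y\<in>elts \<delta>. p = opair x y)"
  obtains B where "B \<in> Un_le \<delta>" "ultrapower B = ultrapower E"
proof -
  have "\<exists>g h. ae E (\<lambda>p. h p \<in> elts \<delta>) \<and> ae E (\<lambda>p. g (h p) = p)"
  proof (cases "finite (elts \<delta>)")
    case True
    \<comment> \<open>A finite \<delta> need not admit an injection of its pairs into itself, but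
      here \<open>E\<close> concentrates on a single pair \<open>a\<close>, and any element of
      \<delta> can code it.\<close>
    define A where "A = (\<lambda>(x, y). opair x y) ` (elts \<delta> \<times> elts \<delta>)"
    have "ae E (\<lambda>p. p \<in> A)" by (rule ae_mono[OF E pairs]) (auto simp: A_def)
    then obtain a where a: "a \<in> A" "ae E (\<lambda>x. x = a)"
      using ccq_finite[of A "ae E"] ccq_ae[OF E] True by (auto simp: A_def)
    then obtain x where "x \<in> elts \<delta>" by (auto simp: A_def)
    then have "ae E (\<lambda>p. x \<in> elts \<delta>)" "ae E (\<lambda>p. a = p)"
      using a(2) by (auto simp: ae_const[OF E] eq_commute)
    then show ?thesis by (intro exI[of _ "\<lambda>_. a"] exI[of _ "\<lambda>_. x"]) simp
  next
    case False
    obtain \<phi> where \<phi>: "bij_betw \<phi> (elts \<delta> \<times> elts \<delta>) (elts \<delta>)"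
      using card_of_Times_same_infinite[OF False] card_of_ordIso by blast
    define h where "h p = \<phi> (pfst p, psnd p)" for p
    define g where "g v = (case inv_into (elts \<delta> \<times> elts \<delta>) \<phi> v of (x, y) \<Rightarrow> opair x y)" for v
    have "ae E (\<lambda>p. h p \<in> elts \<delta> \<and> g (h p) = p)"
    proof (rule ae_mono[OF E pairs])
      fix p assume "\<exists>x\<in>elts \<delta>. \<exists>y\<in>elts \<delta>. p = opair x y"
      then obtain x y where xy: "x \<in> elts \<delta>" "y \<in> elts \<delta>" "p = opair x y" by blast
      then have "inv_into (elts \<delta> \<times> elts \<delta>) \<phi> (\<phi> (x, y)) = (x, y)"
        using \<phi> by (auto simp: bij_betw_def)
      then show "h p \<in> elts \<delta> \<and> g (h p) = p"
        using \<phi> xy by (auto simp: h_def g_def bij_betw_def)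
    qed
    then show ?thesis unfolding ae_conj[OF E] by blast
  qed
  then obtain g h where h: "ae E (\<lambda>p. h p \<in> elts \<delta>)" and g: "ae E (\<lambda>p. g (h p) = p)" by blast
  obtain B where B: "B \<in> Un_le \<delta>" "\<And>P. ae B P = ae E (\<lambda>p. P (h p))"
    using uniform_uf[of "\<lambda>P. ae E (\<lambda>p. P (h p))" \<delta>] ccq_map[OF ccq_ae[OF E]] h \<delta> by metis
  have "ultrapower B = ultrapower E"
    by (rule ultrapower_pushforward_inj[OF Un_le_ccu[OF B(1)] E B(2) g])
  then show ?thesis using that B(1) by blast
qed

lemma ultraproduct_pointed_le:
  assumes \<delta>: "ordinal \<delta>" and U: "U \<in> Un_le \<delta>" and W: "\<And>x. W x \<in> Un_le \<delta>"
    and \<alpha>: "ordinal (cls U \<alpha>)"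
  shows "(ultrapower (usum U W), cls U \<alpha>) \<in> pointed_le \<delta>"
proof -
  note cU = Un_le_ccu[OF U] and cW = Un_le_ccu[OF W]
  have sU: "elts (uspace U) \<subseteq> elts \<delta>" and sW: "elts (uspace (W x)) \<subseteq> elts \<delta>" for x
    using U W[of x] by (simp_all add: Un_le_def)
  have "ae (usum U W) (\<lambda>p. \<exists>x\<in>elts \<delta>. \<exists>y\<in>elts \<delta>. p = opair x y)"
    unfolding ae_usum[OF cU cW]
    by (intro ae_all[OF cU] ae_all[OF cW]) (use sU sW in blast)
  then obtain B where "B \<in> Un_le \<delta>" "ultrapower B = ultrapower (usum U W)"
    using ultrapower_of_pairs[OF \<delta> ccu_usum[where D = U and z = W, OF cU cW]] by blast
  then show ?thesis unfolding pointed_le_def using \<alpha> by blast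
qed

text \<open>Where a seed comparison needs no further extension of the right-hand model, the
  ultrapower by \<open>trivial_uf\<close> provides the required internal embedding.\<close>

lemma internal_id:
  assumes E: "ccu E"
  shows "internal_ultrapower_embedding (ultrapower E) (ultrapower E) (\<lambda>x. x)"
proof -
  have triv: "cls trivial_uf f = f (set_of {})" for f :: "'a \<Rightarrow> 'a"
  proof (rule collapse_unique[of "cls trivial_uf" "\<lambda>f. f (set_of {})"])
    show "x \<in> range (\<lambda>f. f (set_of {}))" for x :: 'a by (rule range_eqI[of _ _ "\<lambda>_. x"]) simp
    show "x \<in> elts (cls trivial_uf f) \<Longrightarrow> x \<in> range (cls trivial_uf)" for x and f :: "'a \<Rightarrow> 'a"
      by (auto simp: elts_cls[OF ccu_trivial_uf])
  qed (simp add: cls_mem_iff[OF ccu_trivial_uf] ae_trivial_uf)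
  have eq: "cls (usum E (\<lambda>_. trivial_uf)) F = cls E (\<lambda>x. F (opair x (set_of {})))" for F
    by (simp add: cls_usum[OF E ccu_trivial_uf] triv)
  have eq': "cls E f = cls (usum E (\<lambda>_. trivial_uf)) (\<lambda>p. f (pfst p))" for f by (simp add: eq)
  have "ultrapower E = ultrapower (usum E (\<lambda>_. trivial_uf))"
    unfolding ultrapower_eq
    by (intro subset_antisym image_subsetI) (subst eq', rule rangeI, subst eq, rule rangeI)
  then show ?thesis unfolding internal_iff[OF E]
    by (intro exI[of _ "\<lambda>_. trivial_uf"] conjI allI ccu_trivial_uf eq')
qed

text \<open>The factor map of the Rudin-Keisler order, for \<open>B\<close> the image of
  \<open>E\<close> under \<open>h\<close>.\<close>

lemma pushforward_elementary:
  assumes B: "ccu B" and E: "ccu E" and h: "\<And>P. ae B P \<longleftrightarrow> ae E (\<lambda>p. P (h p))"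
  obtains i where "elementary_embedding (ultrapower B) (ultrapower E) i"
    "\<And>f. i (cls B f) = cls E (\<lambda>p. f (h p))"
proof -
  define i where "i w = cls E (\<lambda>p. (SOME f. w = cls B f) (h p))" for w
  have i: "i (cls B f) = cls E (\<lambda>p. f (h p))" for f
  proof -
    define f' where "f' = (SOME f'. cls B f = cls B f')"
    have "cls B f = cls B f'" unfolding f'_def by (rule someI[of "\<lambda>f'. cls B f = cls B f'"]) (rule refl)
    then have "ae E (\<lambda>p. f' (h p) = f (h p))"
      using h[of "\<lambda>x. f' x = f x"] by (metis cls_eq_iff[OF B])
    then show ?thesis unfolding i_def f'_def[symmetric] by (rule cls_cong[OF E])
  qed
  have "elementary_embedding (ultrapower B) (ultrapower E) i"
    by (rule elementary_mapI[OF B E, where i = i and g = "\<lambda>f p. f (h p)"]) (simp_all add: i h)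
  then show ?thesis using i by (rule that)
qed

text \<open>Two presentations of one model with the same embedding of \<open>V\<close>, given by the
  constant functions. An element represented by \<open>h\<close> and \<open>h'\<close> has the same
  derived ultrafilter on both sides, and \<open>f\<close> composed with either represents the value
  of the image of \<open>f\<close> at that element.\<close>

lemma
  fixes E E' :: "'v::zfc_universe"
  assumes E: "ccu E" and E': "ccu E'" and M: "ultrapower E = ultrapower E'"
    and c: "\<And>x. cls E (\<lambda>_. x) = cls E' (\<lambda>_. x)" and h: "cls E h = cls E' h'"
  shows agree_ae: "ae E (\<lambda>p. P (h p)) \<longleftrightarrow> ae E' (\<lambda>p. P (h' p))"
    and agree_cls: "cls E (\<lambda>p. f (h p)) = cls E' (\<lambda>p. f (h' p))"
proof -
  \<comment> \<open>\<open>X\<close> contains all values of \<open>h\<close> and \<open>h'\<close>,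
    so \<open>P\<close> and \<open>f\<close> can be replaced by sets, whose images are classes of
    constant functions.\<close>
  define X where "X = set_of (h ` elts (uspace E) \<union> h' ` elts (uspace E'))"
  have X: "elts X = h ` elts (uspace E) \<union> h' ` elts (uspace E')" by (simp add: X_def)
  have aX: "ae E (\<lambda>p. h p \<in> elts X)" "ae E' (\<lambda>p. h' p \<in> elts X)"
    by (rule ae_all[OF E] ae_all[OF E'], simp add: X)+
  show "ae E (\<lambda>p. P (h p)) \<longleftrightarrow> ae E' (\<lambda>p. P (h' p))"
  proof -
    have "ae E (\<lambda>p. P (h p)) \<longleftrightarrow> ae E (\<lambda>p. h p \<in> elts (set_of {x \<in> elts X. P x}))"
      using aX(1) by (simp add: ae_conj[OF E])
    also have "\<dots> \<longleftrightarrow> ae E' (\<lambda>p. h' p \<in> elts (set_of {x \<in> elts X. P x}))"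
      unfolding cls_mem_iff[OF E, symmetric] cls_mem_iff[OF E', symmetric] h c ..
    also have "\<dots> \<longleftrightarrow> ae E' (\<lambda>p. P (h' p))"
      using aX(2) by (simp add: ae_conj[OF E'])
    finally show ?thesis .
  qed
  have "cls E (\<lambda>p. f (h p)) \<in> ultrapower E'" using M cls_in by metis
  then obtain t where t: "cls E (\<lambda>p. f (h p)) = cls E' t" by (rule ultrapowerE)
  have "ae E (\<lambda>p. opair (h p) (f (h p)) \<in> elts (restr f X))"
    by (rule ae_mono[OF E aX(1)]) simp
  then have "opair (cls E h) (cls E (\<lambda>p. f (h p))) \<in> elts (cls E (\<lambda>_. restr f X))"
    by (simp add: los3[OF E, of "\<lambda>_ a b r. opair a b \<in> elts r", OF fo_opair_mem])
  then have "ae E' (\<lambda>p. opair (h' p) (t p) \<in> elts (restr f X))"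
    unfolding h c t by (simp add: los3[OF E', of "\<lambda>_ a b r. opair a b \<in> elts r", OF fo_opair_mem])
  then have "ae E' (\<lambda>p. t p = f (h' p))" by (rule ae_mono[OF E']) auto
  then show "cls E (\<lambda>p. f (h p)) = cls E' (\<lambda>p. f (h' p))" unfolding t by (rule cls_cong[OF E'])
qed

lemma ordinal_empty: "ordinal (set_of {})"
  by (rule ordinalI) simp_all

text \<open>
  The factor ultrafilters are derived, inside the ultrapower by \<open>U\<close>, from the image of the seed of
  \<open>A\<close> in a comparison of \<open>U\<close> with \<open>A\<close>; the resulting ultrapower lies between that of \<open>A\<close> and the
  model of the comparison.
\<close>

lemma pointed_le_as_ultraproduct:
  fixes \<delta> U :: "'v::zfc_universe"
  assumes UA: "ultrapower_axiom TYPE('v)" and \<delta>: "ordinal \<delta>" and U: "U \<in> Un_le \<delta>"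
    and P: "P \<in> pointed_le \<delta>"
  obtains W \<alpha> where "\<And>x. W x \<in> Un_le \<delta>" "\<And>x. ordinal (\<alpha> x)"
    "seed_le P (ultrapower (usum U W), cls U \<alpha>)" "seed_le (ultrapower (usum U W), cls U \<alpha>) P"
proof -
  obtain A \<beta> where A: "A \<in> Un_le \<delta>" and \<beta>: "ordinal \<beta>" and P: "P = (ultrapower A, \<beta>)"
    using P by (auto simp: pointed_le_def)
  note cU = Un_le_ccu[OF U] and cA = Un_le_ccu[OF A]
  obtain z y where z: "\<And>x. ccu (z x)" and y: "\<And>x. ccu (y x)"
    and N: "ultrapower (usum U z) = ultrapower (usum A y)"
    and c: "\<And>x. cls (usum U z) (\<lambda>_. x) = cls (usum A y) (\<lambda>_. x)"
    by (rule ua_compare[OF UA cU cA]) (rule that)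
  note Sz = ccu_usum[OF cU z] and Sy = ccu_usum[OF cA y]
  \<comment> \<open>\<open>pfst\<close> represents the image of the seed of \<open>A\<close> in the
    common model, and \<open>h\<close> represents the same element over \<open>U\<close>.\<close>
  have "cls (usum A y) pfst \<in> ultrapower (usum U z)" unfolding N by (rule cls_in)
  then obtain h where h: "cls (usum A y) pfst = cls (usum U z) h" by (rule ultrapowerE)
  note agree = agree_ae[OF Sz Sy N c h[symmetric]] agree_cls[OF Sz Sy N c h[symmetric]]
  have hA: "ae (usum U z) (\<lambda>p. Q (h p)) \<longleftrightarrow> ae A Q" for Q
    unfolding agree(1) by (simp add: ae_usum[OF cA y] ae_const[OF y])
  have "ae A (\<lambda>x. x \<in> elts \<delta>)" by (rule ae_all[OF cA]) (use A in \<open>auto simp: Un_le_def\<close>)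
  then have hd: "ae U (\<lambda>x. ae (z x) (\<lambda>v. h (opair x v) \<in> elts \<delta>))"
    unfolding hA[symmetric] ae_usum[OF cU z] .
  \<comment> \<open>For almost every \<open>x\<close> the image of \<open>z x\<close> under
    \<open>h\<close> concentrates on \<delta>, and it is taken as \<open>W x\<close> in uniform
    form; at the exceptional \<open>x\<close>, \<open>U\<close> itself serves as a default member of
    \<open>Un_le \<delta>\<close>.\<close>
  have "\<exists>W. W \<in> Un_le \<delta> \<and> (ae (z x) (\<lambda>v. h (opair x v) \<in> elts \<delta>) \<longrightarrow>
      (\<forall>Q. ae W Q \<longleftrightarrow> ae (z x) (\<lambda>v. Q (h (opair x v)))))" for x
  proof (cases "ae (z x) (\<lambda>v. h (opair x v) \<in> elts \<delta>)")
    case True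
    obtain W where "W \<in> Un_le \<delta>" "\<And>Q. ae W Q = ae (z x) (\<lambda>v. Q (h (opair x v)))"
      by (rule uniform_uf[OF ccq_map[OF ccq_ae[OF z], of x "\<lambda>v. h (opair x v)"] True \<delta>]) (rule that)
    then show ?thesis by blast
  qed (use U in blast)
  then obtain W where W: "\<And>x. W x \<in> Un_le \<delta>"
    and Wh: "\<And>x Q. ae (z x) (\<lambda>v. h (opair x v) \<in> elts \<delta>) \<Longrightarrow>
      ae (W x) Q \<longleftrightarrow> ae (z x) (\<lambda>v. Q (h (opair x v)))" by metis
  note cW = Un_le_ccu[OF W]
  define E where "E = usum U W"
  have E: "ccu E" unfolding E_def by (rule ccu_usum[where D = U and z = W, OF cU cW])
  have EH: "ae E Q \<longleftrightarrow> ae (usum U z) (\<lambda>p. Q (opair (pfst p) (h p)))" for Q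
  proof -
    have "ae U (\<lambda>x. ae (W x) (\<lambda>w. Q (opair x w)) = ae (z x) (\<lambda>v. Q (opair x (h (opair x v)))))"
      by (rule ae_mono[OF cU hd]) (rule Wh)
    then show ?thesis unfolding E_def ae_usum[where D = U and z = W, OF cU cW] ae_usum[OF cU z] pfst_opair
      by (rule ae_iff[OF cU])
  qed
  obtain i where i: "elementary_embedding (ultrapower E) (ultrapower (usum U z)) i"
    "\<And>f. i (cls E f) = cls (usum U z) (\<lambda>p. f (opair (pfst p) (h p)))"
    by (rule pushforward_elementary[OF E Sz EH]) (rule that)
  have AE: "ae A Q \<longleftrightarrow> ae E (\<lambda>p. Q (psnd p))" for Q
    unfolding EH psnd_opair hA ..
  obtain e where e: "elementary_embedding (ultrapower A) (ultrapower E) e"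
    "\<And>f. e (cls A f) = cls E (\<lambda>p. f (psnd p))"
    by (rule pushforward_elementary[OF cA E AE]) (rule that)
  \<comment> \<open>The composition of \<open>e\<close> and \<open>i\<close> is the internal
    embedding of the model of \<open>A\<close> into the common model. Hence \<open>e\<close> with
    the identity witnesses one inequality, and \<open>i\<close> with this internal embedding the
    other.\<close>
  have ie: "i (e (cls A f)) = cls (usum A y) (\<lambda>p. f (pfst p))" for f
    unfolding e i psnd_opair by (rule agree(2))
  note \<beta>A = ordinal_in_ultrapower[OF cA \<beta>]
  obtain b where b: "\<beta> = cls A b" using \<beta>A by (rule ultrapowerE)
  have oe: "ordinal (e \<beta>)"
    by (rule elementary_ordinal(1)[OF e(1) nice_ultrapower[OF cA] nice_ultrapower[OF E] \<beta> \<beta>A])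
  have "e \<beta> = cls U (\<lambda>x. cls (W x) (\<lambda>v. b v))"
    unfolding b e E_def by (simp add: cls_usum[where D = U and z = W, OF cU cW])
  moreover from this have "ae U (\<lambda>x. ordinal (cls (W x) (\<lambda>v. b v)))"
    using oe by (simp add: ordinal_cls[OF cU])
  ultimately obtain \<alpha> where \<alpha>: "\<And>x. ordinal (\<alpha> x)" "cls U \<alpha> = e \<beta>"
    using family_everywhere[OF cU, of ordinal "\<lambda>x. cls (W x) (\<lambda>v. b v)" "set_of {}"] ordinal_empty by metis
  show ?thesis
  proof (rule that[OF W \<alpha>(1)])
    show "seed_le P (ultrapower (usum U W), cls U \<alpha>)"
      unfolding seed_le_def seed_rel_def P \<alpha>(2) E_def[symmetric]
      by (intro exI[of _ "ultrapower E"] exI[of _ e] exI[of _ "\<lambda>x. x"]) (simp add: e(1) internal_id[OF E])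
    show "seed_le (ultrapower (usum U W), cls U \<alpha>) P"
      unfolding seed_le_def P b seed_rel_iff[OF cA] \<alpha>(2) E_def[symmetric]
      using y i(1) ie unfolding N b by blast
  qed
qed

text \<open>Induction along the seed order, comparing elements. An element of the right side is at
  most the ranks of predecessors chosen for almost every \<open>x\<close>, whose ultraproduct is a
  predecessor on the left. Conversely a predecessor on the left is equivalent to an ultraproduct,
  whose factors are predecessors almost everywhere: otherwise totality gives the reverse inequality
  almost everywhere, and this passes to the ultraproducts.\<close>

lemma pointed_rank_ultraproduct:
  fixes \<delta> U :: "'v::zfc_universe"
  assumes UA: "ultrapower_axiom TYPE('v)" and \<delta>: "ordinal \<delta>" and U: "U \<in> Un_le \<delta>"
  shows "(\<And>x. W x \<in> Un_le \<delta>) \<Longrightarrow> (\<And>x. ordinal (\<alpha> x)) \<Longrightarrow>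
    pointed_rank \<delta> (ultrapower (usum U W), cls U \<alpha>) = cls U (\<lambda>x. pointed_rank \<delta> (ultrapower (W x), \<alpha> x))"
proof (induction "(ultrapower (usum U W), cls U \<alpha>)" arbitrary: W \<alpha>
    rule: wf_induct_rule[OF wf_seed_pred[of \<delta>]])
  case (1 W \<alpha>)
  note cU = Un_le_ccu[OF U]
  define r where "r = pointed_rank \<delta>"
  define ult :: "('v \<Rightarrow> 'v) \<Rightarrow> ('v \<Rightarrow> 'v) \<Rightarrow> 'v pointed" where "ult W \<alpha> = (ultrapower (usum U W), cls U \<alpha>)" for W \<alpha>
  have ult_le: "ult V \<gamma> \<in> pointed_le \<delta>"
    if "\<And>x. V x \<in> Un_le \<delta>" "\<And>x. ordinal (\<gamma> x)" for V \<gamma>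
    unfolding ult_def
    by (rule ultraproduct_pointed_le[where U = U and W = V, OF \<delta> U that(1)])
      (simp add: ordinal_cls[OF cU] that(2) ae_const[OF cU])
  have ult_rel: "seed_rel S (ult V \<gamma>) (ult V' \<gamma>')"
    if "\<And>x. V x \<in> Un_le \<delta>" "\<And>x. ordinal (\<gamma> x)" "\<And>x. V' x \<in> Un_le \<delta>" "\<And>x. ordinal (\<gamma>' x)"
      "ae U (\<lambda>x. seed_rel S (ultrapower (V x), \<gamma> x) (ultrapower (V' x), \<gamma>' x))"
      "fo (\<lambda>M e. S (e 0) (e (Suc 0)))" for S V \<gamma> V' \<gamma>'
    unfolding ult_def
    by (rule seed_rel_ultraproduct[where U = U and W = V and W' = V', OF cU Un_le_ccu[OF that(1)] Un_le_ccu[OF that(3)] that(6)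
        ordinal_in_ultrapower[OF Un_le_ccu[OF that(1)] that(2)]
        ordinal_in_ultrapower[OF Un_le_ccu[OF that(3)] that(4)] that(5)])
  note W = "1.prems"(1) and \<alpha> = "1.prems"(2)
  have IH: "r (ult V \<gamma>) = cls U (\<lambda>x. r (ultrapower (V x), \<gamma> x))"
    if "seed_less (ult V \<gamma>) (ult W \<alpha>)" "\<And>x. V x \<in> Un_le \<delta>" "\<And>x. ordinal (\<gamma> x)" for V \<gamma>
    unfolding r_def ult_def
    by (rule "1.hyps") (use that ult_le[OF that(2,3)] in \<open>simp_all add: seed_pred_def ult_def\<close>)
  have pWx: "pup (ultrapower (W x), \<alpha> x)" for x by (rule pupI[OF Un_le_ccu[OF W] \<alpha>])
  have pW: "pup (ult W \<alpha>)" by (rule pointed_le_pup, rule ult_le, rule W, rule \<alpha>)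
  note elts_r = elts_pointed_rank[OF UA, of _ \<delta>, folded r_def]
  define \<rho> where "\<rho> x = r (ultrapower (W x), \<alpha> x)" for x
  have ord\<rho>: "ordinal (cls U \<rho>)"
    unfolding ordinal_cls[OF cU] \<rho>_def r_def
    by (rule ae_all[OF cU]) (rule ordinal_pointed_rank[OF UA pWx])
  have ordQ: "ordinal (r (ult W \<alpha>))"
    unfolding r_def by (rule ordinal_pointed_rank[OF UA pW])
  have "elts (r (ult W \<alpha>)) = elts (cls U \<rho>)"
  proof (intro subset_antisym subsetI)
    fix \<gamma> assume "\<gamma> \<in> elts (cls U \<rho>)"
    then obtain g where g: "\<gamma> = cls U g" "ae U (\<lambda>x. g x \<in> elts (\<rho> x))" by (auto simp: elts_cls[OF cU])
    define good where "good x V \<epsilon> \<longleftrightarrow> V \<in> Un_le \<delta> \<and> ordinal \<epsilon> \<and>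
        seed_less (ultrapower V, \<epsilon>) (ultrapower (W x), \<alpha> x) \<and>
        (g x = r (ultrapower V, \<epsilon>) \<or> g x \<in> elts (r (ultrapower V, \<epsilon>)))" for x V \<epsilon>
    have "ae U (\<lambda>x. \<exists>V \<epsilon>. good x V \<epsilon>)"
    proof (rule ae_mono[OF cU g(2)])
      fix x assume "g x \<in> elts (\<rho> x)"
      then obtain P where "P \<in> pointed_le \<delta>" "seed_less P (ultrapower (W x), \<alpha> x)"
        "g x = r P \<or> g x \<in> elts (r P)"
        unfolding \<rho>_def elts_r[OF pWx] by blast
      then show "\<exists>V \<epsilon>. good x V \<epsilon>" unfolding good_def pointed_le_def by blast
    qed
    then obtain V0 \<epsilon>0 where ve: "ae U (\<lambda>x. good x (V0 x) (\<epsilon>0 x))" unfolding ae_ex_choice[OF cU] by blast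
    define V where "V x = (if good x (V0 x) (\<epsilon>0 x) then V0 x else U)" for x
    define \<epsilon> where "\<epsilon> x = (if good x (V0 x) (\<epsilon>0 x) then \<epsilon>0 x else set_of {})" for x
    have V: "V x \<in> Un_le \<delta>" and \<epsilon>: "ordinal (\<epsilon> x)" for x
      by (auto simp: V_def \<epsilon>_def good_def U ordinal_empty)
    have gd: "ae U (\<lambda>x. good x (V x) (\<epsilon> x))"
      by (rule ae_mono[OF cU ve]) (simp add: V_def \<epsilon>_def)
    have less: "seed_less (ult V \<epsilon>) (ult W \<alpha>)"
      unfolding seed_less_eq
      by (rule ult_rel, rule V, rule \<epsilon>, rule W, rule \<alpha>)
        (rule ae_mono[OF cU gd], simp add: good_def seed_less_eq, rule fo_mem)
    have lV: "ult V \<epsilon> \<in> pointed_le \<delta>" by (rule ult_le, rule V, rule \<epsilon>)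
    have rV: "r (ult V \<epsilon>) = cls U (\<lambda>x. r (ultrapower (V x), \<epsilon> x))"
      by (rule IH, rule less, rule V, rule \<epsilon>)
    have "ae U (\<lambda>x. g x = r (ultrapower (V x), \<epsilon> x) \<or> g x \<in> elts (r (ultrapower (V x), \<epsilon> x)))"
      by (rule ae_mono[OF cU gd]) (simp add: good_def)
    then have "\<gamma> = r (ult V \<epsilon>) \<or> \<gamma> \<in> elts (r (ult V \<epsilon>))"
      unfolding g(1) rV cls_eq_iff[OF cU] cls_mem_iff[OF cU] ae_disj[OF cU] .
    moreover have "r (ult V \<epsilon>) \<in> elts (r (ult W \<alpha>))"
      unfolding r_def by (rule pointed_rank_less[OF UA lV less pW])
    ultimately show "\<gamma> \<in> elts (r (ult W \<alpha>))" using ordinal_transitive[OF ordQ] by metis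
  next
    fix \<gamma> assume "\<gamma> \<in> elts (r (ult W \<alpha>))"
    then obtain P where P: "P \<in> pointed_le \<delta>" "seed_less P (ult W \<alpha>)"
      "\<gamma> = r P \<or> \<gamma> \<in> elts (r P)"
      unfolding elts_r[OF pW] by blast
    obtain V \<epsilon> where V: "\<And>x. V x \<in> Un_le \<delta>" and \<epsilon>: "\<And>x. ordinal (\<epsilon> x)"
      and le': "seed_le P (ultrapower (usum U V), cls U \<epsilon>)" "seed_le (ultrapower (usum U V), cls U \<epsilon>) P"
      by (rule pointed_le_as_ultraproduct[OF UA \<delta> U P(1)], rule that[rotated 2])
    note le = le'[folded ult_def]
    have lV: "ult V \<epsilon> \<in> pointed_le \<delta>" by (rule ult_le, rule V, rule \<epsilon>)
    have pVx: "pup (ultrapower (V x), \<epsilon> x)" for x by (rule pupI[OF Un_le_ccu[OF V] \<epsilon>])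
    note pP = pointed_le_pup[OF P(1)] and pV = pointed_le_pup[OF lV]
    have less: "seed_less (ult V \<epsilon>) (ult W \<alpha>)" by (rule seed_le_less_trans[OF le(2) P(2) pV pP pW])
    have "ae U (\<lambda>x. seed_less (ultrapower (V x), \<epsilon> x) (ultrapower (W x), \<alpha> x))"
    proof (rule ccontr)
      assume "\<not> ?thesis"
      then have "ae U (\<lambda>x. \<not> seed_less (ultrapower (V x), \<epsilon> x) (ultrapower (W x), \<alpha> x))"
        by (simp add: ae_not[OF cU])
      then have le_x: "ae U (\<lambda>x. seed_le (ultrapower (W x), \<alpha> x) (ultrapower (V x), \<epsilon> x))"
        by (rule ae_mono[OF cU])
          (use seed_total[OF UA pVx pWx] in blast)
      have "seed_le (ult W \<alpha>) (ult V \<epsilon>)"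
        unfolding seed_le_def
        by (rule ult_rel, rule W, rule \<alpha>, rule V, rule \<epsilon>, rule le_x[unfolded seed_le_def], rule fo_le)
      then show False using not_seed_less_le[OF less _ pV pW] by blast
    qed
    then have "ae U (\<lambda>x. r (ultrapower (V x), \<epsilon> x) \<in> elts (\<rho> x))"
    proof (rule ae_mono[OF cU])
      fix x assume less_x: "seed_less (ultrapower (V x), \<epsilon> x) (ultrapower (W x), \<alpha> x)"
      have "(ultrapower (V x), \<epsilon> x) \<in> pointed_le \<delta>" unfolding pointed_le_def using V \<epsilon> by blast
      then show "r (ultrapower (V x), \<epsilon> x) \<in> elts (\<rho> x)"
        unfolding r_def \<rho>_def by (rule pointed_rank_less[OF UA _ less_x pWx])
    qed
    moreover have "r (ult V \<epsilon>) = cls U (\<lambda>x. r (ultrapower (V x), \<epsilon> x))"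
      by (rule IH, rule less, rule V, rule \<epsilon>)
    ultimately have "r (ult V \<epsilon>) \<in> elts (cls U \<rho>)" by (simp add: cls_mem_iff[OF cU])
    moreover have "r P = r (ult V \<epsilon>)"
      unfolding r_def by (rule pointed_rank_eq[OF UA le pP pV])
    ultimately show "\<gamma> \<in> elts (cls U \<rho>)" using P(3) ordinal_transitive[OF ord\<rho>] by metis
  qed
  then show ?case unfolding r_def \<rho>_def[abs_def] ult_def by (rule extensionality)
qed

section \<open>The internal relation\<close>

text \<open>
  Combinatorially, \<open>U\<close> is internal to \<open>W\<close> iff the product of \<open>U\<close> and \<open>W\<close> is, with the two factors
  exchanged, a sum over \<open>W\<close>.
\<close>

definition commutes :: "'v::zfc_universe \<Rightarrow> 'v \<Rightarrow> bool" where
  "commutes U W \<longleftrightarrow> (\<exists>d. (\<forall>y. ccu (d y)) \<and>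
     (\<forall>R. ae W (\<lambda>y. ae (d y) (\<lambda>x. R x y)) \<longleftrightarrow> ae U (\<lambda>x. ae W (\<lambda>y. R x y))))"

lemma j_ult_cls: "ccu U \<Longrightarrow> ccu W \<Longrightarrow> j_ult U (cls W g) = cls (usum U (\<lambda>_. W)) (\<lambda>p. g (psnd p))"
  by (simp add: j_ult_eq cls_usum)

context
  fixes U W :: "'v::zfc_universe"
  assumes U: "ccu U" and W: "ccu W"
begin

lemma ae_prod: "ae (usum U (\<lambda>_. W)) P \<longleftrightarrow> ae U (\<lambda>x. ae W (\<lambda>y. P (opair x y)))"
  by (rule ae_usum[OF U W])

lemma commutes_flip:
  assumes d: "\<And>y. ccu (d y)"
    and R: "\<And>R. ae W (\<lambda>y. ae (d y) (\<lambda>x. R x y)) \<longleftrightarrow> ae U (\<lambda>x. ae W (\<lambda>y. R x y))"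
  shows "ultrapower (usum U (\<lambda>_. W)) = ultrapower (usum W d)"
    and "cls (usum U (\<lambda>_. W)) F = cls (usum W d) (\<lambda>p. F (opair (psnd p) (pfst p)))"
proof -
  note E = ccu_usum[where D = U and z = "\<lambda>_. W", OF U W] and E' = ccu_usum[OF W d]
  have h: "ae (usum U (\<lambda>_. W)) P \<longleftrightarrow> ae (usum W d) (\<lambda>p. P (opair (psnd p) (pfst p)))" for P
    unfolding ae_prod ae_usum[OF W d] psnd_opair pfst_opair using R[of "\<lambda>x y. P (opair x y)"] ..
  have g: "ae (usum W d) (\<lambda>p. opair (psnd (opair (psnd p) (pfst p))) (pfst (opair (psnd p) (pfst p))) = p)"
    unfolding ae_usum[OF W d] by (simp add: ae_const[OF W] ae_const[OF d])
  show "ultrapower (usum U (\<lambda>_. W)) = ultrapower (usum W d)"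
    by (rule ultrapower_pushforward_inj[OF E E' h, of "\<lambda>p. opair (psnd p) (pfst p)"]) (rule g)
  show "cls (usum U (\<lambda>_. W)) F = cls (usum W d) (\<lambda>p. F (opair (psnd p) (pfst p)))"
    by (rule cls_pushforward_inj[OF E E' h, of "\<lambda>p. opair (psnd p) (pfst p)"]) (rule g)
qed

text \<open>The exchange of factors presents \<open>j_ult U\<close> on the model of \<open>W\<close>
  as the ultraproduct of the embeddings \<open>j_ult (d y)\<close>. Its restriction to
  \<open>cls W X\<close> is then the class of the restrictions to the \<open>X y\<close>.\<close>

lemma commutes_imp_internal_rel:
  assumes "commutes U W"
  shows "internal_rel U W"
  unfolding internal_rel_def
proof
  obtain d where d: "\<And>y. ccu (d y)"
    and R: "\<And>R. ae W (\<lambda>y. ae (d y) (\<lambda>x. R x y)) \<longleftrightarrow> ae U (\<lambda>x. ae W (\<lambda>y. R x y))"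
    using assms unfolding commutes_def by blast
  have j: "j_ult U (cls W g) = cls W (\<lambda>y. j_ult (d y) (g y))" for g
    unfolding j_ult_cls[OF U W] commutes_flip(2)[OF d R] by (simp add: cls_usum[OF W d] j_ult_eq)
  note op = opair_cls[OF W]
  fix w assume "w \<in> ultrapower W"
  then obtain X where X: "w = cls W X" by (rule ultrapowerE)
  have "restr (j_ult U) w = cls W (\<lambda>y. restr (j_ult (d y)) (X y))"
  proof (rule extensionality, intro subset_antisym subsetI)
    fix p assume "p \<in> elts (restr (j_ult U) w)"
    then obtain g where g: "p = opair (cls W g) (j_ult U (cls W g))" "ae W (\<lambda>y. g y \<in> elts (X y))"
      by (auto simp: X elts_cls[OF W])
    show "p \<in> elts (cls W (\<lambda>y. restr (j_ult (d y)) (X y)))"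
      unfolding g(1) j op cls_mem_iff[OF W] by (rule ae_mono[OF W g(2)]) simp
  next
    fix p assume "p \<in> elts (cls W (\<lambda>y. restr (j_ult (d y)) (X y)))"
    then obtain k where k: "p = cls W k" "ae W (\<lambda>y. k y \<in> elts (restr (j_ult (d y)) (X y)))"
      by (auto simp: elts_cls[OF W])
    have "ae W (\<lambda>y. \<exists>a. a \<in> elts (X y) \<and> k y = opair a (j_ult (d y) a))"
      by (rule ae_mono[OF W k(2)]) auto
    then obtain g where g: "ae W (\<lambda>y. g y \<in> elts (X y))" "ae W (\<lambda>y. k y = opair (g y) (j_ult (d y) (g y)))"
      unfolding ae_ex_choice[OF W] ae_conj[OF W] by blast
    have "p = opair (cls W g) (j_ult U (cls W g))"
      unfolding k(1) j op by (rule cls_cong[OF W g(2)])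
    moreover have "cls W g \<in> elts w" unfolding X cls_mem_iff[OF W] by (rule g(1))
    ultimately show "p \<in> elts (restr (j_ult U) w)" by simp
  qed
  then show "restr (j_ult U) w \<in> ultrapower W" by simp
qed

text \<open>No single \<open>F y\<close> is assumed to be an ultrafilter. Each clause of
  \<open>ccq\<close> quantifies over predicates, and a choice of one predicate for each
  \<open>y\<close> is a relation to which \<open>F\<close> applies; the clause then follows from
  completeness of \<open>U\<close> and \<open>W\<close>.\<close>

lemma ae_ccq_family:
  assumes F: "\<And>R. ae W (\<lambda>y. F y (\<lambda>x. R x y)) \<longleftrightarrow> ae U (\<lambda>x. ae W (\<lambda>y. R x y))"
  shows "ae W (\<lambda>y. ccq (F y))"
  unfolding ccq_def ae_conj[OF W] ae_all_choice[OF W]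
proof (intro conjI allI)
  have F': "ae W (\<lambda>y. F y (P y)) \<longleftrightarrow> ae U (\<lambda>x. ae W (\<lambda>y. P y x))" for P
    using F[of "\<lambda>x y. P y x"] .
  fix P Q :: "'v \<Rightarrow> 'v \<Rightarrow> bool"
  show "ae W (\<lambda>y. (\<forall>x. P y x \<longrightarrow> Q y x) \<longrightarrow> F y (P y) \<longrightarrow> F y (Q y))"
    unfolding ae_imp[OF W] F'
  proof (intro impI)
    assume PQ: "ae W (\<lambda>y. \<forall>x. P y x \<longrightarrow> Q y x)" and P: "ae U (\<lambda>x. ae W (\<lambda>y. P y x))"
    show "ae U (\<lambda>x. ae W (\<lambda>y. Q y x))"
      by (rule ae_mono[OF U P], erule ae_mp[OF W PQ]) blast
  qed
  have "ae W (\<lambda>y. F y (\<lambda>x. \<not> P y x)) \<longleftrightarrow> ae W (\<lambda>y. \<not> F y (P y))"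
    unfolding ae_not[OF W] F' ae_not[OF U] ..
  then show "ae W (\<lambda>y. F y (\<lambda>x. \<not> P y x) = (\<not> F y (P y)))"
    by (simp add: iff_conv_conj_imp ae_conj[OF W] ae_imp[OF W])
next
  fix P :: "'v \<Rightarrow> nat \<Rightarrow> 'v \<Rightarrow> bool"
  have F': "ae W (\<lambda>y. F y (P y)) \<longleftrightarrow> ae U (\<lambda>x. ae W (\<lambda>y. P y x))" for P
    using F[of "\<lambda>x y. P y x"] .
  show "ae W (\<lambda>y. (\<forall>n. F y (P y n)) \<longrightarrow> F y (\<lambda>x. \<forall>n. P y n x))"
    unfolding ae_imp[OF W] ae_nat[OF W] F' ae_nat[OF U] by blast
qed

text \<open>Passes from the quantifiers \<open>F y\<close> to ultrafilters: almost every
  \<open>F y\<close> is countably complete and concentrates on the set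
  \<open>uspace U\<close>.\<close>

lemma commutesI:
  assumes F: "\<And>R. ae W (\<lambda>y. F y (\<lambda>x. R x y)) \<longleftrightarrow> ae U (\<lambda>x. ae W (\<lambda>y. R x y))"
  shows "commutes U W"
proof -
  have sp: "ae W (\<lambda>y. F y (\<lambda>x. x \<in> elts (uspace U)))"
    unfolding F by (rule ae_mono[OF U ae_uspace[OF U]]) (simp add: ae_const[OF W])
  define d where "d y = (if ccq (F y) \<and> F y (\<lambda>x. x \<in> elts (uspace U)) then mk_uf (uspace U) (F y) else trivial_uf)"
    for y
  have "ccu (d y)" for y by (auto simp: d_def ccu_trivial_uf ccu_mk_uf)
  moreover have "ae W (\<lambda>y. ae (d y) (\<lambda>x. R x y)) \<longleftrightarrow> ae W (\<lambda>y. F y (\<lambda>x. R x y))" for R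
  proof (rule ae_iff[OF W], rule ae_mp[OF W ae_ccq_family[OF F] sp])
    fix y assume "ccq (F y)" "F y (\<lambda>x. x \<in> elts (uspace U))"
    then show "ae (d y) (\<lambda>x. R x y) \<longleftrightarrow> F y (\<lambda>x. R x y)" by (simp add: d_def ae_mk_uf)
  qed
  ultimately show ?thesis unfolding commutes_def F by blast
qed

text \<open>The model of \<open>W\<close> contains the restriction \<open>J\<close> of
  \<open>j_ult U\<close> to the image of the power set of \<open>uspace U\<close>, and also a point
  \<open>a\<close> from which to derive an ultrafilter. Evaluating \<open>J\<close> and
  \<open>a\<close> at an index \<open>y\<close> gives the quantifier \<open>F y\<close>.\<close>

lemma internal_rel_imp_commutes:
  assumes I: "internal_rel U W" and ord: "ordinal (uspace U)"
  shows "commutes U W"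
proof -
  note E = ccu_usum[where D = U and z = "\<lambda>_. W", OF U W]
  define \<Pi> where "\<Pi> = set_of {A. elts A \<subseteq> elts (uspace U)}"
  have \<Pi>: "elts \<Pi> = {A. elts A \<subseteq> elts (uspace U)}" by (simp add: \<Pi>_def)
  have "restr (j_ult U) (cls W (\<lambda>_. \<Pi>)) \<in> ultrapower W" using I unfolding internal_rel_def by simp
  then obtain J where J: "restr (j_ult U) (cls W (\<lambda>_. \<Pi>)) = cls W J" by (rule ultrapowerE)
  have func: "ae W (\<lambda>y. function_on (J y) \<Pi>)"
    using los2[OF W, of "\<lambda>_. function_on" J "\<lambda>_. \<Pi>", OF fo_function_on] J
    by (metis function_on_restr)
  \<comment> \<open>The point is represented modulo \<open>U\<close> by the map from
    \<open>x\<close> to \<open>j_ult W x\<close> and not by the identity, since the sets to be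
    measured are subsets of the image of \<open>uspace U\<close> under \<open>j_ult W\<close>. It is
    an ordinal because \<open>uspace U\<close> is one, and therefore lies in the model of
    \<open>W\<close>.\<close>
  have "ordinal (cls U (\<lambda>x. cls W (\<lambda>_. x)))"
    unfolding ordinal_cls[OF U]
    by (rule ae_all[OF U]) (simp add: ordinal_cls[OF W] ae_const[OF W] ordinal_mem[OF ord])
  then have "ordinal (cls (usum U (\<lambda>_. W)) pfst)" by (simp add: cls_usum[OF U W])
  then have "cls (usum U (\<lambda>_. W)) pfst \<in> ultrapower W" by (rule ordinal_in_ultrapower[OF W])
  then obtain a where a: "cls (usum U (\<lambda>_. W)) pfst = cls W a" by (rule ultrapowerE)
  define F where "F y P \<longleftrightarrow> a y \<in> elts (app (J y) (set_of {x \<in> elts (uspace U). P x}))" for y P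
  show ?thesis
  proof (rule commutesI)
    fix R :: "'v \<Rightarrow> 'v \<Rightarrow> bool"
    define A where "A y = set_of {x \<in> elts (uspace U). R x y}" for y
    have A: "elts (A y) = {x \<in> elts (uspace U). R x y}" for y by (simp add: A_def)
    have A\<Pi>: "A y \<in> elts \<Pi>" for y by (auto simp: \<Pi> A)
    have "cls W A \<in> elts (cls W (\<lambda>_. \<Pi>))" by (simp add: cls_mem_iff[OF W] A\<Pi> ae_const[OF W])
    then have m: "opair (cls W A) (j_ult U (cls W A)) \<in> elts (cls W J)" unfolding J[symmetric] by simp
    have "opair (cls W A) (j_ult U (cls W A)) \<in> ultrapower W"
      using m ultrapower_transitive[OF W cls_in] by blast
    then have "j_ult U (cls W A) \<in> ultrapower W"
      using opair_in_nice[OF nice_ultrapower[OF W]] by blast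
    then obtain B where B: "j_ult U (cls W A) = cls W B" by (rule ultrapowerE)
    have "ae W (\<lambda>y. opair (A y) (B y) \<in> elts (J y))"
      using m unfolding B los3[OF W, of "\<lambda>_ a b r. opair a b \<in> elts r", OF fo_opair_mem] .
    then have "ae W (\<lambda>y. B y = app (J y) (A y))"
      by (rule ae_mp[OF W func]) (use opair_mem_function A\<Pi> in blast)
    then have "ae W (\<lambda>y. F y (\<lambda>x. R x y) = (a y \<in> elts (B y)))"
      by (rule ae_mono[OF W]) (simp add: F_def A_def)
    then have "ae W (\<lambda>y. F y (\<lambda>x. R x y)) \<longleftrightarrow> ae W (\<lambda>y. a y \<in> elts (B y))" by (rule ae_iff[OF W])
    also have "\<dots> \<longleftrightarrow> cls (usum U (\<lambda>_. W)) pfst \<in> elts (j_ult U (cls W A))"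
      unfolding a B cls_mem_iff[OF W] ..
    also have "\<dots> \<longleftrightarrow> ae U (\<lambda>x. ae W (\<lambda>y. x \<in> elts (A y)))"
      unfolding j_ult_cls[OF U W] cls_mem_iff[OF E] ae_prod by simp
    also have "\<dots> \<longleftrightarrow> ae U (\<lambda>x. ae W (\<lambda>y. R x y))"
      by (rule ae_cong) (simp add: A)
    finally show "ae W (\<lambda>y. F y (\<lambda>x. R x y)) \<longleftrightarrow> ae U (\<lambda>x. ae W (\<lambda>y. R x y))" .
  qed
qed

lemma seed_le_prod:
  "seed_le (ultrapower W, seed W) (ultrapower (usum U (\<lambda>_. W)), j_ult U (seed W))"
proof -
  note E = ccu_usum[where D = U and z = "\<lambda>_. W", OF U W]
  have h: "ae W P \<longleftrightarrow> ae (usum U (\<lambda>_. W)) (\<lambda>p. P (psnd p))" for P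
    by (simp add: ae_prod ae_const[OF U])
  obtain i where i: "elementary_embedding (ultrapower W) (ultrapower (usum U (\<lambda>_. W))) i"
    "\<And>f. i (cls W f) = cls (usum U (\<lambda>_. W)) (\<lambda>p. f (psnd p))"
    by (rule pushforward_elementary[OF W E h]) (rule that)
  show ?thesis unfolding seed_le_def seed_rel_def seed_eq j_ult_cls[OF U W]
    by (intro exI[of _ "ultrapower (usum U (\<lambda>_. W))"] exI[of _ i] exI[of _ "\<lambda>x. x"])
      (simp add: i internal_id[OF E])
qed

text \<open>After the exchange of factors the product is an internal ultrapower of the model of
  \<open>W\<close>, whose embedding maps the seed of \<open>W\<close> to
  \<open>j_ult U (seed W)\<close>.\<close>

lemma commutes_imp_seed_le:
  assumes "commutes U W"
  shows "seed_le (ultrapower (usum U (\<lambda>_. W)), j_ult U (seed W)) (ultrapower W, seed W)"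
proof -
  obtain d where d: "\<And>y. ccu (d y)"
    and R: "\<And>R. ae W (\<lambda>y. ae (d y) (\<lambda>x. R x y)) \<longleftrightarrow> ae U (\<lambda>x. ae W (\<lambda>y. R x y))"
    using assms unfolding commutes_def by blast
  have "j_ult U (seed W) = cls (usum W d) (\<lambda>p. pfst p)"
    unfolding seed_eq j_ult_cls[OF U W] commutes_flip(2)[OF d R] by simp
  then show ?thesis
    unfolding seed_le_def seed_eq seed_rel_iff[OF W] commutes_flip(1)[OF d R]
    by (intro exI[of _ d] exI[of _ "\<lambda>x. x"]) (simp add: d elementary_id)
qed

text \<open>In a comparison of the product with \<open>W\<close>, equal ranks exclude that the
  images of \<open>j_ult U (seed W)\<close> and \<open>seed W\<close> are strictly related, so these
  coincide. The generating pair of the product is then represented over \<open>W\<close> by a pair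
  with second entry \<open>pfst p\<close>, and the images of the \<open>c y\<close> under
  \<open>h\<close> are the factors of the exchanged sum.\<close>

lemma pointed_rank_eq_imp_commutes:
  assumes UA: "ultrapower_axiom TYPE('v)"
    and P: "(ultrapower W, seed W) \<in> pointed_le \<delta>"
    and Q: "(ultrapower (usum U (\<lambda>_. W)), j_ult U (seed W)) \<in> pointed_le \<delta>"
    and eq: "pointed_rank \<delta> (ultrapower (usum U (\<lambda>_. W)), j_ult U (seed W)) =
      pointed_rank \<delta> (ultrapower W, seed W)"
  shows "commutes U W"
proof -
  let ?E = "usum U (\<lambda>_. W)"
  note E = ccu_usum[where D = U and z = "\<lambda>_. W", OF U W]
  obtain z c where z: "\<And>x. ccu (z x)" and c: "\<And>x. ccu (c x)"
    and N: "ultrapower (usum ?E z) = ultrapower (usum W c)"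
    and k: "\<And>x. cls (usum ?E z) (\<lambda>_. x) = cls (usum W c) (\<lambda>_. x)"
    by (rule ua_compare[OF UA E W]) (rule that)
  note Sz = ccu_usum[OF E z] and Sc = ccu_usum[OF W c]
  have js: "j_ult U (seed W) = cls ?E (\<lambda>p. psnd p)" unfolding seed_eq j_ult_cls[OF U W] ..
  let ?s = "cls (usum ?E z) (\<lambda>p. psnd (pfst p))" and ?t = "cls (usum W c) (\<lambda>p. pfst p)"
  obtain i where i: "elementary_embedding (ultrapower ?E) (ultrapower (usum ?E z)) i"
    "\<And>f. i (cls ?E f) = cls (usum ?E z) (\<lambda>p. f (pfst p))"
    using internal_elementary[where z = z, OF E z, of "ult_emb (ultrapower ?E) (cls ?E z)"]
      ult_emb_internal[where z = z, OF E z] by blast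
  obtain l where l: "elementary_embedding (ultrapower W) (ultrapower (usum W c)) l"
    "\<And>f. l (cls W f) = cls (usum W c) (\<lambda>p. f (pfst p))"
    using internal_elementary[where z = c, OF W c, of "ult_emb (ultrapower W) (cls W c)"]
      ult_emb_internal[where z = c, OF W c] by blast
  \<comment> \<open>The comparison itself would witness a strict relation: \<open>i\<close> acts as
    the elementary embedding and the ultrapower by \<open>c\<close> as the internal one. The roles
    are exchanged for the other direction.\<close>
  have "?s \<notin> elts ?t"
  proof
    assume m: "?s \<in> elts ?t"
    have "seed_less (ultrapower ?E, j_ult U (seed W)) (ultrapower W, seed W)"
      unfolding seed_less_eq seed_eq j_ult_cls[OF U W] seed_rel_iff[OF W]
      by (rule exI[of _ c], rule exI[of _ i]) (use c i m in \<open>simp add: N[symmetric]\<close>)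
    then show False
      using pointed_rank_less[OF UA Q _ pointed_le_pup[OF P]] by (simp add: eq not_mem_self)
  qed
  moreover have "?t \<notin> elts ?s"
  proof
    assume m: "?t \<in> elts ?s"
    have "seed_less (ultrapower W, seed W) (ultrapower ?E, j_ult U (seed W))"
      unfolding seed_less_eq seed_eq j_ult_cls[OF U W] seed_rel_iff[OF E]
      by (rule exI[of _ z], rule exI[of _ l]) (use z l m in \<open>simp add: N\<close>)
    then show False
      using pointed_rank_less[OF UA P _ pointed_le_pup[OF Q]] by (simp add: eq not_mem_self)
  qed
  moreover have "ordinal ?s"
  proof -
    have "ordinal (j_ult U (seed W))" using Q by (auto simp: pointed_le_def)
    then show ?thesis unfolding js ordinal_cls[OF E] ordinal_cls[OF Sz] ae_usum[OF E z] pfst_opair ae_const[OF z] .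
  qed
  moreover have "ordinal ?t"
  proof -
    have "ordinal (seed W)" using P by (auto simp: pointed_le_def)
    then show ?thesis unfolding seed_eq ordinal_cls[OF W] ordinal_cls[OF Sc] ae_usum[OF W c] pfst_opair ae_const[OF c] .
  qed
  ultimately have st: "?s = ?t" using ordinal_linear by blast
  \<comment> \<open>\<open>h\<close> represents over \<open>W\<close> the first coordinate of the
    product, which carries \<open>U\<close>.\<close>
  have "cls (usum ?E z) (\<lambda>p. pfst (pfst p)) \<in> ultrapower (usum W c)" unfolding N[symmetric] by (rule cls_in)
  then obtain h where h: "cls (usum ?E z) (\<lambda>p. pfst (pfst p)) = cls (usum W c) h" by (rule ultrapowerE)
  have hh: "cls (usum ?E z) (\<lambda>p. opair (pfst (pfst p)) (psnd (pfst p))) =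
      cls (usum W c) (\<lambda>p. opair (h p) (pfst p))"
    unfolding opair_cls[OF Sz, symmetric] opair_cls[OF Sc, symmetric] h st ..
  show ?thesis
  proof (rule commutesI)
    fix R :: "'v \<Rightarrow> 'v \<Rightarrow> bool"
    show "ae W (\<lambda>y. ae (c y) (\<lambda>v. R (h (opair y v)) y)) \<longleftrightarrow> ae U (\<lambda>x. ae W (\<lambda>y. R x y))"
      using agree_ae[OF Sz Sc N k hh, of "\<lambda>q. R (pfst q) (psnd q)"]
      by (simp add: ae_usum[OF E z] ae_usum[OF W c] ae_const[OF z] ae_prod)
  qed
qed

end

theorem mainTheorem7:
  fixes \<delta> U W :: "'v::zfc_universe"
  assumes "ultrapower_axiom TYPE('v)"
    and "cardinal \<delta>"
    and "U \<in> Un_le \<delta>"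
    and "W \<in> Un_le \<delta>"
  shows "internal_rel U W \<longleftrightarrow> j_ult U (seed_rank \<delta> W) = seed_rank \<delta> W"
proof -
  note UA = assms(1)
  have \<delta>: "ordinal \<delta>" using assms(2) by (simp add: cardinal_def)
  note U = Un_le_ccu[OF assms(3)] and W = Un_le_ccu[OF assms(4)]
  have oU: "ordinal (uspace U)" and oW: "ordinal (uspace W)" using assms(3,4) by (simp_all add: Un_le_def)
  have os: "ordinal (seed W)"
    unfolding seed_eq ordinal_cls[OF W] by (rule ae_all[OF W]) (rule ordinal_mem[OF oW])
  let ?Q = "(ultrapower (usum U (\<lambda>_. W)), j_ult U (seed W))"
  have P: "(ultrapower W, seed W) \<in> pointed_le \<delta>" using assms(4) os by (auto simp: pointed_le_def)
  have Q: "?Q \<in> pointed_le \<delta>"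
    unfolding j_ult_eq
    by (rule ultraproduct_pointed_le[OF \<delta> assms(3,4)]) (simp add: ordinal_cls[OF U] ae_const[OF U] os)
  \<comment> \<open>The constant families \<open>W\<close> and \<open>seed W\<close> give the
    product, whose point \<open>cls U (\<lambda>_. seed W)\<close> is
    \<open>j_ult U (seed W)\<close>; on the right the constant rank gives its image.\<close>
  have rank: "pointed_rank \<delta> ?Q = j_ult U (seed_rank \<delta> W)"
    unfolding j_ult_eq seed_rank_def by (rule pointed_rank_ultraproduct[OF UA \<delta> assms(3,4) os])
  have "internal_rel U W \<longleftrightarrow> commutes U W"
    using internal_rel_imp_commutes[OF U W _ oU] commutes_imp_internal_rel[OF U W] by blast
  also have "\<dots> \<longleftrightarrow> pointed_rank \<delta> ?Q = pointed_rank \<delta> (ultrapower W, seed W)"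
    using pointed_rank_eq_imp_commutes[OF U W UA P Q]
      pointed_rank_eq[OF UA commutes_imp_seed_le[OF U W] seed_le_prod[OF U W] pointed_le_pup[OF Q] pointed_le_pup[OF P]]
    by blast
  finally show ?thesis unfolding rank seed_rank_def .
qed

end
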